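(* Let $m\in(0,1)\cup\mathbb{N}$, $0<\alpha<2m<n$, $\frac{n-\alpha}{n-2m}<p<\infty$, $q_c=\frac{n(p-1)}{2m-\alpha}$, and let $F:\mathbb{R}\to\mathbb{R}$ satisfy $F(0)=0$ and $|F(a)-F(b)|\le C|a-b|(|a|^{p-1}+|b|^{p-1})$ for some constant $C>0$ and all $a,b\in\mathbb{R}$. Let $u_0,v_0$ be two sufficiently small data in $L^{q_c,\infty}(\mathbb{R}^n)$ and let $u,v\in C_b([0,\infty);L^{q_c,\infty}(\mathbb{R}^n))$ be the corresponding small global solutions, with initial data $u_0$ and $v_0$ respectively, of $$u(t)=e^{-t(-\Delta)^m}u_0+\int_0^t e^{-(t-\tau)(-\Delta)^m}|\cdot|^{-\alpha}F(u(\tau))\,d\tau,\qquad t>0. \tag{I}$$ Assume that $\lim_{t\to\infty}\|e^{-t(-\Delta)^m}(u_0-v_0)\|_{L^{q_c,\infty}}=0$. Then $$\lim_{t\to\infty}\|u(t)-v(t)\|_{L^{q_c,\infty}}=0.$$ Moreover, suppose that $2m+\alpha<n$, $p<\frac{2m}{\alpha}$, $q_c<q<\frac{np(p-1)}{2m-\alpha p}$, $\delta=\frac n{2m}\left(\frac1{q_c}-\frac1q\right)$, and that $u,v$ are the corresponding small solutions in $S_q^\delta$ (for $u_0,v_0$ sufficiently small in $L^{q_c,\infty}(\mathbb{R}^n)$, depending on $q$). Then $$\lim_{t\to\infty}t^\delta\|u(t)-v(t)\|_{L^{q,\infty}}=0$$ whenever $\lim_{t\to\infty}t^\delta\|e^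{-t(-\Delta)^m}(u_0-v_0)\|_{L^{q,\infty}}=0$.
   Context: $e^{-t(-\Delta)^m}$ is convolution with the kernel $g_m(\cdot,t)$, $\widehat{g_m}(\xi,t)=e^{-t|\xi|^{2m}}$. For measurable $f$ on $\mathbb{R}^n$ let $f^*(\lambda)=\inf\{\tau>0:|\{|f|>\tau\}|\le\lambda\}$ and $f^{**}(s)=\frac1s\int_0^s f^*(\lambda)\,d\lambda$; for $1<q<\infty$, $\|f\|_{L^{q,\infty}}=\sup_{s>0}s^{1/q}f^{**}(s)$. $C_b([0,\infty);\mathcal X)$ is the space of bounded continuous functions with values in $\mathcal X$, with $[u]_{\mathcal X}=\sup_{t>0}\|u(t)\|_{\mathcal X}$; for weak-Lebesgue spaces the convergence $u(t)\to u_0$ as $t\to0^+$ (continuity at $t=0$) is in the weak-$\star$ sense. $S_q^\delta=\{u\in C_b([0,\infty);L^{q_c,\infty}(\mathbb{R}^n)):t^\delta u\in C_b((0,\infty);L^{q,\infty}(\mathbb{R}^n))\}$ with norm $\|u\|_{S_q^\delta}=[u]_{L^{q_c,\infty}}+\sup_{t>0}t^\delta\|u(t)\|_{L^{q,\infty}}$. Small global solutions: there exist $\varepsilon,\vartheta>0$ such that for $\|u_0\|_{L^{q_c,\infty}}<\varepsilon$ equation (I) has exactly one solution in $\{u\in C_b([0,\infty);L^{q_c,\infty}(\mathbb{R}^n)):[u]_{L^{q_c,\infty}}\le2\vartheta\}$ (with $\vartheta$ proportional to $\varepsilon$, $\varepsilon$ taken as small as needed); this is the solution meant. Likewise, in the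 range of parameters of the second part, there exist $\varepsilon_q\in(0,\varepsilon)$ and $\vartheta_q>0$ such that for $\|u_0\|_{L^{q_c,\infty}}<\varepsilon_q$ equation (I) has exactly one solution with $\|u\|_{S_q^\delta}\le2\vartheta_q$; this is the solution in $S_q^\delta$ meant. *)

theory Defs
  imports "HOL-Analysis.Analysis"
begin

text \<open>Functions on \<open>\<real>\<^sup>n\<close> are represented by functions on \<^typ>\<open>real ^ 'n\<close>, identified only
  through almost-everywhere equality; \<open>n\<close> is \<open>CARD('n)\<close>.\<close>


subsection \<open>Weak Lebesgue spaces\<close>

definition rearrangement :: "(real ^ 'n \<Rightarrow> real) \<Rightarrow> real \<Rightarrow> ennreal" where
  "rearrangement f l =
     Inf {ennreal \<tau> |\<tau>. \<tau> > 0 \<and> emeasure lebesgue {x. \<bar>f x\<bar> > \<tau>} \<le> ennreal l}"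

definition rearrangement_avg :: "(real ^ 'n \<Rightarrow> real) \<Rightarrow> real \<Rightarrow> ennreal" where
  "rearrangement_avg f s = ennreal (1 / s) * (\<integral>\<^sup>+l\<in>{0<..<s}. rearrangement f l \<partial>lborel)"

definition weak_norm :: "real \<Rightarrow> (real ^ 'n \<Rightarrow> real) \<Rightarrow> ennreal" where
  "weak_norm q f = (SUP s\<in>{0<..}. ennreal (s powr (1 / q)) * rearrangement_avg f s)"

definition weak_Lebesgue :: "real \<Rightarrow> (real ^ 'n \<Rightarrow> real) set" where
  "weak_Lebesgue q = {f \<in> borel_measurable lebesgue. weak_norm q f < \<infinity>}"

text \<open>The Lorentz space \<open>L\<^bsup>r,1\<^esup>\<close>. For \<open>1 < q < \<infinity>\<close>, \<open>L\<^bsup>q,\<infinity>\<^esup>\<close> is the dual of \<open>L\<^bsup>q',1\<^esup>\<close>, where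
  \<open>q' = q / (q - 1)\<close>; this is the duality behind weak-star convergence in \<open>L\<^bsup>q,\<infinity>\<^esup>\<close>.\<close>

definition Lorentz1 :: "real \<Rightarrow> (real ^ 'n \<Rightarrow> real) set" where
  "Lorentz1 r = {f \<in> borel_measurable lebesgue.
     (\<integral>\<^sup>+s\<in>{0<..}. ennreal (s powr (1 / r) / s) * rearrangement_avg f s \<partial>lborel) < \<infinity>}"

definition weak_star_tendsto ::
    "real \<Rightarrow> ('b \<Rightarrow> real ^ 'n \<Rightarrow> real) \<Rightarrow> (real ^ 'n \<Rightarrow> real) \<Rightarrow> 'b filter \<Rightarrow> bool" where
  "weak_star_tendsto q u f G \<longleftrightarrow>
     (\<forall>\<phi>\<in>Lorentz1 (q / (q - 1)).
        ((\<lambda>t. \<integral>x. u t x * \<phi> x \<partial>lebesgue) \<longlongrightarrow> (\<integral>x. f x * \<phi> x \<partial>lebesgue)) G)"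


subsection \<open>Bounded continuous functions of time\<close>

definition time_sup :: "real \<Rightarrow> (real \<Rightarrow> real ^ 'n \<Rightarrow> real) \<Rightarrow> ennreal" where
  "time_sup q u = (SUP t\<in>{0<..}. weak_norm q (u t))"

text \<open>\<open>Cb_pos q\<close> is \<open>C\<^sub>b((0,\<infinity>); L\<^bsup>q,\<infinity>\<^esup>)\<close>, with continuity in norm.
  \<open>Cb q\<close> is \<open>C\<^sub>b([0,\<infinity>); L\<^bsup>q,\<infinity>\<^esup>)\<close>, where continuity at \<open>t = 0\<close> is weak-star.
  Values at negative times play no role.\<close>

definition Cb_pos :: "real \<Rightarrow> (real \<Rightarrow> real ^ 'n \<Rightarrow> real) set" where
  "Cb_pos q = {u. (\<forall>t>0. u t \<in> weak_Lebesgue q) \<and> time_sup q u < \<infinity> \<and>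
     (\<forall>t>0. ((\<lambda>s. weak_norm q (\<lambda>x. u s x - u t x)) \<longlongrightarrow> 0) (at t))}"

definition Cb :: "real \<Rightarrow> (real \<Rightarrow> real ^ 'n \<Rightarrow> real) set" where
  "Cb q = {u \<in> Cb_pos q. u 0 \<in> weak_Lebesgue q \<and> weak_star_tendsto q u (u 0) (at_right 0)}"

definition S_space :: "real \<Rightarrow> real \<Rightarrow> real \<Rightarrow> (real \<Rightarrow> real ^ 'n \<Rightarrow> real) set" where
  "S_space qc q \<delta> = {u \<in> Cb qc. (\<lambda>t x. t powr \<delta> * u t x) \<in> Cb_pos q}"

definition S_norm :: "real \<Rightarrow> real \<Rightarrow> real \<Rightarrow> (real \<Rightarrow> real ^ 'n \<Rightarrow> real) \<Rightarrow> ennreal" where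
  "S_norm qc q \<delta> u =
     time_sup qc u + (SUP t\<in>{0<..}. ennreal (t powr \<delta>) * weak_norm q (u t))"


subsection \<open>The semigroup and the integral equation\<close>

text \<open>The kernel with Fourier transform \<open>exp (- t |\<xi>|\<^bsup>2m\<^esup>)\<close>, under the convention
  \<open>\<integral> exp (- i x \<bullet> \<xi>) g(x) dx\<close> for which \<open>- \<Delta>\<close> has symbol \<open>|\<xi>|\<^sup>2\<close>, written as the inverse
  Fourier integral. That integral is real because \<open>\<xi> \<mapsto> |\<xi>|\<close> is even.\<close>

definition heat_kernel :: "real \<Rightarrow> real \<Rightarrow> real ^ 'n \<Rightarrow> real" where
  "heat_kernel m t x = 1 / (2 * pi) ^ CARD('n) *
     Re (\<integral>\<xi>. cis (x \<bullet> \<xi>) * complex_of_real (exp (- t * norm \<xi> powr (2 * m))) \<partial>lebesgue)"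

definition heat :: "real \<Rightarrow> real \<Rightarrow> (real ^ 'n \<Rightarrow> real) \<Rightarrow> real ^ 'n \<Rightarrow> real" where
  "heat m t f x = (\<integral>y. heat_kernel m t (x - y) * f y \<partial>lebesgue)"

definition nonlinearity ::
    "real \<Rightarrow> (real \<Rightarrow> real) \<Rightarrow> (real ^ 'n \<Rightarrow> real) \<Rightarrow> real ^ 'n \<Rightarrow> real" where
  "nonlinearity \<alpha> F w y = norm y powr (- \<alpha>) * F (w y)"

text \<open>The time integral is not a Bochner integral in \<open>L\<^bsup>q,\<infinity>\<^esup>\<close> (the critical norm of the integrand
  is only bounded by a multiple of \<open>1 / (t - \<tau>)\<close>); it is read pointwise, as an
  absolutely convergent integral for almost every \<open>x\<close>. For \<open>u\<close> in \<^term>\<open>Cb q\<close> with \<open>q\<close> the critical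
  exponent, the integrand is continuous in \<open>\<tau> \<in> (0,t)\<close> for each \<open>x\<close> and does not depend on the
  representatives of \<open>u \<tau>\<close>.\<close>

definition mild_solution ::
    "real \<Rightarrow> real \<Rightarrow> (real \<Rightarrow> real) \<Rightarrow> (real ^ 'n \<Rightarrow> real) \<Rightarrow> (real \<Rightarrow> real ^ 'n \<Rightarrow> real) \<Rightarrow> bool"
  where
  "mild_solution m \<alpha> F u\<^sub>0 u \<longleftrightarrow>
     (AE x in lebesgue. u 0 x = u\<^sub>0 x) \<and>
     (\<forall>t>0. AE x in lebesgue.
        set_integrable lborel {0<..<t} (\<lambda>\<tau>. heat m (t - \<tau>) (nonlinearity \<alpha> F (u \<tau>)) x) \<and>
        u t x = heat m t u\<^sub>0 x +
          (LINT \<tau>:{0<..<t}|lborel. heat m (t - \<tau>) (nonlinearity \<alpha> F (u \<tau>)) x))"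

end

theory Submission
  imports Defs "HOL-Probability.Characteristic_Functions" "HOL-Real_Asymp.Real_Asymp"
begin

text \<open>The difference \<open>w = u - v\<close> of two mild solutions satisfies
\<open>w(t) = e\<^bsup>-t(-\<Delta>)^m\<^esup> (u\<^sub>0 - v\<^sub>0) + \<integral>\<^sub>0\<^sup>t e\<^bsup>-(t-\<tau>)(-\<Delta>)^m\<^esup> f(\<tau>) d\<tau>\<close> with
\<open>f = |x|\<^bsup>-\<alpha>\<^esup> (F(u) - F(v))\<close>. Suppose \<open>u(\<tau>)\<close> and \<open>v(\<tau>)\<close> have norm at most \<open>M \<tau>\<^bsup>-\<delta>\<^esup>\<close> in
\<open>L\<^bsup>q,\<infinity>\<^esup>\<close> and \<open>w(\<tau>)\<close> has norm at most \<open>L \<tau>\<^bsup>-\<delta>\<^esup>\<close>. Hoelder's inequality in weak spaces then bounds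
\<open>f(\<tau>)\<close> in \<open>L\<^bsup>r,\<infinity>\<^esup>\<close>, \<open>1/r = p/q + \<alpha>/n\<close>, by a constant times \<open>M\<^bsup>p-1\<^esup> L \<tau>\<^bsup>-\<delta>p\<^esup>\<close>
(\<open>nonlinearity_diff_weak_type\<close>). Both parts of the theorem are the same argument: \<open>\<delta> = 0\<close> and \<open>q = q\<^sub>c\<close>
in the first part, \<open>\<delta> > 0\<close> and \<open>q > q\<^sub>c\<close> in the second.

The argument rests on one estimate of the Duhamel integral (\<open>duhamel_abs_bound\<close>). If the source is
bounded by \<open>B \<tau>\<^bsup>-\<delta>p\<^esup>\<close> for \<open>\<tau> < \<rho>t\<close> and by \<open>L \<tau>\<^bsup>-\<delta>p\<^esup>\<close> for \<open>\<rho>t \<le> \<tau> < t\<close>, then \<open>t\<^sup>\<delta>\<close> times the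
norm of the integral is at most \<open>K (\<rho>\<^bsup>1-\<delta>p\<^esup> B + L)\<close>: early times are few and are smoothed for a time
comparable to \<open>t\<close>, so they contribute little as \<open>\<rho> \<rightarrow> 0\<close>. Hence, once \<open>K M\<^bsup>p-1\<^esup>\<close> is small and the
linear part is small, a bound \<open>L\<close> for \<open>t\<^sup>\<delta> \<parallel>w(t)\<parallel>\<close> valid for all large times improves to \<open>(3/4) L\<close>
for all larger times, and iterating this gives the limit \<open>0\<close> (\<open>contraction_iteration\<close>,
\<open>mild_solutions_asymptotic\<close>).

For \<open>q > q\<^sub>c\<close> the late times are controlled by a convergent Beta-type integral. For \<open>q = q\<^sub>c\<close> the
smoothing rate is exactly \<open>(t - \<tau>)\<^bsup>-1\<^esup>\<close>, so integrating the norms diverges logarithmically.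
Instead, at each height \<open>\<lambda>\<close> the time integral is cut at a distance \<open>S\<close> from \<open>t\<close> that depends on
\<open>\<lambda>\<close>: the part with \<open>t - \<tau> \<ge> S\<close> is bounded pointwise by \<open>\<lambda>/2\<close>, and the other part is small in
\<open>L\<^bsup>r,\<infinity>\<^esup>\<close> (\<open>duhamel_abs_critical\<close>).

About the semigroup, only three facts enter: its kernel is continuous, is bounded by
\<open>G t\<^bsup>-n/(2m)\<^esup>\<close>, and has \<open>L\<^sup>1\<close> norm at most \<open>G\<close>. By scaling they reduce to integrability of the kernel
at \<open>t = 1\<close>. For \<open>0 < m < 1\<close> the kernel is nonnegative, because \<open>exp (-|\<xi>|\<^bsup>2m\<^esup>)\<close> is a limit of positive
mixtures of Gaussians, and a nonnegative Fourier transform of a bounded integrable function is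
integrable. For integer \<open>m\<close> the symbol is smooth with rapidly decaying derivatives, so the
kernel decays faster than any power.\<close>

section \<open>Integrable majorants and Fourier transforms\<close>

text \<open>The function is dominated by a series of indicators of the balls of radius \<open>k + 1\<close> with weights
\<open>(k + 1)\<^bsup>-n-2\<^esup>\<close>; the volume of such a ball leaves the convergent series \<open>\<Sum> (k + 1)\<^bsup>-2\<^esup>\<close>.\<close>

lemma nn_integral_decay_finite:
  "(\<integral>\<^sup>+x. ennreal (1 / (1 + norm (x :: 'a::euclidean_space)) ^ (DIM('a) + 2)) \<partial>lborel) < \<infinity>"
proof -
  let ?N = "DIM('a) + 2"
  let ?V = "unit_ball_vol (real DIM('a))"
  have le: "ennreal (1 / (1 + norm x) ^ ?N)
      \<le> (\<Sum>k. ennreal (1 / real (Suc k) ^ ?N) * indicator (ball 0 (real (Suc k))) x)" for x :: 'a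
  proof -
    define k where "k = nat \<lfloor>norm x\<rfloor>"
    have k: "real k \<le> norm x" "norm x < real (Suc k)"
      unfolding k_def using norm_ge_zero[of x] by (linarith+)
    have "1 / (1 + norm x) ^ ?N \<le> 1 / real (Suc k) ^ ?N"
      using k by (intro divide_left_mono power_mono) auto
    then have "ennreal (1 / (1 + norm x) ^ ?N)
        \<le> ennreal (1 / real (Suc k) ^ ?N) * indicator (ball 0 (real (Suc k))) x"
      using k by (simp add: ennreal_leI del: of_nat_Suc)
    also have "\<dots> \<le> (\<Sum>k. ennreal (1 / real (Suc k) ^ ?N) * indicator (ball 0 (real (Suc k))) x)"
      using sum_le_suminf[of "\<lambda>k. ennreal (1 / real (Suc k) ^ ?N) * indicator (ball 0 (real (Suc k))) x" "{k}"]
      by (simp only: summableI finite.intros sum.insert sum.empty empty_iff not_False_eq_True add_0_right simp_thms) simp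
    finally show ?thesis .
  qed
  have "(\<integral>\<^sup>+x. ennreal (1 / (1 + norm (x::'a)) ^ ?N) \<partial>lborel)
      \<le> (\<integral>\<^sup>+x. (\<Sum>k. ennreal (1 / real (Suc k) ^ ?N) * indicator (ball 0 (real (Suc k))) (x::'a)) \<partial>lborel)"
    by (intro nn_integral_mono le)
  also have "\<dots> = (\<Sum>k. ennreal (1 / real (Suc k) ^ ?N) * emeasure lborel (ball (0::'a) (real (Suc k))))"
    by (subst nn_integral_suminf)
       (simp_all only: nn_integral_cmult_indicator sets_lborel borel_open[OF open_ball]
          borel_measurable_indicator borel_measurable_const borel_measurable_times_ennreal
          measurable_lborel1 measurable_lborel2)
  also have "\<dots> = (\<Sum>k. ennreal (?V * (1 / real (Suc k) ^ 2)))"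
  proof (intro suminf_cong)
    fix k
    show "ennreal (1 / real (Suc k) ^ ?N) * emeasure lborel (ball (0::'a) (real (Suc k)))
       = ennreal (?V * (1 / real (Suc k) ^ 2))"
      by (subst emeasure_ball)
         (auto simp: ennreal_mult'[symmetric] power_add power2_eq_square field_simps simp del: of_nat_Suc)
  qed
  also have "\<dots> < \<infinity>"
  proof -
    have "summable (\<lambda>k. 1 / real (Suc k) ^ 2)"
      using inverse_power_summable[of 2, where 'a=real] summable_Suc_iff[of "\<lambda>n. 1 / real n ^ 2"]
      by (simp add: inverse_eq_divide)
    then have "summable (\<lambda>k. ?V * (1 / real (Suc k) ^ 2))"
      by (rule summable_mult)
    then show ?thesis
      by (subst suminf_ennreal2) (auto simp del: of_nat_Suc)
  qed
  finally show ?thesis .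
qed

lemma integrable_of_decay:
  fixes f :: "'a::euclidean_space \<Rightarrow> 'b::{banach, second_countable_topology}"
  assumes [measurable]: "f \<in> borel_measurable borel"
    and "\<And>x. norm (f x) \<le> B / (1 + norm x) ^ (DIM('a) + 2)"
  shows "integrable lborel f"
proof (rule Bochner_Integration.integrable_bound)
  show "integrable lborel (\<lambda>x::'a. B * (1 / (1 + norm x) ^ (DIM('a) + 2)))"
    using nn_integral_decay_finite[where 'a='a]
    by (intro integrable_mult_right) (simp add: integrable_iff_bounded)
  show "AE x in lborel. norm (f x) \<le> norm (B * (1 / (1 + norm x) ^ (DIM('a) + 2)))"
  proof (intro AE_I2)
    fix x
    have "norm (f x) \<le> B * (1 / (1 + norm x) ^ (DIM('a) + 2))"
      using assms(2)[of x] by simp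
    then show "norm (f x) \<le> norm (B * (1 / (1 + norm x) ^ (DIM('a) + 2)))"
      unfolding real_norm_def by linarith
  qed
qed simp

text \<open>Together with \<open>integrable_of_decay\<close> this makes every symbol \<open>exp (- t |\<xi>|\<^bsup>2m\<^esup>)\<close> integrable, also when it
is not smooth at the origin.\<close>

lemma exp_neg_power_decay:
  fixes N :: nat and a b :: real
  assumes "a > 0" "b > 0"
  shows "\<exists>B>0. \<forall>y\<ge>0. exp (- a * y powr b) \<le> B / (1 + y) ^ N"
proof -
  have "((\<lambda>y::real. (1 + y) ^ N * exp (- a * y powr b)) \<longlongrightarrow> 0) at_top"
    using assms by real_asymp
  then have "eventually (\<lambda>y. (1 + y) ^ N * exp (- a * y powr b) < 1) at_top"
    by (rule order_tendstoD) simp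
  then obtain Y where Y: "\<And>y. y \<ge> Y \<Longrightarrow> (1 + y) ^ N * exp (- a * y powr b) < 1"
    by (auto simp: eventually_at_top_linorder)
  show ?thesis
  proof (intro exI[of _ "(1 + \<bar>Y\<bar>) ^ N"] conjI allI impI)
    fix y :: real assume y: "y \<ge> 0"
    have "(1 + y) ^ N * exp (- a * y powr b) \<le> (1 + \<bar>Y\<bar>) ^ N"
    proof (cases "y \<ge> Y")
      case True
      have "1 \<le> (1 + \<bar>Y\<bar>) ^ N" by simp
      with Y[OF True] show ?thesis by linarith
    next
      case False
      then have "(1 + y) ^ N \<le> (1 + \<bar>Y\<bar>) ^ N" using y by (intro power_mono) auto
      moreover have "exp (- a * y powr b) \<le> 1" using assms by simp
      ultimately have "(1 + y) ^ N * exp (- a * y powr b) \<le> (1 + \<bar>Y\<bar>) ^ N * 1"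
        using y by (intro mult_mono) auto
      then show ?thesis by simp
    qed
    then show "exp (- a * y powr b) \<le> (1 + \<bar>Y\<bar>) ^ N / (1 + y) ^ N"
      using y by (simp add: field_simps)
  qed simp
qed

lemma integrable_exp_neg_norm_powr:
  assumes "a > 0" "b > 0"
  shows "integrable lborel (\<lambda>x::'a::euclidean_space. exp (- a * norm x powr b))"
proof -
  obtain B where "\<forall>y\<ge>0. exp (- a * y powr b) \<le> B / (1 + y) ^ (DIM('a) + 2)"
    using exp_neg_power_decay[OF assms, of "DIM('a) + 2"] by blast
  then show ?thesis
    by (intro integrable_of_decay[where B=B]) auto
qed

definition fourier :: "('a::euclidean_space \<Rightarrow> real) \<Rightarrow> 'a \<Rightarrow> complex" where
  "fourier \<phi> x = (\<integral>\<xi>. cis (x \<bullet> \<xi>) * complex_of_real (\<phi> \<xi>) \<partial>lborel)"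

lemma borel_measurable_cis [measurable]: "cis \<in> borel_measurable borel"
  by (intro borel_measurable_continuous_onI continuous_intros)

lemma integrable_fourier_integrand:
  assumes "integrable lborel \<phi>"
  shows "integrable lborel (\<lambda>\<xi>. cis (x \<bullet> \<xi>) * complex_of_real (\<phi> \<xi>))"
proof (rule Bochner_Integration.integrable_bound[OF assms])
  have [measurable]: "\<phi> \<in> borel_measurable borel"
    using assms by (simp add: integrable_iff_bounded)
  show "(\<lambda>\<xi>. cis (x \<bullet> \<xi>) * complex_of_real (\<phi> \<xi>)) \<in> borel_measurable lborel"
    by measurable
qed (simp add: norm_mult)

lemma norm_fourier_le:
  assumes "integrable lborel \<phi>"
  shows "norm (fourier \<phi> x) \<le> (\<integral>\<xi>. \<bar>\<phi> \<xi>\<bar> \<partial>lborel)"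
  unfolding fourier_def
  by (rule order_trans[OF integral_norm_bound]) (simp add: norm_mult)

lemma continuous_fourier:
  assumes "integrable lborel \<phi>"
  shows "continuous_on UNIV (fourier \<phi>)"
  unfolding fourier_def continuous_on_sequentially
proof (intro ballI allI impI, unfold o_def)
  have [measurable]: "\<phi> \<in> borel_measurable borel"
    using assms by (simp add: integrable_iff_bounded)
  fix x :: 'a and s assume "(\<forall>n. s n \<in> UNIV) \<and> s \<longlonglongrightarrow> x"
  then have s: "s \<longlonglongrightarrow> x" by simp
  show "(\<lambda>n. \<integral>\<xi>. cis (s n \<bullet> \<xi>) * complex_of_real (\<phi> \<xi>) \<partial>lborel)
      \<longlonglongrightarrow> (\<integral>\<xi>. cis (x \<bullet> \<xi>) * complex_of_real (\<phi> \<xi>) \<partial>lborel)"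
  proof (rule integral_dominated_convergence[where w="\<lambda>\<xi>. \<bar>\<phi> \<xi>\<bar>"])
    show "AE \<xi> in lborel. (\<lambda>n. cis (s n \<bullet> \<xi>) * complex_of_real (\<phi> \<xi>))
        \<longlonglongrightarrow> cis (x \<bullet> \<xi>) * complex_of_real (\<phi> \<xi>)"
      by (intro AE_I2 tendsto_intros s)
  qed (use assms in \<open>auto simp: norm_mult\<close>)
qed

text \<open>A rescaling of the characteristic function of the standard normal distribution.\<close>

lemma gaussian_char_1d:
  fixes s x :: real assumes s: "s > 0"
  shows "(\<integral>t. cis (x * t) * complex_of_real (exp (- s * t\<^sup>2)) \<partial>lborel)
     = complex_of_real (sqrt (pi / s) * exp (- x\<^sup>2 / (4 * s)))"
    and "integrable lborel (\<lambda>t::real. exp (- s * t\<^sup>2))"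
proof -
  let ?c = "sqrt (2 * s)"
  have c: "?c \<noteq> 0" "?c > 0" using s by auto
  have c2: "?c\<^sup>2 = 2 * s" using s by simp
  have d: "std_normal_density t = exp (- t\<^sup>2 / 2) / sqrt (2 * pi)" for t
    by (simp add: normal_density_def)
  have eq: "exp (- s * t\<^sup>2) = sqrt (2 * pi) * std_normal_density (0 + ?c * t)" for t
    unfolding d using s by (simp add: power_mult_distrib)
  have eq': "std_normal_density (sqrt (2 * s) * t) = exp (- (s * t\<^sup>2)) / sqrt (2 * pi)" for t
    unfolding d using s by (simp add: power_mult_distrib)
  have "integrable lborel (\<lambda>t::real. sqrt (2 * pi) * std_normal_density (0 + ?c * t))"
    using c integrable_normal_density[of 1 0]
    by (intro integrable_mult_right lborel_integrable_real_affine) auto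
  then show "integrable lborel (\<lambda>t::real. exp (- s * t\<^sup>2))"
    unfolding eq .
  have "(\<integral>t. iexp (x / ?c * t) * complex_of_real (std_normal_density t) \<partial>lborel)
      = char std_normal_distribution (x / ?c)"
    unfolding char_def
    by (subst integral_density) (auto simp: normal_density_nonneg scaleR_conv_of_real mult_ac)
  also have "\<dots> = complex_of_real (exp (- ((x / ?c)^2) / 2))"
    by (simp only: char_std_normal_distribution)
  finally have *: "(\<integral>t. iexp (x / ?c * t) * complex_of_real (std_normal_density t) \<partial>lborel)
      = complex_of_real (exp (- ((x / ?c)^2) / 2))" .
  have "(\<integral>t. iexp (x / ?c * t) * complex_of_real (std_normal_density t) \<partial>lborel)
      = \<bar>?c\<bar> *\<^sub>R (\<integral>t. iexp (x / ?c * (0 + ?c * t)) * complex_of_real (std_normal_density (0 + ?c * t)) \<partial>lborel)"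
    by (rule lborel_integral_real_affine) (use c in auto)
  also have "\<dots> = complex_of_real ?c * (\<integral>t. (cis (x * t) * complex_of_real (exp (- s * t\<^sup>2))) / complex_of_real (sqrt (2 * pi)) \<partial>lborel)"
    unfolding scaleR_conv_of_real
    using c by (intro arg_cong2[where f="(*)"] Bochner_Integration.integral_cong)
       (simp_all add: eq' cis_conv_exp del: of_real_exp)
  also have "\<dots> = complex_of_real (?c / sqrt (2 * pi)) * (\<integral>t. (cis (x * t) * complex_of_real (exp (- s * t\<^sup>2))) \<partial>lborel)"
    by simp
  finally have "(\<integral>t. (cis (x * t) * complex_of_real (exp (- s * t\<^sup>2))) \<partial>lborel)
     = complex_of_real (sqrt (2 * pi) / ?c) * complex_of_real (exp (- ((x / ?c)^2) / 2))"
    unfolding * using c by (simp add: field_simps del: of_real_exp)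
  also have "\<dots> = complex_of_real (sqrt (pi / s) * exp (- x\<^sup>2 / (4 * s)))"
    unfolding power_divide c2 using s by (simp add: real_sqrt_divide real_sqrt_mult field_simps del: of_real_exp)
  finally show "(\<integral>t. cis (x * t) * complex_of_real (exp (- s * t\<^sup>2)) \<partial>lborel)
     = complex_of_real (sqrt (pi / s) * exp (- x\<^sup>2 / (4 * s)))" .
qed

text \<open>Both the Gaussian and the character factor over the coordinates, and so does Lebesgue measure.
Two things are used later: the transform is nonnegative, and its integral does not depend on \<open>s\<close>.\<close>

lemma fourier_gaussian:
  fixes x :: "'a::euclidean_space"
  assumes s: "s > 0"
  shows "fourier (\<lambda>\<xi>. exp (- s * (norm \<xi>)\<^sup>2)) x
    = complex_of_real (sqrt (pi / s) ^ DIM('a) * exp (- (norm x)\<^sup>2 / (4 * s)))"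
proof -
  interpret product_sigma_finite "\<lambda>_. lborel :: real measure" ..
  have norm2: "(norm y)\<^sup>2 = (\<Sum>b\<in>Basis. (y \<bullet> b)\<^sup>2)" for y :: 'a
    unfolding power2_norm_eq_inner by (subst euclidean_inner) (simp add: power2_eq_square)
  have cisprod: "cis (\<Sum>b\<in>A. f b) = (\<Prod>b\<in>A. cis (f b))" if "finite A" for A and f :: "'a \<Rightarrow> real"
    using that by (induction A rule: finite_induct) (auto simp: cis_mult[symmetric])
  have split: "cis (x \<bullet> y) * complex_of_real (exp (- s * (norm y)\<^sup>2))
     = (\<Prod>b\<in>Basis. cis ((x \<bullet> b) * (y \<bullet> b)) * complex_of_real (exp (- s * (y \<bullet> b)\<^sup>2)))" for y
    unfolding norm2
    by (subst euclidean_inner)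
       (simp add: cisprod prod.distrib sum_distrib_left exp_sum sum_negf[symmetric] del: of_real_exp)
  have "fourier (\<lambda>\<xi>. exp (- s * (norm \<xi>)\<^sup>2)) x
     = (\<integral>y. (\<Prod>b\<in>Basis. cis ((x \<bullet> b) * (y \<bullet> b)) * complex_of_real (exp (- s * (y \<bullet> b)\<^sup>2))) \<partial>lborel)"
    unfolding fourier_def split ..
  also have "\<dots> = (\<integral>f. (\<Prod>b\<in>Basis. cis ((x \<bullet> b) * f b) * complex_of_real (exp (- s * (f b)\<^sup>2)))
       \<partial>(\<Pi>\<^sub>M b\<in>Basis. lborel :: real measure))"
    by (subst lborel_eq, subst integral_distr) (auto intro!: Bochner_Integration.integral_cong)
  also have "\<dots> = (\<Prod>b\<in>Basis. (\<integral>t. cis ((x \<bullet> b) * t) * complex_of_real (exp (- s * t\<^sup>2)) \<partial>lborel))"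
  proof (rule product_integral_prod)
    show "integrable lborel (\<lambda>t. cis (x \<bullet> i * t) * complex_of_real (exp (- s * t\<^sup>2)))" for i
      using gaussian_char_1d(2)[OF s] integrable_fourier_integrand[of "\<lambda>t. exp (- s * t\<^sup>2)" "x \<bullet> i"]
      by simp
  qed simp
  also have "\<dots> = (\<Prod>b\<in>Basis. complex_of_real (sqrt (pi / s) * exp (- (x \<bullet> b)\<^sup>2 / (4 * s))))"
    unfolding gaussian_char_1d(1)[OF s] ..
  also have "\<dots> = complex_of_real (\<Prod>b\<in>(Basis::'a set). sqrt (pi / s) * exp (- (x \<bullet> b)\<^sup>2 / (4 * s)))"
    by (simp only: of_real_prod)
  also have "(\<Prod>b\<in>(Basis::'a set). sqrt (pi / s) * exp (- (x \<bullet> b)\<^sup>2 / (4 * s)))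
     = sqrt (pi / s) ^ DIM('a) * exp (- (norm x)\<^sup>2 / (4 * s))"
    unfolding norm2
    by (simp add: prod.distrib exp_sum[symmetric] sum_divide_distrib sum_negf)
  finally show ?thesis .
qed

lemma integrable_gaussian:
  assumes "s > 0"
  shows "integrable lborel (\<lambda>x::'a::euclidean_space. exp (- s * (norm x)\<^sup>2))"
  using integrable_exp_neg_norm_powr[OF assms, of 2, where 'a='a] by (simp)

section \<open>Positivity of the kernel for fractional powers\<close>

lemma powr_set_integrable_0:
  fixes a c :: real assumes "a > -1" "c \<ge> 0"
  shows "set_integrable lborel {0..c} (\<lambda>x. x powr a)"
proof -
  have "(\<lambda>x. x powr a) absolutely_integrable_on {0..c}"
    using has_integral_powr_from_0[OF assms]
    by (intro nonnegative_absolutely_integrable_1) (auto simp: integrable_on_def)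
  then show ?thesis unfolding set_integrable_def
    by (subst (asm) integrable_completion) (auto simp: set_borel_measurable_def)
qed

lemma powr_set_integrable_inf:
  fixes a c :: real assumes "a < -1" "c > 0"
  shows "set_integrable lborel {c..} (\<lambda>x. x powr a)"
proof -
  have "(\<lambda>x. x powr a) absolutely_integrable_on {c..}"
    using has_integral_powr_to_inf[OF assms]
    by (intro nonnegative_absolutely_integrable_1) (auto simp: integrable_on_def)
  then show ?thesis unfolding set_integrable_def
    by (subst (asm) integrable_completion) (auto simp: set_borel_measurable_def)
qed

text \<open>Up to a constant factor, this is \<open>r\<^sup>b\<close>, written as a superposition of the functions \<open>1 - exp (- s r)\<close>:
the Levy--Khintchine formula for the stable subordinator of index \<open>b\<close>.\<close>

definition bernstein_integral :: "real \<Rightarrow> real \<Rightarrow> real" where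
  "bernstein_integral b r = (LINT s:{0<..}|lborel. (1 - exp (- s * r)) * s powr (- 1 - b))"

text \<open>Near \<open>s = 0\<close> the integrand is at most \<open>r s\<^bsup>-b\<^esup>\<close>, and near infinity it is at most \<open>s\<^bsup>-1-b\<^esup>\<close>; these are
integrable there exactly because \<open>0 < b < 1\<close>.\<close>

lemma bernstein_integrable:
  fixes b r :: real
  assumes "0 < b" "b < 1" "r \<ge> 0"
  shows "set_integrable lborel {0<..} (\<lambda>s. (1 - exp (- s * r)) * s powr (- 1 - b))"
proof -
  have "set_integrable lborel {0..1::real} (\<lambda>s::real. r * s powr (- b))"
    using powr_set_integrable_0[of "- b" 1] assms by (intro set_integrable_mult_right) auto
  moreover have "set_integrable lborel {1::real..} (\<lambda>s. s powr (- 1 - b))"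
    using powr_set_integrable_inf[of "- 1 - b" 1] assms by auto
  ultimately have "integrable lborel (\<lambda>s. indicator {0..1} s * (r * s powr (- b)) + indicator {1..} (s::real) * s powr (- 1 - b))"
    unfolding set_integrable_def by simp
  then show ?thesis unfolding set_integrable_def
  proof (rule Bochner_Integration.integrable_bound)
    show "AE s in lborel. norm (indicator {0<..} s *\<^sub>R ((1 - exp (- s * r)) * s powr (- 1 - b)))
      \<le> norm (indicator {0..1} s * (r * s powr (- b)) + indicator {1..} (s::real) * s powr (- 1 - b))"
    proof (intro AE_I2)
      fix s :: real
      show "norm (indicator {0<..} s *\<^sub>R ((1 - exp (- s * r)) * s powr (- 1 - b)))
      \<le> norm (indicator {0..1} s * (r * s powr (- b)) + indicator {1..} (s::real) * s powr (- 1 - b))"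
      proof (cases "s > 0")
        case True
        have e: "0 \<le> 1 - exp (- s * r)" "1 - exp (- s * r) \<le> 1" "1 - exp (- s * r) \<le> s * r"
          using True assms exp_ge_add_one_self[of "- s * r"] by (auto simp: algebra_simps)
        have "(1 - exp (- s * r)) * s powr (- 1 - b) \<le> (s * r) * s powr (- 1 - b)"
          using e by (intro mult_right_mono) auto
        also have "\<dots> = r * s powr (- b)"
          using True by (simp add: powr_diff powr_minus field_simps)
        finally have 1: "(1 - exp (- s * r)) * s powr (- 1 - b) \<le> r * s powr (- b)" .
        have 2: "(1 - exp (- s * r)) * s powr (- 1 - b) \<le> 1 * s powr (- 1 - b)"
          using e by (intro mult_right_mono) auto
        have 3: "0 \<le> r * s powr (- b)" using assms by simp
        show ?thesis
        proof (cases "s \<le> 1")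
          case True
          have "0 \<le> indicator {1..} s * s powr (- 1 - b)" by simp
          with 1 have 4: "(1 - exp (- s * r)) * s powr (- 1 - b)
              \<le> r * s powr (- b) + indicator {1..} s * s powr (- 1 - b)" by linarith
          moreover have "0 \<le> (1 - exp (- s * r)) * s powr (- 1 - b)" using e by simp
          ultimately show ?thesis using True \<open>s > 0\<close> by simp
        next
          case False
          then show ?thesis using 2 e \<open>s > 0\<close> by (simp add: abs_mult)
        qed
      qed simp
    qed
  qed measurable
qed

lemma bernstein_integral_scale:
  assumes "0 < b" "b < 1" "r \<ge> 0"
  shows "bernstein_integral b r = r powr b * bernstein_integral b 1"
proof (cases "r = 0")
  case True then show ?thesis by (simp add: bernstein_integral_def)
next
  case False
  then have r: "r > 0" using assms by simp
  have "bernstein_integral b r = (\<integral>s. indicator {0<..} s *\<^sub>R ((1 - exp (- s * r)) * s powr (- 1 - b)) \<partial>lborel)"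
    by (simp add: bernstein_integral_def set_lebesgue_integral_def)
  also have "\<dots> = \<bar>1/r\<bar> *\<^sub>R (\<integral>s. indicator {0<..} (0 + 1/r * s) *\<^sub>R ((1 - exp (- (0 + 1/r * s) * r)) * (0 + 1/r * s) powr (- 1 - b)) \<partial>lborel)"
    by (rule lborel_integral_real_affine) (use r in auto)
  also have "\<dots> = 1/r * (\<integral>s. r powr (1 + b) * (indicator {0<..} s *\<^sub>R ((1 - exp (- s * 1)) * s powr (- 1 - b))) \<partial>lborel)"
  proof -
    have "indicator {0<..} (0 + 1/r * s) *\<^sub>R ((1 - exp (- (0 + 1/r * s) * r)) * (0 + 1/r * s) powr (- 1 - b))
       = r powr (1 + b) * (indicator {0<..} s *\<^sub>R ((1 - exp (- s * 1)) * s powr (- 1 - b)))" for s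
    proof (cases "s > 0")
      case True
      have "(1 / r * s) powr (- 1 - b) = r powr (1 + b) * s powr (- 1 - b)"
        using True r by (simp add: powr_mult powr_divide powr_minus powr_diff powr_add field_simps)
      then show ?thesis using True r by (simp add: algebra_simps)
    next
      case False
      then have "\<not> 0 < 1/r * s" using r by (simp add: not_less divide_le_0_iff)
      then show ?thesis using False by simp
    qed
    then show ?thesis using r by (simp only: real_scaleR_def) simp
  qed
  also have "\<dots> = r powr b * bernstein_integral b 1"
    using r by (simp add: bernstein_integral_def set_lebesgue_integral_def powr_add)
  finally show ?thesis .
qed

lemma bernstein_integral_pos:
  assumes "0 < b" "b < 1"
  shows "bernstein_integral b 1 > 0"
proof -
  let ?f = "\<lambda>s. indicator {0<..} s *\<^sub>R ((1 - exp (- s * 1)) * s powr (- 1 - b)) :: real"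
  have i: "integrable lborel ?f"
    using bernstein_integrable[OF assms, of 1] by (simp add: set_integrable_def)
  have nn: "?f s \<ge> 0" for s by (auto simp: indicator_def)
  have "bernstein_integral b 1 \<noteq> 0"
  proof
    assume "bernstein_integral b 1 = 0"
    then have "(\<integral>s. ?f s \<partial>lborel) = 0" by (simp add: bernstein_integral_def set_lebesgue_integral_def)
    then have "AE s in lborel. ?f s = 0"
      using integral_nonneg_eq_0_iff_AE[OF i] nn by simp
    then have "AE s in lborel. s \<notin> {0<..<1::real}"
      by eventually_elim (auto simp: indicator_def)
    then have "{0<..<1::real} \<in> null_sets lborel"
      by (simp add: AE_iff_null_sets)
    then show False by (simp add: null_sets_def)
  qed
  moreover have "bernstein_integral b 1 \<ge> 0"
    unfolding bernstein_integral_def set_lebesgue_integral_def using nn by (intro integral_nonneg_AE AE_I2) simp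
  ultimately show ?thesis by simp
qed

text \<open>Positive definiteness, expressed by nonnegativity of the Fourier transform after multiplication
by an arbitrary Gaussian. The Gaussian makes every bounded function integrable, and the class is
trivially stable under further multiplication by Gaussians.\<close>

definition pos_def_fun :: "('a::euclidean_space \<Rightarrow> real) \<Rightarrow> bool" where
  "pos_def_fun \<phi> \<longleftrightarrow> \<phi> \<in> borel_measurable borel \<and> (\<exists>B. \<forall>\<xi>. \<bar>\<phi> \<xi>\<bar> \<le> B) \<and>
     (\<forall>s>0. \<forall>x. 0 \<le> Re (fourier (\<lambda>\<xi>. exp (- s * (norm \<xi>)\<^sup>2) * \<phi> \<xi>) x))"

lemma integrable_gaussian_times_bounded:
  assumes [measurable]: "\<phi> \<in> borel_measurable borel" and B: "\<And>\<xi>. \<bar>\<phi> \<xi>\<bar> \<le> B" and s: "s > 0"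
  shows "integrable lborel (\<lambda>\<xi>::'a::euclidean_space. exp (- s * (norm \<xi>)\<^sup>2) * \<phi> \<xi>)"
proof (rule Bochner_Integration.integrable_bound)
  show "integrable lborel (\<lambda>\<xi>::'a. exp (- s * (norm \<xi>)\<^sup>2) * B)"
    by (rule integrable_mult_left[OF integrable_gaussian[OF s]])
  show "AE \<xi> in lborel. norm (exp (- s * (norm \<xi>)\<^sup>2) * \<phi> \<xi>) \<le> norm (exp (- s * (norm \<xi>)\<^sup>2) * B)"
    using order_trans[OF B abs_ge_self] by (intro AE_I2) (auto simp: abs_mult)
qed simp

lemma pos_def_fun_one: "pos_def_fun (\<lambda>_::'a::euclidean_space. 1)"
  unfolding pos_def_fun_def by (auto simp: fourier_gaussian[simplified] intro: exI[of _ 1])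

lemma fourier_add:
  assumes "integrable lborel \<phi>" "integrable lborel \<psi>"
  shows "fourier (\<lambda>\<xi>. \<phi> \<xi> + \<psi> \<xi>) x = fourier \<phi> x + fourier \<psi> x"
  unfolding fourier_def
  using assms[THEN integrable_fourier_integrand, of x]
  by (subst Bochner_Integration.integral_add[symmetric]) (auto simp: algebra_simps)

lemma fourier_cmult: "fourier (\<lambda>\<xi>. c * \<phi> \<xi>) x = complex_of_real c * fourier \<phi> x"
  unfolding fourier_def
  by (subst integral_mult_right_zero[symmetric]) (simp add: mult_ac)

lemma pos_def_fun_add:
  assumes "pos_def_fun \<phi>" "pos_def_fun \<psi>"
  shows "pos_def_fun (\<lambda>\<xi>. \<phi> \<xi> + \<psi> \<xi>)"
proof -
  obtain B C where B: "\<And>\<xi>. \<bar>\<phi> \<xi>\<bar> \<le> B" and C: "\<And>\<xi>. \<bar>\<psi> \<xi>\<bar> \<le> C"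
    and [measurable]: "\<phi> \<in> borel_measurable borel" "\<psi> \<in> borel_measurable borel"
    using assms unfolding pos_def_fun_def by blast
  have "\<bar>\<phi> \<xi> + \<psi> \<xi>\<bar> \<le> B + C" for \<xi> using B[of \<xi>] C[of \<xi>] by linarith
  moreover have "fourier (\<lambda>\<xi>. exp (- s * (norm \<xi>)\<^sup>2) * (\<phi> \<xi> + \<psi> \<xi>)) x =
      fourier (\<lambda>\<xi>. exp (- s * (norm \<xi>)\<^sup>2) * \<phi> \<xi>) x + fourier (\<lambda>\<xi>. exp (- s * (norm \<xi>)\<^sup>2) * \<psi> \<xi>) x"
    if "s > 0" for s x
    using B C that unfolding distrib_left
    by (intro fourier_add integrable_gaussian_times_bounded) auto
  ultimately show ?thesis
    using assms unfolding pos_def_fun_def by (auto intro!: exI[of _ "B + C"])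
qed

lemma pos_def_fun_cmult:
  assumes "pos_def_fun \<phi>" "c \<ge> 0"
  shows "pos_def_fun (\<lambda>\<xi>. c * \<phi> \<xi>)"
proof -
  obtain B where B: "\<And>\<xi>. \<bar>\<phi> \<xi>\<bar> \<le> B"
    using assms unfolding pos_def_fun_def by blast
  have "\<bar>c * \<phi> \<xi>\<bar> \<le> c * B" for \<xi> using B[of \<xi>] assms by (simp add: abs_mult mult_left_mono)
  moreover have "fourier (\<lambda>\<xi>. exp (- s * (norm \<xi>)\<^sup>2) * (c * \<phi> \<xi>)) x =
      complex_of_real c * fourier (\<lambda>\<xi>. exp (- s * (norm \<xi>)\<^sup>2) * \<phi> \<xi>) x" for s x
    by (subst fourier_cmult[symmetric]) (simp add: mult_ac)
  ultimately show ?thesis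
    using assms unfolding pos_def_fun_def by (auto intro!: exI[of _ "c * B"])
qed

lemma pos_def_fun_limit:
  assumes pd: "\<And>k. pos_def_fun (\<phi> k)"
    and lim: "\<And>\<xi>. (\<lambda>k. \<phi> k \<xi>) \<longlonglongrightarrow> \<psi> \<xi>"
    and B: "\<And>k \<xi>. \<bar>\<phi> k \<xi>\<bar> \<le> B"
  shows "pos_def_fun \<psi>"
proof -
  have [measurable]: "\<phi> k \<in> borel_measurable borel" for k
    using pd unfolding pos_def_fun_def by blast
  have [measurable]: "\<psi> \<in> borel_measurable borel"
    by (rule borel_measurable_LIMSEQ_real[OF lim]) auto
  have "\<bar>\<psi> \<xi>\<bar> \<le> B" for \<xi>
    by (rule LIMSEQ_le_const2[OF tendsto_rabs[OF lim]]) (use B in auto)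
  moreover have "0 \<le> Re (fourier (\<lambda>\<xi>. exp (- s * (norm \<xi>)\<^sup>2) * \<psi> \<xi>) x)" if s: "s > 0" for s x
  proof -
    have "(\<lambda>k. fourier (\<lambda>\<xi>. exp (- s * (norm \<xi>)\<^sup>2) * \<phi> k \<xi>) x)
       \<longlonglongrightarrow> fourier (\<lambda>\<xi>. exp (- s * (norm \<xi>)\<^sup>2) * \<psi> \<xi>) x"
      unfolding fourier_def
    proof (rule integral_dominated_convergence[where w="\<lambda>\<xi>. exp (- s * (norm \<xi>)\<^sup>2) * B"])
      show "integrable lborel (\<lambda>\<xi>::'a. exp (- s * (norm \<xi>)\<^sup>2) * B)"
        by (rule integrable_mult_left[OF integrable_gaussian[OF s]])
      show "AE \<xi> in lborel. (\<lambda>k. cis (x \<bullet> \<xi>) * complex_of_real (exp (- s * (norm \<xi>)\<^sup>2) * \<phi> k \<xi>))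
        \<longlonglongrightarrow> cis (x \<bullet> \<xi>) * complex_of_real (exp (- s * (norm \<xi>)\<^sup>2) * \<psi> \<xi>)"
        by (intro AE_I2 tendsto_intros lim)
      show "AE \<xi> in lborel. norm (cis (x \<bullet> \<xi>) * complex_of_real (exp (- s * (norm \<xi>)\<^sup>2) * \<phi> k \<xi>))
          \<le> exp (- s * (norm \<xi>)\<^sup>2) * B" for k
        using B by (intro AE_I2) (simp add: norm_mult abs_mult)
    qed measurable
    then have "(\<lambda>k. Re (fourier (\<lambda>\<xi>. exp (- s * (norm \<xi>)\<^sup>2) * \<phi> k \<xi>) x))
       \<longlonglongrightarrow> Re (fourier (\<lambda>\<xi>. exp (- s * (norm \<xi>)\<^sup>2) * \<psi> \<xi>) x)"
      by (rule tendsto_Re)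
    then show ?thesis
      using pd s unfolding pos_def_fun_def by (intro LIMSEQ_le_const) auto
  qed
  ultimately show ?thesis unfolding pos_def_fun_def by auto
qed

lemma laplace_mixture:
  fixes \<xi> :: "'a::euclidean_space"
  assumes w: "integrable lborel w" "\<And>r. w r \<ge> 0" "\<And>r. r \<le> 0 \<Longrightarrow> w r = 0"
  shows "integrable lborel (\<lambda>r. exp (- r * (norm \<xi>)\<^sup>2) * w r)"
    and "0 \<le> (\<integral>r. exp (- r * (norm \<xi>)\<^sup>2) * w r \<partial>lborel)"
    and "(\<integral>r. exp (- r * (norm \<xi>)\<^sup>2) * w r \<partial>lborel) \<le> (\<integral>r. w r \<partial>lborel)"
proof -
  have [measurable]: "w \<in> borel_measurable borel" using w by auto
  have ew: "exp (- r * (norm \<xi>)\<^sup>2) * w r \<le> w r" for r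
    using w(2)[of r] w(3)[of r] by (cases "r \<le> 0") (auto intro!: mult_left_le_one_le)
  show iw: "integrable lborel (\<lambda>r. exp (- r * (norm \<xi>)\<^sup>2) * w r)"
    by (rule Bochner_Integration.integrable_bound[OF w(1)]) (use ew w(2) in auto)
  show "0 \<le> (\<integral>r. exp (- r * (norm \<xi>)\<^sup>2) * w r \<partial>lborel)"
    using w(2) by (intro integral_nonneg_AE AE_I2) simp
  show "(\<integral>r. exp (- r * (norm \<xi>)\<^sup>2) * w r \<partial>lborel) \<le> (\<integral>r. w r \<partial>lborel)"
    using iw w(1) ew by (intro integral_mono) auto
qed

text \<open>By Fubini the transform of the product is the average, with the nonnegative weight \<open>w r\<close>, of
transforms of \<open>\<phi>\<close> times a Gaussian of parameter \<open>s + r\<close>, all of them nonnegative.\<close>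

lemma pos_def_fun_laplace:
  fixes \<phi> :: "'a::euclidean_space \<Rightarrow> real"
  assumes pd: "pos_def_fun \<phi>" and w: "integrable lborel w" "\<And>r. w r \<ge> 0" "\<And>r. r \<le> 0 \<Longrightarrow> w r = 0"
  shows "pos_def_fun (\<lambda>\<xi>. (\<integral>r. exp (- r * (norm \<xi>)\<^sup>2) * w r \<partial>lborel) * \<phi> \<xi>)"
proof -
  have [measurable]: "\<phi> \<in> borel_measurable borel" "w \<in> borel_measurable borel"
    using pd w unfolding pos_def_fun_def by auto
  obtain B where B: "\<And>\<xi>. \<bar>\<phi> \<xi>\<bar> \<le> B"
    using pd unfolding pos_def_fun_def by blast
  then have B0: "B \<ge> 0" using abs_ge_zero[of "\<phi> 0"] order_trans by blast
  have iw: "integrable lborel (\<lambda>r. exp (- r * (norm \<xi>)\<^sup>2) * w r)" for \<xi> :: 'a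
    by (rule laplace_mixture(1)[OF w])
  let ?W = "\<lambda>\<xi>::'a. \<integral>r. exp (- r * (norm \<xi>)\<^sup>2) * w r \<partial>lborel"
  have W: "\<bar>?W \<xi>\<bar> \<le> (\<integral>r. w r \<partial>lborel)" for \<xi>
    using laplace_mixture(2,3)[OF w, of \<xi>] by simp
  have "\<bar>?W \<xi> * \<phi> \<xi>\<bar> \<le> (\<integral>r. w r \<partial>lborel) * B" for \<xi>
    unfolding abs_mult using W[of \<xi>] B[of \<xi>] by (intro mult_mono) auto
  moreover have "0 \<le> Re (fourier (\<lambda>\<xi>. exp (- s * (norm \<xi>)\<^sup>2) * (?W \<xi> * \<phi> \<xi>)) x)" if s: "s > 0" for s x
  proof -
    let ?h = "\<lambda>\<xi>. cis (x \<bullet> \<xi>) * complex_of_real (exp (- s * (norm \<xi>)\<^sup>2) * \<phi> \<xi>)"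
    let ?H = "\<lambda>\<xi> r. ?h \<xi> * complex_of_real (exp (- r * (norm \<xi>)\<^sup>2) * w r)"
    have int: "integrable (lborel \<Otimes>\<^sub>M lborel) (\<lambda>(\<xi>, r). ?H \<xi> r)"
    proof (rule lborel_pair.Fubini_integrable)
      show "(\<lambda>(\<xi>, r). ?H \<xi> r) \<in> borel_measurable (lborel \<Otimes>\<^sub>M lborel)" by measurable
      have "(\<integral>r. norm (?H \<xi> r) \<partial>lborel) = exp (- s * (norm \<xi>)\<^sup>2) * (\<bar>\<phi> \<xi>\<bar> * ?W \<xi>)" for \<xi>
        using w(2) by (simp add: norm_mult abs_mult mult.assoc)
      moreover have "integrable lborel (\<lambda>\<xi>. exp (- s * (norm \<xi>)\<^sup>2) * (\<bar>\<phi> \<xi>\<bar> * ?W \<xi>))"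
        by (rule integrable_gaussian_times_bounded[OF _ _ s, where B="B * (\<integral>r. w r \<partial>lborel)"])
           (use B W B0 in \<open>auto simp: abs_mult intro!: mult_mono\<close>)
      ultimately show "integrable lborel (\<lambda>\<xi>. \<integral>y. norm (case (\<xi>, y) of (\<xi>, r) \<Rightarrow> ?H \<xi> r) \<partial>lborel)" by simp
      show "AE \<xi> in lborel. integrable lborel (\<lambda>y. case (\<xi>, y) of (\<xi>, r) \<Rightarrow> ?H \<xi> r)"
        using iw by (intro AE_I2) (simp add: integrable_mult_right del: of_real_mult)
    qed
    have "fourier (\<lambda>\<xi>. exp (- s * (norm \<xi>)\<^sup>2) * (?W \<xi> * \<phi> \<xi>)) x = (\<integral>\<xi>. (\<integral>r. ?H \<xi> r \<partial>lborel) \<partial>lborel)"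
      unfolding fourier_def by (intro Bochner_Integration.integral_cong refl)
       (simp only: integral_mult_right_zero integral_complex_of_real, simp add: mult_ac)
    also have "\<dots> = (\<integral>r. (\<integral>\<xi>. ?H \<xi> r \<partial>lborel) \<partial>lborel)"
      by (rule lborel_pair.Fubini_integral[symmetric, OF int])
    also have "\<dots> = (\<integral>r. complex_of_real (w r) * fourier (\<lambda>\<xi>. exp (- (s + r) * (norm \<xi>)\<^sup>2) * \<phi> \<xi>) x \<partial>lborel)"
      unfolding fourier_def
      by (intro Bochner_Integration.integral_cong refl, subst integral_mult_right_zero[symmetric],
          intro Bochner_Integration.integral_cong refl)
         (simp add: algebra_simps exp_add[symmetric] exp_of_real[symmetric] del: exp_of_real flip: of_real_mult)
    finally have eq: "fourier (\<lambda>\<xi>. exp (- s * (norm \<xi>)\<^sup>2) * (?W \<xi> * \<phi> \<xi>)) x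
       = (\<integral>r. complex_of_real (w r) * fourier (\<lambda>\<xi>. exp (- (s + r) * (norm \<xi>)\<^sup>2) * \<phi> \<xi>) x \<partial>lborel)"
       (is "_ = (\<integral>r. ?K r \<partial>lborel)") .
    have "0 \<le> Re (?K r)" for r
    proof (cases "r \<le> 0")
      case False
      then have "0 \<le> Re (fourier (\<lambda>\<xi>. exp (- (s + r) * (norm \<xi>)\<^sup>2) * \<phi> \<xi>) x)"
        using pd s unfolding pos_def_fun_def by (metis add_pos_pos not_le)
      then show ?thesis using w(2)[of r] by simp
    qed (simp add: w(3))
    moreover have "Re (\<integral>r. ?K r \<partial>lborel) = (\<integral>r. Re (?K r) \<partial>lborel)" if "integrable lborel ?K"
      using integral_Re[OF that] by simp
    moreover have "(\<integral>r. ?K r \<partial>lborel) = 0" if "\<not> integrable lborel ?K"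
      using that by (rule not_integrable_integral_eq)
    ultimately show ?thesis unfolding eq
      by (cases "integrable lborel ?K") (auto intro!: integral_nonneg_AE)
  qed
  ultimately show ?thesis unfolding pos_def_fun_def by auto
qed

text \<open>The exponential series has nonnegative coefficients, and powers of a Laplace mixture stay positive
definite by \<open>pos_def_fun_laplace\<close>.\<close>

lemma pos_def_fun_exp_laplace:
  fixes w :: "real \<Rightarrow> real"
  assumes w: "integrable lborel w" "\<And>r. w r \<ge> 0" "\<And>r. r \<le> 0 \<Longrightarrow> w r = 0"
  defines "W \<equiv> \<lambda>\<xi>::'a::euclidean_space. \<integral>r. exp (- r * (norm \<xi>)\<^sup>2) * w r \<partial>lborel"
  shows "pos_def_fun (\<lambda>\<xi>. exp (W \<xi>))"
proof -
  have pw: "pos_def_fun (\<lambda>\<xi>. W \<xi> ^ j)" for j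
  proof (induction j)
    case 0 then show ?case by (simp add: pos_def_fun_one)
  next
    case (Suc j)
    then show ?case using pos_def_fun_laplace[OF Suc w] by (simp add: W_def)
  qed
  have ps: "pos_def_fun (\<lambda>\<xi>. \<Sum>j<k. W \<xi> ^ j /\<^sub>R fact j)" for k
  proof (induction k)
    case 0 then show ?case using pos_def_fun_cmult[OF pos_def_fun_one, of 0] by simp
  next
    case (Suc k)
    then show ?case using pos_def_fun_add[OF Suc pos_def_fun_cmult[OF pw, of "inverse (fact k)" k]] by simp
  qed
  have W: "0 \<le> W \<xi>" for \<xi>
    unfolding W_def by (rule laplace_mixture(2)[OF w])
  have Wle: "W \<xi> \<le> (\<integral>r. w r \<partial>lborel)" for \<xi>
    unfolding W_def by (rule laplace_mixture(3)[OF w])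
  show ?thesis
  proof (rule pos_def_fun_limit[OF ps, where B="exp (\<integral>r. w r \<partial>lborel)"])
    show "(\<lambda>k. \<Sum>j<k. W \<xi> ^ j /\<^sub>R fact j) \<longlonglongrightarrow> exp (W \<xi>)" for \<xi>
      using exp_converges[of "W \<xi>"] unfolding sums_def .
    show "\<bar>\<Sum>j<k. W \<xi> ^ j /\<^sub>R fact j\<bar> \<le> exp (\<integral>r. w r \<partial>lborel)" for k \<xi>
    proof -
      have "(\<Sum>j<k. W \<xi> ^ j /\<^sub>R fact j) \<le> exp (W \<xi>)"
        unfolding exp_def using W by (intro sum_le_suminf summable_exp_generic) auto
      moreover have "0 \<le> (\<Sum>j<k. W \<xi> ^ j /\<^sub>R fact j)"
        using W by (intro sum_nonneg) auto
      ultimately show ?thesis using Wle[of \<xi>] by (auto intro: order_trans)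
    qed
  qed
qed

text \<open>Cutting the representation of \<open>|\<xi>|\<^bsup>2b\<^esup>\<close> off at \<open>s \<ge> d\<^sub>k\<close> makes the measure finite, so that the truncated
exponent is a constant minus a Laplace mixture \<open>W\<^sub>k\<close>. Thus \<open>exp (- |\<xi>|\<^bsup>2b\<^esup>)\<close> is the limit of positive
multiples of \<open>exp W\<^sub>k\<close>.\<close>

lemma pos_def_fun_exp_neg_norm_powr:
  assumes b: "0 < b" "b < 1"
  shows "pos_def_fun (\<lambda>\<xi>::'a::euclidean_space. exp (- (norm \<xi> powr (2 * b))))"
proof -
  define c where "c = inverse (bernstein_integral b 1)"
  have c: "c > 0" unfolding c_def using bernstein_integral_pos[OF b] by simp
  define d where "d k = inverse (real (Suc k))" for k
  have d: "d k > 0" for k by (simp add: d_def)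
  have d0: "d \<longlonglongrightarrow> 0" unfolding d_def by (rule LIMSEQ_inverse_real_of_nat)
  define w where "w k r = c * (indicator {d k..} r * r powr (- 1 - b))" for k r
  have wint: "integrable lborel (w k)" for k
    using powr_set_integrable_inf[of "- 1 - b" "d k"] b d[of k]
    unfolding w_def set_integrable_def by (intro integrable_mult_right) auto
  have w0: "w k r \<ge> 0" for k r using c by (simp add: w_def)
  have wneg: "r \<le> 0 \<Longrightarrow> w k r = 0" for k r using d[of k] by (auto simp: w_def indicator_def)
  define W where "W k \<xi> = (\<integral>r. exp (- r * (norm \<xi>)\<^sup>2) * w k r \<partial>lborel)" for k and \<xi> :: 'a
  have [measurable]: "w k \<in> borel_measurable borel" for k using wint[of k] by auto
  note mix = laplace_mixture[OF wint w0 wneg]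
  have diff: "(\<integral>r. w k r \<partial>lborel) - W k \<xi> = (\<integral>r. (1 - exp (- r * (norm \<xi>)\<^sup>2)) * w k r \<partial>lborel)" for k \<xi>
    unfolding W_def using mix(1) wint
    by (subst Bochner_Integration.integral_diff[symmetric]) (auto simp: algebra_simps)
  have lim: "(\<lambda>k. (\<integral>r. w k r \<partial>lborel) - W k \<xi>) \<longlonglongrightarrow> norm \<xi> powr (2 * b)" for \<xi>
  proof -
    let ?r = "(norm \<xi>)\<^sup>2"
    have "(\<lambda>k. (\<integral>r. (1 - exp (- r * ?r)) * w k r \<partial>lborel))
      \<longlonglongrightarrow> (\<integral>r. c * (indicator {0<..} r *\<^sub>R ((1 - exp (- r * ?r)) * r powr (- 1 - b))) \<partial>lborel)"
    proof (rule integral_dominated_convergence[where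
          w="\<lambda>r. c * (indicator {0<..} r *\<^sub>R ((1 - exp (- r * ?r)) * r powr (- 1 - b)))"])
      show "integrable lborel (\<lambda>r. c * (indicator {0<..} r *\<^sub>R ((1 - exp (- r * ?r)) * r powr (- 1 - b))))"
        using bernstein_integrable[OF b, of ?r] unfolding set_integrable_def
        by (intro integrable_mult_right) auto
      show "AE r in lborel. (\<lambda>k. (1 - exp (- r * ?r)) * w k r)
        \<longlonglongrightarrow> c * (indicator {0<..} r *\<^sub>R ((1 - exp (- r * ?r)) * r powr (- 1 - b)))"
      proof (intro AE_I2 tendsto_eventually)
        fix r :: real
        show "\<forall>\<^sub>F k in sequentially. (1 - exp (- r * ?r)) * w k r =
           c * (indicator {0<..} r *\<^sub>R ((1 - exp (- r * ?r)) * r powr (- 1 - b)))"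
        proof (cases "r > 0")
          case True
          then have "\<forall>\<^sub>F k in sequentially. d k < r" using d0 by (rule order_tendstoD(2)[rotated])
          then show ?thesis by eventually_elim (use True in \<open>auto simp: w_def\<close>)
        next
          case False then show ?thesis using wneg by simp
        qed
      qed
      show "AE r in lborel. norm ((1 - exp (- r * ?r)) * w k r)
         \<le> c * (indicator {0<..} r *\<^sub>R ((1 - exp (- r * ?r)) * r powr (- 1 - b)))" for k
      proof (intro AE_I2)
        fix r :: real
        show "norm ((1 - exp (- r * ?r)) * w k r)
         \<le> c * (indicator {0<..} r *\<^sub>R ((1 - exp (- r * ?r)) * r powr (- 1 - b)))"
          using wneg[of r k] c by (cases "r > 0") (auto simp: abs_mult w_def indicator_def)
      qed
    qed measurable
    also have "(\<integral>r. c * (indicator {0<..} r *\<^sub>R ((1 - exp (- r * ?r)) * r powr (- 1 - b))) \<partial>lborel)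
       = c * bernstein_integral b ?r"
      by (simp add: bernstein_integral_def set_lebesgue_integral_def)
    also have "\<dots> = ?r powr b"
      using bernstein_integral_scale[OF b, of ?r] bernstein_integral_pos[OF b] by (simp add: c_def field_simps)
    also have "\<dots> = norm \<xi> powr (2 * b)"
      by (cases "\<xi> = 0") (auto simp: powr_powr[symmetric])
    finally show ?thesis unfolding diff .
  qed
  have Wle: "W k \<xi> \<le> (\<integral>r. w k r \<partial>lborel)" for k \<xi>
    unfolding W_def by (rule mix(3))
  show ?thesis
  proof (rule pos_def_fun_limit[where B=1])
    show "pos_def_fun (\<lambda>\<xi>. exp (- (\<integral>r. w k r \<partial>lborel)) * exp (W k \<xi>))" for k
      unfolding W_def
      by (rule pos_def_fun_cmult[OF pos_def_fun_exp_laplace[OF wint w0 wneg]]) auto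
    show "(\<lambda>k. exp (- (\<integral>r. w k r \<partial>lborel)) * exp (W k \<xi>)) \<longlonglongrightarrow> exp (- (norm \<xi> powr (2 * b)))" for \<xi>
      using tendsto_exp[OF tendsto_minus[OF lim[of \<xi>]]] by (simp add: exp_add[symmetric] algebra_simps)
    show "\<bar>exp (- (\<integral>r. w k r \<partial>lborel)) * exp (W k \<xi>)\<bar> \<le> 1" for k \<xi>
      using Wle[of k \<xi>] by (simp add: exp_add[symmetric])
  qed
qed

text \<open>The testing Gaussian is removed by letting its parameter tend to \<open>0\<close>.\<close>

lemma pos_def_fun_fourier_nonneg:
  assumes pd: "pos_def_fun \<phi>" and int: "integrable lborel \<phi>"
  shows "0 \<le> Re (fourier \<phi> x)"
proof -
  have [measurable]: "\<phi> \<in> borel_measurable borel" using int by auto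
  define d where "d k = inverse (real (Suc k))" for k
  have d: "d k > 0" for k by (simp add: d_def)
  have d0: "d \<longlonglongrightarrow> 0" unfolding d_def by (rule LIMSEQ_inverse_real_of_nat)
  have "(\<lambda>k. fourier (\<lambda>\<xi>. exp (- d k * (norm \<xi>)\<^sup>2) * \<phi> \<xi>) x) \<longlonglongrightarrow> fourier \<phi> x"
    unfolding fourier_def
  proof (rule integral_dominated_convergence[where w="\<lambda>\<xi>. \<bar>\<phi> \<xi>\<bar>"])
    show "AE \<xi> in lborel. (\<lambda>k. cis (x \<bullet> \<xi>) * complex_of_real (exp (- d k * (norm \<xi>)\<^sup>2) * \<phi> \<xi>))
        \<longlonglongrightarrow> cis (x \<bullet> \<xi>) * complex_of_real (\<phi> \<xi>)"
    proof (intro AE_I2 tendsto_intros)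
      fix \<xi>
      have "(\<lambda>k. exp (- d k * (norm \<xi>)\<^sup>2) * \<phi> \<xi>) \<longlonglongrightarrow> exp (- 0 * (norm \<xi>)\<^sup>2) * \<phi> \<xi>"
        by (intro tendsto_intros d0)
      then show "(\<lambda>k. exp (- d k * (norm \<xi>)\<^sup>2) * \<phi> \<xi>) \<longlonglongrightarrow> \<phi> \<xi>" by simp
    qed
    show "AE \<xi> in lborel. norm (cis (x \<bullet> \<xi>) * complex_of_real (exp (- d k * (norm \<xi>)\<^sup>2) * \<phi> \<xi>)) \<le> \<bar>\<phi> \<xi>\<bar>" for k
      using d[of k] by (intro AE_I2) (auto simp: norm_mult abs_mult intro!: mult_left_le_one_le)
    show "integrable lborel (\<lambda>\<xi>. \<bar>\<phi> \<xi>\<bar>)" using int by simp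
  qed measurable
  then have "(\<lambda>k. Re (fourier (\<lambda>\<xi>. exp (- d k * (norm \<xi>)\<^sup>2) * \<phi> \<xi>) x)) \<longlonglongrightarrow> Re (fourier \<phi> x)"
    by (rule tendsto_Re)
  then show ?thesis
    using pd d unfolding pos_def_fun_def by (intro LIMSEQ_le_const) auto
qed

text \<open>Integrating the transform of \<open>\<phi>\<close> against a wide Gaussian equals, by Fubini, the integral of \<open>\<phi>\<close>
against the transform of that Gaussian, whose total mass is \<open>(2\<pi>)\<^sup>n\<close> whatever the width. As the
transform of \<open>\<phi>\<close> is nonnegative, Fatou's lemma passes to infinite width.\<close>

lemma integrable_fourier_of_nonneg:
  fixes \<phi> :: "'a::euclidean_space \<Rightarrow> real"
  assumes int: "integrable lborel \<phi>" and bd: "\<And>\<xi>. \<bar>\<phi> \<xi>\<bar> \<le> B"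
    and nn: "\<And>x. 0 \<le> Re (fourier \<phi> x)"
  shows "integrable lborel (\<lambda>x. Re (fourier \<phi> x))"
proof -
  have [measurable]: "\<phi> \<in> borel_measurable borel" using int by auto
  have cont: "continuous_on UNIV (fourier \<phi>)" by (rule continuous_fourier[OF int])
  have [measurable]: "fourier \<phi> \<in> borel_measurable borel"
    by (rule borel_measurable_continuous_onI[OF cont])
  define d where "d k = inverse (real (Suc k))" for k
  have d: "d k > 0" for k by (simp add: d_def)
  have d0: "d \<longlonglongrightarrow> 0" unfolding d_def by (rule LIMSEQ_inverse_real_of_nat)
  have bound: "(\<integral>\<^sup>+x. ennreal (exp (- s * (norm x)\<^sup>2) * Re (fourier \<phi> x)) \<partial>lborel) \<le> ennreal (B * (2 * pi) ^ DIM('a))"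
    if s: "s > 0" for s
  proof -
    let ?H = "\<lambda>x \<xi>. cis (x \<bullet> \<xi>) * complex_of_real (exp (- s * (norm x)\<^sup>2) * \<phi> \<xi>)"
    let ?G = "\<lambda>x::'a. exp (- s * (norm x)\<^sup>2)"
    have intG: "integrable lborel ?G" by (rule integrable_gaussian[OF s])
    have int2: "integrable (lborel \<Otimes>\<^sub>M lborel) (\<lambda>(x, \<xi>). ?H x \<xi>)"
    proof (rule lborel_pair.Fubini_integrable)
      show "(\<lambda>(x, \<xi>). ?H x \<xi>) \<in> borel_measurable (lborel \<Otimes>\<^sub>M lborel)" by measurable
      have "(\<integral>\<xi>. norm (?H x \<xi>) \<partial>lborel) = ?G x * (\<integral>\<xi>. \<bar>\<phi> \<xi>\<bar> \<partial>lborel)" for x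
        by (simp add: norm_mult abs_mult)
      then show "integrable lborel (\<lambda>x. \<integral>y. norm (case (x, y) of (x, \<xi>) \<Rightarrow> ?H x \<xi>) \<partial>lborel)"
        using intG by simp
      show "AE x in lborel. integrable lborel (\<lambda>y. case (x, y) of (x, \<xi>) \<Rightarrow> ?H x \<xi>)"
        using integrable_fourier_integrand[OF integrable_mult_right[OF int]] by simp
    qed
    have intg: "integrable lborel (\<lambda>x. complex_of_real (?G x) * fourier \<phi> x)"
    proof (rule Bochner_Integration.integrable_bound)
      show "integrable lborel (\<lambda>x. ?G x * (\<integral>\<xi>. \<bar>\<phi> \<xi>\<bar> \<partial>lborel))"
        by (rule integrable_mult_left[OF intG])
      show "AE x in lborel. norm (complex_of_real (?G x) * fourier \<phi> x) \<le> norm (?G x * (\<integral>\<xi>. \<bar>\<phi> \<xi>\<bar> \<partial>lborel))"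
        using norm_fourier_le[OF int] by (intro AE_I2) (simp add: norm_mult abs_mult)
    qed measurable
    have "(\<integral>x. complex_of_real (?G x) * fourier \<phi> x \<partial>lborel) = (\<integral>x. (\<integral>\<xi>. ?H x \<xi> \<partial>lborel) \<partial>lborel)"
      unfolding fourier_def
      by (intro Bochner_Integration.integral_cong refl, subst integral_mult_right_zero[symmetric],
          intro Bochner_Integration.integral_cong refl) (simp add: mult_ac)
    also have "\<dots> = (\<integral>\<xi>. (\<integral>x. ?H x \<xi> \<partial>lborel) \<partial>lborel)"
      by (rule lborel_pair.Fubini_integral[symmetric, OF int2])
    also have "\<dots> = (\<integral>\<xi>. complex_of_real (\<phi> \<xi>) * fourier ?G \<xi> \<partial>lborel)"
      unfolding fourier_def
      by (intro Bochner_Integration.integral_cong refl, subst integral_mult_right_zero[symmetric],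
          intro Bochner_Integration.integral_cong refl) (simp add: mult_ac inner_commute)
    also have "\<dots> = (\<integral>\<xi>. complex_of_real (\<phi> \<xi> * (sqrt (pi / s) ^ DIM('a) * exp (- (norm \<xi>)\<^sup>2 / (4 * s)))) \<partial>lborel)"
      unfolding fourier_gaussian[OF s] of_real_mult ..
    also have "\<dots> = complex_of_real (\<integral>\<xi>. \<phi> \<xi> * (sqrt (pi / s) ^ DIM('a) * exp (- (norm \<xi>)\<^sup>2 / (4 * s))) \<partial>lborel)"
      by (rule integral_complex_of_real)
    finally have eq: "(\<integral>x. complex_of_real (?G x) * fourier \<phi> x \<partial>lborel)
      = complex_of_real (\<integral>\<xi>. \<phi> \<xi> * (sqrt (pi / s) ^ DIM('a) * exp (- (norm \<xi>)\<^sup>2 / (4 * s))) \<partial>lborel)" .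
    have s4: "1 / (4 * s) > 0" using s by simp
    have gs: "exp (- (norm \<xi>)\<^sup>2 / (4 * s)) = exp (- (1 / (4 * s)) * (norm \<xi>)\<^sup>2)" for \<xi> :: 'a by simp
    have gi: "integrable lborel (\<lambda>\<xi>::'a. exp (- (1 / (4 * s)) * (norm \<xi>)\<^sup>2))"
      by (rule integrable_gaussian[OF s4])
    have gtot: "(\<integral>\<xi>. exp (- (1 / (4 * s)) * (norm (\<xi>::'a))\<^sup>2) \<partial>lborel) = sqrt (pi * (4 * s)) ^ DIM('a)"
    proof -
      have "complex_of_real (\<integral>\<xi>. exp (- (1 / (4 * s)) * (norm (\<xi>::'a))\<^sup>2) \<partial>lborel)
         = fourier (\<lambda>\<xi>. exp (- (1 / (4 * s)) * (norm (\<xi>::'a))\<^sup>2)) 0"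
        unfolding fourier_def by (subst integral_complex_of_real[symmetric]) (simp del: of_real_exp)
      also have "\<dots> = complex_of_real (sqrt (pi * (4 * s)) ^ DIM('a))"
        unfolding fourier_gaussian[OF s4] by simp
      finally show ?thesis using of_real_eq_iff by blast
    qed
    have Re_eq: "(\<integral>x. ?G x * Re (fourier \<phi> x) \<partial>lborel) = Re (\<integral>x. complex_of_real (?G x) * fourier \<phi> x \<partial>lborel)"
      by (subst integral_Re[OF intg, symmetric]) (simp del: of_real_exp)
    have "(\<integral>\<^sup>+x. ennreal (?G x * Re (fourier \<phi> x)) \<partial>lborel) = ennreal (\<integral>x. ?G x * Re (fourier \<phi> x) \<partial>lborel)"
    proof (rule nn_integral_eq_integral)
      show "integrable lborel (\<lambda>x. ?G x * Re (fourier \<phi> x))"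
        using integrable_Re[OF intg] by (simp del: of_real_exp)
    qed (use nn in auto)
    also have "(\<integral>x. ?G x * Re (fourier \<phi> x) \<partial>lborel)
       = (\<integral>\<xi>. \<phi> \<xi> * (sqrt (pi / s) ^ DIM('a) * exp (- (norm \<xi>)\<^sup>2 / (4 * s))) \<partial>lborel)"
      unfolding Re_eq eq by simp
    also have "\<dots> \<le> (\<integral>\<xi>. (B * sqrt (pi / s) ^ DIM('a)) * exp (- (1 / (4 * s)) * (norm (\<xi>::'a))\<^sup>2) \<partial>lborel)"
    proof (rule integral_mono)
      have "integrable lborel (\<lambda>\<xi>::'a. exp (- (1 / (4 * s)) * (norm \<xi>)\<^sup>2) * (\<phi> \<xi> * sqrt (pi / s) ^ DIM('a)))"
        by (rule integrable_gaussian_times_bounded[OF _ _ s4, where B="B * sqrt (pi / s) ^ DIM('a)"])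
           (use bd s in \<open>auto simp: abs_mult intro!: mult_right_mono\<close>)
      then show "integrable lborel (\<lambda>\<xi>. \<phi> \<xi> * (sqrt (pi / s) ^ DIM('a) * exp (- (norm \<xi>)\<^sup>2 / (4 * s))))"
        unfolding gs by (simp add: mult_ac)
      show "integrable lborel (\<lambda>\<xi>::'a. (B * sqrt (pi / s) ^ DIM('a)) * exp (- (1 / (4 * s)) * (norm \<xi>)\<^sup>2))"
        using gi by (intro integrable_mult_right)
      show "\<phi> \<xi> * (sqrt (pi / s) ^ DIM('a) * exp (- (norm \<xi>)\<^sup>2 / (4 * s)))
          \<le> (B * sqrt (pi / s) ^ DIM('a)) * exp (- (1 / (4 * s)) * (norm \<xi>)\<^sup>2)" for \<xi>
        unfolding gs mult.assoc using bd[of \<xi>] s by (intro mult_right_mono) auto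
    qed
    also have "\<dots> = B * (sqrt (pi / s) * sqrt (pi * (4 * s))) ^ DIM('a)"
      by (simp only: integral_mult_right_zero gtot power_mult_distrib mult.assoc)
    also have "sqrt (pi / s) * sqrt (pi * (4 * s)) = 2 * pi"
    proof -
      have "pi / s * (pi * (4 * s)) = (2 * pi)\<^sup>2" using s by (simp add: power2_eq_square)
      then show ?thesis by (simp only: real_sqrt_mult[symmetric] real_sqrt_abs) simp
    qed
    finally show ?thesis by (simp add: ennreal_leI)
  qed
  have "(\<integral>\<^sup>+x. ennreal (Re (fourier \<phi> x)) \<partial>lborel)
      = (\<integral>\<^sup>+x. liminf (\<lambda>k. ennreal (exp (- d k * (norm x)\<^sup>2) * Re (fourier \<phi> x))) \<partial>lborel)"
  proof (intro nn_integral_cong)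
    fix x :: 'a
    have "(\<lambda>k. ennreal (exp (- d k * (norm x)\<^sup>2) * Re (fourier \<phi> x))) \<longlonglongrightarrow> ennreal (exp (- 0 * (norm x)\<^sup>2) * Re (fourier \<phi> x))"
      by (intro tendsto_intros d0)
    then show "ennreal (Re (fourier \<phi> x)) = liminf (\<lambda>k. ennreal (exp (- d k * (norm x)\<^sup>2) * Re (fourier \<phi> x)))"
      by (subst lim_imp_Liminf) auto
  qed
  also have "\<dots> \<le> liminf (\<lambda>k. \<integral>\<^sup>+x. ennreal (exp (- d k * (norm x)\<^sup>2) * Re (fourier \<phi> x)) \<partial>lborel)"
    by (rule nn_integral_liminf) measurable
  also have "\<dots> \<le> liminf (\<lambda>k. ennreal (B * (2 * pi) ^ DIM('a)))"
    by (intro Liminf_mono always_eventually allI bound d)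
  also have "\<dots> < \<infinity>" by (simp add: Liminf_const)
  finally show ?thesis
    using nn by (simp add: integrable_iff_bounded)
qed

section \<open>Rapid decay of the kernel for integer powers\<close>

text \<open>The functions generated from \<open>exp (- |\<xi>|\<^bsup>2k\<^esup>)\<close> by multiplication with the coordinate \<open>\<xi> \<bullet> e\<close> and with
\<open>|\<xi>|\<^sup>2\<close>. This is just large enough to be closed under differentiation in the one direction \<open>e\<close>, and
decay in each single direction is enough.\<close>

inductive schwartz_class :: "nat \<Rightarrow> 'a::euclidean_space \<Rightarrow> ('a \<Rightarrow> real) \<Rightarrow> bool" for k e where
  base: "schwartz_class k e (\<lambda>\<xi>. exp (- (((norm \<xi>)\<^sup>2) ^ k)))"
| coord: "schwartz_class k e \<phi> \<Longrightarrow> schwartz_class k e (\<lambda>\<xi>. (\<xi> \<bullet> e) * \<phi> \<xi>)"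
| radial: "schwartz_class k e \<phi> \<Longrightarrow> schwartz_class k e (\<lambda>\<xi>. (norm \<xi>)\<^sup>2 * \<phi> \<xi>)"
| scale: "schwartz_class k e \<phi> \<Longrightarrow> schwartz_class k e (\<lambda>\<xi>. c * \<phi> \<xi>)"
| plus: "schwartz_class k e \<phi> \<Longrightarrow> schwartz_class k e \<psi> \<Longrightarrow> schwartz_class k e (\<lambda>\<xi>. \<phi> \<xi> + \<psi> \<xi>)"

lemma schwartz_class_radial_power:
  "schwartz_class k e \<phi> \<Longrightarrow> schwartz_class k e (\<lambda>\<xi>. ((norm \<xi>)\<^sup>2) ^ j * \<phi> \<xi>)"
proof (induction j)
  case (Suc j)
  then show ?case using schwartz_class.radial[OF Suc.IH[OF Suc.prems]] by (simp add: mult.assoc)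
qed simp

lemma schwartz_class_measurable:
  assumes "schwartz_class k e \<phi>" shows "\<phi> \<in> borel_measurable borel"
  using assms by induction (simp_all, measurable)

lemma schwartz_class_decay:
  assumes "schwartz_class k e \<phi>" "k \<ge> 1"
  shows "\<exists>B. \<forall>\<xi>. \<bar>\<phi> \<xi>\<bar> \<le> B / (1 + norm \<xi>) ^ N"
  using assms(1)
proof (induction arbitrary: N)
  case base
  obtain B where B: "B > 0" "\<And>y. y \<ge> 0 \<Longrightarrow> exp (- 1 * y powr (2 * real k)) \<le> B / (1 + y) ^ N"
    using exp_neg_power_decay[of 1 "2 * real k" N] assms(2) by auto
  have "((norm \<xi>)\<^sup>2) ^ k = norm \<xi> powr (2 * real k)" for \<xi> :: 'a
  proof (cases "\<xi> = 0")
    case False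
    then have "norm \<xi> powr (2 * real k) = norm \<xi> powr (real (2 * k))" by simp
    also have "\<dots> = norm \<xi> ^ (2 * k)" using False by (subst powr_realpow) auto
    finally show ?thesis by (simp add: power_mult)
  qed (use assms(2) in auto)
  then show ?case using B(2)[OF norm_ge_zero[where 'a='a]] by (intro exI[of _ B]) (simp_all only: mult_1 mult_minus1 abs_exp_cancel simp_thms)
next
  case (coord \<phi>)
  obtain B where B: "\<And>\<xi>. \<bar>\<phi> \<xi>\<bar> \<le> B / (1 + norm \<xi>) ^ Suc N" using coord.IH by blast
  show ?case
  proof (intro exI allI)
    fix \<xi>
    have "\<bar>\<xi> \<bullet> e * \<phi> \<xi>\<bar> \<le> ((1 + norm \<xi>) * norm e) * (B / (1 + norm \<xi>) ^ Suc N)"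
      unfolding abs_mult using B[of \<xi>] Cauchy_Schwarz_ineq2[of \<xi> e]
      by (intro mult_mono) (auto simp: algebra_simps intro: order_trans)
    also have "\<dots> = norm e * B / (1 + norm \<xi>) ^ N"
      using norm_ge_zero[of \<xi>] by (simp add: field_simps add_nonneg_eq_0_iff)
    finally show "\<bar>\<xi> \<bullet> e * \<phi> \<xi>\<bar> \<le> norm e * B / (1 + norm \<xi>) ^ N" .
  qed
next
  case (radial \<phi>)
  obtain B where B: "\<And>\<xi>. \<bar>\<phi> \<xi>\<bar> \<le> B / (1 + norm \<xi>) ^ (N + 2)" using radial.IH by blast
  show ?case
  proof (intro exI allI)
    fix \<xi> :: 'a
    have "\<bar>(norm \<xi>)\<^sup>2 * \<phi> \<xi>\<bar> \<le> (1 + norm \<xi>)\<^sup>2 * (B / (1 + norm \<xi>) ^ (N + 2))"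
      unfolding abs_mult using B[of \<xi>]
      by (intro mult_mono) (auto intro: power_mono)
    also have "\<dots> = B / (1 + norm \<xi>) ^ N"
      using norm_ge_zero[of \<xi>] by (simp add: power_add power2_eq_square add_nonneg_eq_0_iff)
    finally show "\<bar>(norm \<xi>)\<^sup>2 * \<phi> \<xi>\<bar> \<le> B / (1 + norm \<xi>) ^ N" .
  qed
next
  case (scale \<phi> c)
  obtain B where B: "\<And>\<xi>. \<bar>\<phi> \<xi>\<bar> \<le> B / (1 + norm \<xi>) ^ N" using scale.IH by blast
  have "\<bar>c * \<phi> \<xi>\<bar> \<le> \<bar>c\<bar> * B / (1 + norm \<xi>) ^ N" for \<xi>
    using mult_left_mono[OF B, of "\<bar>c\<bar>" \<xi>] by (simp add: abs_mult)
  then show ?case by blast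
next
  case (plus \<phi> \<psi>)
  obtain B where B: "\<And>\<xi>. \<bar>\<phi> \<xi>\<bar> \<le> B / (1 + norm \<xi>) ^ N" using plus.IH by blast
  obtain D where D: "\<And>\<xi>. \<bar>\<psi> \<xi>\<bar> \<le> D / (1 + norm \<xi>) ^ N" using plus.IH by blast
  have "\<bar>\<phi> \<xi> + \<psi> \<xi>\<bar> \<le> (B + D) / (1 + norm \<xi>) ^ N" for \<xi>
    unfolding add_divide_distrib using B[of \<xi>] D[of \<xi>] by linarith
  then show ?case by blast
qed

lemma norm_sq_line:
  "(norm (\<xi> + h *\<^sub>R e))\<^sup>2 = (norm \<xi>)\<^sup>2 + 2 * h * (\<xi> \<bullet> e) + h\<^sup>2 * (norm e)\<^sup>2"
  for \<xi> e :: "'a::real_inner"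
  unfolding power2_norm_eq_inner
  by (simp add: inner_simps inner_commute power2_eq_square algebra_simps)

lemma norm_sq_line_deriv:
  "((\<lambda>h. (norm (\<xi> + h *\<^sub>R e))\<^sup>2) has_real_derivative 2 * (\<xi> \<bullet> e)) (at 0)"
  for \<xi> e :: "'a::real_inner"
  unfolding norm_sq_line by (auto intro!: derivative_eq_intros)

lemma schwartz_class_derivative:
  assumes "schwartz_class k e \<phi>"
  shows "\<exists>\<psi>. schwartz_class k e \<psi> \<and>
    (\<forall>\<xi>. ((\<lambda>h. \<phi> (\<xi> + h *\<^sub>R e)) has_real_derivative \<psi> \<xi>) (at 0))"
  using assms
proof induction
  case base
  have "schwartz_class k e (\<lambda>\<xi>. (- 2 * real k) * ((\<xi> \<bullet> e) * (((norm \<xi>)\<^sup>2) ^ (k - 1) *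
      exp (- (((norm \<xi>)\<^sup>2) ^ k)))))"
    by (intro schwartz_class.scale schwartz_class.coord schwartz_class_radial_power schwartz_class.base)
  moreover have "((\<lambda>h. exp (- (((norm (\<xi> + h *\<^sub>R e))\<^sup>2) ^ k))) has_real_derivative
      (- 2 * real k) * ((\<xi> \<bullet> e) * (((norm \<xi>)\<^sup>2) ^ (k - 1) * exp (- (((norm \<xi>)\<^sup>2) ^ k))))) (at 0)" for \<xi>
    by (rule derivative_eq_intros norm_sq_line_deriv refl)+ simp
  ultimately show ?case by blast
next
  case (coord \<phi>)
  then obtain \<psi> where \<psi>: "schwartz_class k e \<psi>"
    "\<And>\<xi>. ((\<lambda>h. \<phi> (\<xi> + h *\<^sub>R e)) has_real_derivative \<psi> \<xi>) (at 0)" by blast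
  have "schwartz_class k e (\<lambda>\<xi>. (norm e)\<^sup>2 * \<phi> \<xi> + (\<xi> \<bullet> e) * \<psi> \<xi>)"
    by (intro schwartz_class.intros coord \<psi>)
  moreover have "((\<lambda>h. ((\<xi> + h *\<^sub>R e) \<bullet> e) * \<phi> (\<xi> + h *\<^sub>R e)) has_real_derivative
      (norm e)\<^sup>2 * \<phi> \<xi> + (\<xi> \<bullet> e) * \<psi> \<xi>) (at 0)" for \<xi>
    unfolding inner_add_left inner_scaleR_left
    by (rule derivative_eq_intros \<psi>(2) refl)+ (simp add: power2_norm_eq_inner)
  ultimately show ?case by blast
next
  case (radial \<phi>)
  then obtain \<psi> where \<psi>: "schwartz_class k e \<psi>"
    "\<And>\<xi>. ((\<lambda>h. \<phi> (\<xi> + h *\<^sub>R e)) has_real_derivative \<psi> \<xi>) (at 0)" by blast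
  have "schwartz_class k e (\<lambda>\<xi>. 2 * ((\<xi> \<bullet> e) * \<phi> \<xi>) + (norm \<xi>)\<^sup>2 * \<psi> \<xi>)"
    by (intro schwartz_class.intros radial \<psi>)
  moreover have "((\<lambda>h. (norm (\<xi> + h *\<^sub>R e))\<^sup>2 * \<phi> (\<xi> + h *\<^sub>R e)) has_real_derivative
      2 * ((\<xi> \<bullet> e) * \<phi> \<xi>) + (norm \<xi>)\<^sup>2 * \<psi> \<xi>) (at 0)" for \<xi>
    by (rule derivative_eq_intros \<psi>(2) norm_sq_line_deriv refl)+ simp
  ultimately show ?case by blast
next
  case (scale \<phi> c)
  then obtain \<psi> where \<psi>: "schwartz_class k e \<psi>"
    "\<And>\<xi>. ((\<lambda>h. \<phi> (\<xi> + h *\<^sub>R e)) has_real_derivative \<psi> \<xi>) (at 0)" by blast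
  then show ?case
    by (intro exI[of _ "\<lambda>\<xi>. c * \<psi> \<xi>"]) (auto intro!: schwartz_class.intros DERIV_cmult)
next
  case (plus \<phi>1 \<phi>2)
  then obtain \<psi>1 \<psi>2 where \<psi>: "schwartz_class k e \<psi>1"
    "\<And>\<xi>. ((\<lambda>h. \<phi>1 (\<xi> + h *\<^sub>R e)) has_real_derivative \<psi>1 \<xi>) (at 0)"
    "schwartz_class k e \<psi>2"
    "\<And>\<xi>. ((\<lambda>h. \<phi>2 (\<xi> + h *\<^sub>R e)) has_real_derivative \<psi>2 \<xi>) (at 0)" by blast
  then show ?case
    by (intro exI[of _ "\<lambda>\<xi>. \<psi>1 \<xi> + \<psi>2 \<xi>"]) (auto intro!: schwartz_class.intros DERIV_add)
qed

lemma lborel_integral_translate: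
  fixes f :: "'a::euclidean_space \<Rightarrow> 'b::{banach, second_countable_topology}"
  assumes [measurable]: "f \<in> borel_measurable borel"
  shows "(\<integral>x. f (x + c) \<partial>lborel) = (\<integral>x. f x \<partial>lborel)"
proof -
  have "(\<integral>x. f x \<partial>lborel) = (\<integral>x. f x \<partial>(distr lborel borel ((+) c)))"
    by (simp add: lborel_distr_plus)
  also have "\<dots> = (\<integral>x. f (c + x) \<partial>lborel)"
    by (subst integral_distr) auto
  finally show ?thesis by (simp add: add.commute)
qed

text \<open>Translating the integration variable by \<open>h e\<close> multiplies the transform by \<open>cis (- h (x \<bullet> e))\<close>. Dividing the
difference by \<open>h\<close> and letting \<open>h \<rightarrow> 0\<close> replaces integration by parts. The difference quotients are
dominated through the mean value theorem, since a shift by a vector of length at most \<open>1\<close> changes the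
majorant by at most the factor \<open>2\<^bsup>n+2\<^esup>\<close>.\<close>

lemma fourier_derivative:
  fixes \<phi> \<psi> :: "'a::euclidean_space \<Rightarrow> real"
  assumes [measurable]: "\<phi> \<in> borel_measurable borel" "\<psi> \<in> borel_measurable borel"
    and decay: "\<And>\<xi>. \<bar>\<phi> \<xi>\<bar> \<le> B / (1 + norm \<xi>) ^ (DIM('a) + 2)"
      "\<And>\<xi>. \<bar>\<psi> \<xi>\<bar> \<le> B / (1 + norm \<xi>) ^ (DIM('a) + 2)"
    and deriv: "\<And>\<xi>. ((\<lambda>h. \<phi> (\<xi> + h *\<^sub>R e)) has_real_derivative \<psi> \<xi>) (at 0)"
    and e: "norm e = 1"
  shows "fourier \<psi> x = - \<i> * complex_of_real (x \<bullet> e) * fourier \<phi> x"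
proof -
  let ?N = "DIM('a) + 2"
  have B: "B \<ge> 0" using decay(1)[of 0] abs_ge_zero[of "\<phi> 0"] by simp
  have int: "integrable lborel \<phi>"
    by (rule integrable_of_decay[where B=B]) (use decay in auto)
  define h where "h k = inverse (real (Suc k))" for k
  have h: "h k > 0" "h k \<le> 1" for k unfolding h_def by (auto simp: field_simps)
  have h0: "h \<longlonglongrightarrow> 0" unfolding h_def by (rule LIMSEQ_inverse_real_of_nat)
  have h0': "filterlim h (at 0) sequentially"
    using h0 h(1) by (auto simp: filterlim_at intro!: always_eventually) (metis less_irrefl)
  have deriv': "((\<lambda>h. \<phi> (\<xi> + h *\<^sub>R e)) has_real_derivative \<psi> (\<xi> + s *\<^sub>R e)) (at s)" for \<xi> s
  proof -
    have "((\<lambda>h. \<phi> ((\<xi> + s *\<^sub>R e) + (h - s) *\<^sub>R e)) has_real_derivative \<psi> (\<xi> + s *\<^sub>R e) * 1) (at s)"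
      by (rule DERIV_chain2[where g="\<lambda>h. h - s" and f="\<lambda>h. \<phi> ((\<xi> + s *\<^sub>R e) + h *\<^sub>R e)"])
         (use deriv[of "\<xi> + s *\<^sub>R e"] in \<open>auto intro!: derivative_eq_intros\<close>)
    then show ?thesis by (simp add: algebra_simps)
  qed
  have shift: "1 / (1 + norm (\<xi> + s *\<^sub>R e)) ^ ?N \<le> 2 ^ ?N / (1 + norm \<xi>) ^ ?N"
    if "\<bar>s\<bar> \<le> 1" for \<xi> s
  proof -
    have "norm \<xi> \<le> norm (\<xi> + s *\<^sub>R e) + norm (s *\<^sub>R e)"
      by (metis add_diff_cancel_right' norm_triangle_ineq4)
    moreover have "norm (s *\<^sub>R e) \<le> 1" using e that by simp
    moreover have "1 + a \<le> 2 * (1 + b)" if "a \<le> b + c" "c \<le> 1" "0 \<le> b" for a b c :: real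
      using that by (simp add: algebra_simps)
    ultimately have "1 + norm \<xi> \<le> 2 * (1 + norm (\<xi> + s *\<^sub>R e))"
      using norm_ge_zero by blast
    then have "(1 + norm \<xi>) ^ ?N \<le> (2 * (1 + norm (\<xi> + s *\<^sub>R e))) ^ ?N"
      by (intro power_mono) auto
    then have *: "(1 + norm \<xi>) ^ ?N \<le> 2 ^ ?N * (1 + norm (\<xi> + s *\<^sub>R e)) ^ ?N"
      by (simp only: power_mult_distrib)
    have "0 < (1 + norm \<xi>) ^ ?N" "0 < (1 + norm (\<xi> + s *\<^sub>R e)) ^ ?N"
      by (intro zero_less_power add_pos_nonneg; simp)+
    with * show ?thesis by (simp add: pos_divide_le_eq pos_le_divide_eq del: power_add power_Suc power_Suc2)
  qed
  have quot: "\<bar>(\<phi> (\<xi> + h k *\<^sub>R e) - \<phi> \<xi>) / h k\<bar> \<le> (B * 2 ^ ?N) / (1 + norm \<xi>) ^ ?N" for \<xi> k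
  proof -
    obtain s where s: "0 < s" "s < h k"
      "\<phi> (\<xi> + h k *\<^sub>R e) - \<phi> (\<xi> + 0 *\<^sub>R e) = (h k - 0) * \<psi> (\<xi> + s *\<^sub>R e)"
      using MVT2[of 0 "h k" "\<lambda>h. \<phi> (\<xi> + h *\<^sub>R e)" "\<lambda>s. \<psi> (\<xi> + s *\<^sub>R e)"] deriv' h(1)
      by blast
    then have "\<bar>(\<phi> (\<xi> + h k *\<^sub>R e) - \<phi> \<xi>) / h k\<bar> = \<bar>\<psi> (\<xi> + s *\<^sub>R e)\<bar>"
      using h(1)[of k] by simp
    also have "\<dots> \<le> B * (1 / (1 + norm (\<xi> + s *\<^sub>R e)) ^ ?N)"
      using decay(2)[of "\<xi> + s *\<^sub>R e"] by simp
    also have "\<dots> \<le> B * (2 ^ ?N / (1 + norm \<xi>) ^ ?N)"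
      using s(1,2) h(2)[of k] by (intro mult_left_mono shift B) auto
    finally show ?thesis by simp
  qed
  have lim1: "(\<lambda>k. \<integral>\<xi>. cis (x \<bullet> \<xi>) * complex_of_real ((\<phi> (\<xi> + h k *\<^sub>R e) - \<phi> \<xi>) / h k) \<partial>lborel)
      \<longlonglongrightarrow> fourier \<psi> x"
    unfolding fourier_def
  proof (rule integral_dominated_convergence[where w="\<lambda>\<xi>. (B * 2 ^ ?N) / (1 + norm \<xi>) ^ ?N"])
    show "integrable lborel (\<lambda>\<xi>::'a. (B * 2 ^ ?N) / (1 + norm \<xi>) ^ ?N)"
    proof (rule integrable_of_decay[where B="B * 2 ^ ?N"])
      show "norm ((B * 2 ^ ?N) / (1 + norm \<xi>) ^ ?N) \<le> (B * 2 ^ ?N) / (1 + norm \<xi>) ^ ?N" for \<xi> :: 'a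
        unfolding real_norm_def
        by (subst abs_of_nonneg) (auto intro!: divide_nonneg_nonneg mult_nonneg_nonneg B)
    qed measurable
    show "AE \<xi> in lborel. (\<lambda>k. cis (x \<bullet> \<xi>) * complex_of_real ((\<phi> (\<xi> + h k *\<^sub>R e) - \<phi> \<xi>) / h k))
       \<longlonglongrightarrow> cis (x \<bullet> \<xi>) * complex_of_real (\<psi> \<xi>)"
    proof (intro AE_I2 tendsto_intros)
      fix \<xi>
      have "((\<lambda>h. (\<phi> (\<xi> + h *\<^sub>R e) - \<phi> \<xi>) / h) \<longlongrightarrow> \<psi> \<xi>) (at 0)"
        using deriv[of \<xi>] unfolding has_field_derivative_iff by simp
      from filterlim_compose[OF this h0']
      show "(\<lambda>k. (\<phi> (\<xi> + h k *\<^sub>R e) - \<phi> \<xi>) / h k) \<longlonglongrightarrow> \<psi> \<xi>" .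
    qed
    show "AE \<xi> in lborel. norm (cis (x \<bullet> \<xi>) * complex_of_real ((\<phi> (\<xi> + h k *\<^sub>R e) - \<phi> \<xi>) / h k))
        \<le> (B * 2 ^ ?N) / (1 + norm \<xi>) ^ ?N" for k
      using quot by (simp only: norm_mult norm_cis mult_1 norm_of_real AE_I2)
  qed measurable
  have shiftint: "(\<integral>\<xi>. cis (x \<bullet> \<xi>) * complex_of_real ((\<phi> (\<xi> + h k *\<^sub>R e) - \<phi> \<xi>) / h k) \<partial>lborel)
     = (cis (- (h k * (x \<bullet> e))) - 1) / complex_of_real (h k) * fourier \<phi> x" for k
  proof -
    have tr: "(\<integral>\<xi>. cis (x \<bullet> \<xi>) * complex_of_real (\<phi> (\<xi> + h k *\<^sub>R e)) \<partial>lborel)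
       = cis (- (h k * (x \<bullet> e))) * fourier \<phi> x"
      and i: "integrable lborel (\<lambda>\<xi>. cis (x \<bullet> \<xi>) * complex_of_real (\<phi> (\<xi> + h k *\<^sub>R e)))"
    proof -
      have "(\<integral>\<xi>. cis (x \<bullet> \<xi>) * complex_of_real (\<phi> (\<xi> + h k *\<^sub>R e)) \<partial>lborel)
        = (\<integral>\<xi>. (\<lambda>\<eta>. cis (- (h k * (x \<bullet> e))) * (cis (x \<bullet> \<eta>) * complex_of_real (\<phi> \<eta>))) (\<xi> + h k *\<^sub>R e) \<partial>lborel)"
        by (intro Bochner_Integration.integral_cong)
           (auto simp: cis_mult inner_simps mult.assoc[symmetric])
      also have "\<dots> = (\<integral>\<eta>. cis (- (h k * (x \<bullet> e))) * (cis (x \<bullet> \<eta>) * complex_of_real (\<phi> \<eta>)) \<partial>lborel)"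
        by (rule lborel_integral_translate) measurable
      finally show "(\<integral>\<xi>. cis (x \<bullet> \<xi>) * complex_of_real (\<phi> (\<xi> + h k *\<^sub>R e)) \<partial>lborel)
         = cis (- (h k * (x \<bullet> e))) * fourier \<phi> x"
        by (simp add: fourier_def)
      have "\<bar>\<phi> (\<xi> + h k *\<^sub>R e)\<bar> \<le> (B * 2 ^ ?N) / (1 + norm \<xi>) ^ ?N" for \<xi>
      proof -
        have "\<bar>\<phi> (\<xi> + h k *\<^sub>R e)\<bar> \<le> B * (1 / (1 + norm (\<xi> + h k *\<^sub>R e)) ^ ?N)"
          using decay(1)[of "\<xi> + h k *\<^sub>R e"] by simp
        also have "\<dots> \<le> B * (2 ^ ?N / (1 + norm \<xi>) ^ ?N)"
          using h[of k] by (intro mult_left_mono shift B) auto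
        finally show ?thesis by simp
      qed
      then have "integrable lborel (\<lambda>\<xi>. \<phi> (\<xi> + h k *\<^sub>R e))"
        by (intro integrable_of_decay[where B="B * 2 ^ ?N"]) (auto simp del: power_add)
      then show "integrable lborel (\<lambda>\<xi>. cis (x \<bullet> \<xi>) * complex_of_real (\<phi> (\<xi> + h k *\<^sub>R e)))"
        by (rule integrable_fourier_integrand)
    qed
    have "(\<integral>\<xi>. cis (x \<bullet> \<xi>) * complex_of_real ((\<phi> (\<xi> + h k *\<^sub>R e) - \<phi> \<xi>) / h k) \<partial>lborel)
      = (\<integral>\<xi>. (cis (x \<bullet> \<xi>) * complex_of_real (\<phi> (\<xi> + h k *\<^sub>R e))
            - cis (x \<bullet> \<xi>) * complex_of_real (\<phi> \<xi>)) / complex_of_real (h k) \<partial>lborel)"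
      by (intro Bochner_Integration.integral_cong) (auto simp: algebra_simps diff_divide_distrib)
    also have "\<dots> = (cis (- (h k * (x \<bullet> e))) * fourier \<phi> x - fourier \<phi> x) / complex_of_real (h k)"
      using integrable_fourier_integrand[OF int, of x] i
      by (simp add: Bochner_Integration.integral_diff tr fourier_def[symmetric])
    finally show ?thesis by (simp add: algebra_simps)
  qed
  have "((\<lambda>z. exp (- \<i> * complex_of_real (x \<bullet> e) * z)) has_field_derivative - \<i> * complex_of_real (x \<bullet> e)) (at 0)"
    by (rule derivative_eq_intros refl)+ simp
  then have "((\<lambda>z. (exp (- \<i> * complex_of_real (x \<bullet> e) * z) - 1) / z) \<longlongrightarrow> - \<i> * complex_of_real (x \<bullet> e)) (at 0)"
    unfolding has_field_derivative_iff by simp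
  moreover have "filterlim (\<lambda>k. complex_of_real (h k)) (at 0) sequentially"
    using tendsto_of_real[OF h0, where 'a=complex] h(1)
    by (auto simp: filterlim_at intro!: always_eventually) (metis less_irrefl)
  ultimately have "(\<lambda>k. (exp (- \<i> * complex_of_real (x \<bullet> e) * complex_of_real (h k)) - 1) / complex_of_real (h k))
      \<longlonglongrightarrow> - \<i> * complex_of_real (x \<bullet> e)"
    by (rule filterlim_compose)
  then have "(\<lambda>k. (cis (- (h k * (x \<bullet> e))) - 1) / complex_of_real (h k)) \<longlonglongrightarrow> - \<i> * complex_of_real (x \<bullet> e)"
    by (simp add: cis_conv_exp mult_ac)
  then have "(\<lambda>k. (cis (- (h k * (x \<bullet> e))) - 1) / complex_of_real (h k) * fourier \<phi> x)
      \<longlonglongrightarrow> - \<i> * complex_of_real (x \<bullet> e) * fourier \<phi> x"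
    by (rule tendsto_mult_right)
  then show ?thesis
    using lim1 unfolding shiftint by (rule LIMSEQ_unique[symmetric])
qed

lemma schwartz_class_fourier_decay:
  fixes e :: "'a::euclidean_space"
  assumes "schwartz_class k e \<phi>" "k \<ge> 1" "norm e = 1"
  shows "\<exists>B. \<forall>x. \<bar>x \<bullet> e\<bar> ^ j * norm (fourier \<phi> x) \<le> B"
  using assms(1)
proof (induction j arbitrary: \<phi>)
  case 0
  obtain B where "\<And>\<xi>. \<bar>\<phi> \<xi>\<bar> \<le> B / (1 + norm \<xi>) ^ (DIM('a) + 2)"
    using schwartz_class_decay[OF 0 assms(2)] by blast
  then have "integrable lborel \<phi>"
    using schwartz_class_measurable[OF 0] by (intro integrable_of_decay[where B=B]) auto
  from norm_fourier_le[OF this] show ?case by auto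
next
  case (Suc j)
  obtain \<psi> where \<psi>: "schwartz_class k e \<psi>"
    "\<And>\<xi>. ((\<lambda>h. \<phi> (\<xi> + h *\<^sub>R e)) has_real_derivative \<psi> \<xi>) (at 0)"
    using schwartz_class_derivative[OF Suc.prems] by blast
  obtain B1 where B1: "\<And>\<xi>. \<bar>\<phi> \<xi>\<bar> \<le> B1 / (1 + norm \<xi>) ^ (DIM('a) + 2)"
    using schwartz_class_decay[OF Suc.prems assms(2)] by blast
  obtain B2 where B2: "\<And>\<xi>. \<bar>\<psi> \<xi>\<bar> \<le> B2 / (1 + norm \<xi>) ^ (DIM('a) + 2)"
    using schwartz_class_decay[OF \<psi>(1) assms(2)] by blast
  have le: "y / (1 + norm \<xi>) ^ (DIM('a) + 2) \<le> max B1 B2 / (1 + norm \<xi>) ^ (DIM('a) + 2)"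
    if "y \<le> max B1 B2" for y and \<xi> :: 'a
    using that by (intro divide_right_mono) auto
  have "fourier \<psi> x = - \<i> * complex_of_real (x \<bullet> e) * fourier \<phi> x" for x
  proof (rule fourier_derivative[where B="max B1 B2"])
    show "\<bar>\<phi> \<xi>\<bar> \<le> max B1 B2 / (1 + norm \<xi>) ^ (DIM('a) + 2)" for \<xi>
      using order_trans[OF B1 le] by simp
    show "\<bar>\<psi> \<xi>\<bar> \<le> max B1 B2 / (1 + norm \<xi>) ^ (DIM('a) + 2)" for \<xi>
      using order_trans[OF B2 le] by simp
  qed (use \<psi> Suc.prems assms schwartz_class_measurable in auto)
  then have "norm (fourier \<psi> x) = \<bar>x \<bullet> e\<bar> * norm (fourier \<phi> x)" for x
    by (simp add: norm_mult)
  with Suc.IH[OF \<psi>(1)] show ?case by (simp add: mult_ac)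
qed

text \<open>Decay of order \<open>n + 2\<close> in each coordinate gives decay of that order in the largest coordinate,
which is comparable to the norm.\<close>

lemma integrable_fourier_exp_even_power:
  assumes "k \<ge> (1::nat)"
  shows "integrable lborel (fourier (\<lambda>\<xi>::'a::euclidean_space. exp (- (((norm \<xi>)\<^sup>2) ^ k))))"
    (is "integrable _ (fourier ?E)")
proof -
  let ?N = "DIM('a) + 2"
  have E: "schwartz_class k e ?E" for e by (rule schwartz_class.base)
  have "\<forall>e\<in>Basis. \<exists>B. \<forall>x. \<bar>x \<bullet> e\<bar> ^ ?N * norm (fourier ?E x) \<le> B"
    using schwartz_class_fourier_decay[OF E assms norm_Basis] by blast
  then obtain B where B: "\<And>e x. e \<in> Basis \<Longrightarrow> \<bar>x \<bullet> e\<bar> ^ ?N * norm (fourier ?E x) \<le> B e"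
    by metis
  obtain e0 :: 'a where e0: "e0 \<in> Basis" using nonempty_Basis by blast
  obtain B0 where B0: "\<And>x. norm (fourier ?E x) \<le> B0"
    using schwartz_class_fourier_decay[OF E assms, of e0 0] e0 by auto
  \<comment> \<open>dominates every directional constant, and the constant without weight\<close>
  define M where "M = B0 + (\<Sum>e\<in>Basis. B e)"
  have Bnn: "B e \<ge> 0" if "e \<in> Basis" for e
    using B[OF that, of 0] by simp
  have M: "(Max ((\<lambda>e. \<bar>x \<bullet> e\<bar>) ` Basis)) ^ ?N * norm (fourier ?E x) \<le> M" for x
  proof -
    have "Max ((\<lambda>e. \<bar>x \<bullet> e\<bar>) ` Basis) \<in> (\<lambda>e. \<bar>x \<bullet> e\<bar>) ` Basis"
      by (rule Max_in) auto
    then obtain e where e: "e \<in> Basis" "Max ((\<lambda>e. \<bar>x \<bullet> e\<bar>) ` Basis) = \<bar>x \<bullet> e\<bar>"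
      by (rule imageE) blast
    have "B e \<le> (\<Sum>e\<in>Basis. B e)" using e(1) Bnn by (intro member_le_sum) auto
    then show ?thesis
      unfolding e(2) M_def using B[OF e(1), of x] B0[of x] norm_ge_zero[of "fourier ?E x"] by linarith
  qed
  let ?d = "real DIM('a)"
  have main: "norm (fourier ?E x) \<le> ((2 * ?d) ^ ?N * M + 2 ^ ?N * B0) / (1 + norm x) ^ ?N" for x
  proof -
    define mx where "mx = Max ((\<lambda>e. \<bar>x \<bullet> e\<bar>) ` Basis)"
    have "norm x \<le> (\<Sum>e\<in>Basis. \<bar>x \<bullet> e\<bar>)" by (rule norm_le_l1)
    also have "\<dots> \<le> (\<Sum>e\<in>(Basis::'a set). mx)"
      unfolding mx_def by (intro sum_mono Max_ge) auto
    finally have nx: "norm x \<le> ?d * mx" by simp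
    have pos: "0 \<le> norm (fourier ?E x)" "0 \<le> B0" using B0[of x] norm_ge_zero[of "fourier ?E x"] by linarith+
    have M0: "0 \<le> M" using pos(2) Bnn unfolding M_def by (intro add_nonneg_nonneg sum_nonneg) auto
    have "(1 + norm x) ^ ?N * norm (fourier ?E x) \<le> (2 * ?d) ^ ?N * M + 2 ^ ?N * B0"
    proof (cases "norm x \<le> 1")
      case True
      then have "(1 + norm x) ^ ?N \<le> 2 ^ ?N" by (intro power_mono) auto
      then have "(1 + norm x) ^ ?N * norm (fourier ?E x) \<le> 2 ^ ?N * B0"
        using B0[of x] pos by (intro mult_mono) auto
      moreover have "0 \<le> (2 * ?d) ^ ?N * M" using M0 by (intro mult_nonneg_nonneg) auto
      ultimately show ?thesis by linarith
    next
      case False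
      then have "1 + norm x \<le> 2 * ?d * mx" using nx by linarith
      then have "(1 + norm x) ^ ?N \<le> (2 * ?d * mx) ^ ?N" by (intro power_mono) auto
      then have "(1 + norm x) ^ ?N * norm (fourier ?E x) \<le> (2 * ?d * mx) ^ ?N * norm (fourier ?E x)"
        by (intro mult_right_mono) auto
      also have "\<dots> = (2 * ?d) ^ ?N * (mx ^ ?N * norm (fourier ?E x))"
        by (simp only: power_mult_distrib mult.assoc)
      also have "\<dots> \<le> (2 * ?d) ^ ?N * M"
        using M[of x] unfolding mx_def by (intro mult_left_mono) auto
      moreover have "0 \<le> 2 ^ ?N * B0" using pos by (intro mult_nonneg_nonneg) auto
      ultimately show ?thesis by linarith
    qed
    moreover have "0 < (1 + norm x) ^ ?N" by (intro zero_less_power add_pos_nonneg) auto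
    ultimately show ?thesis by (simp only: pos_le_divide_eq mult.commute)
  qed
  have "integrable lborel ?E"
  proof -
    obtain B where "\<And>\<xi>. \<bar>?E \<xi>\<bar> \<le> B / (1 + norm \<xi>) ^ ?N"
      using schwartz_class_decay[OF E assms] by blast
    then show ?thesis
      by (intro integrable_of_decay[where B=B]) auto
  qed
  from continuous_fourier[OF this] have "fourier ?E \<in> borel_measurable borel"
    by (rule borel_measurable_continuous_onI)
  then show ?thesis by (rule integrable_of_decay[OF _ main])
qed

section \<open>Bounds for the heat kernel\<close>

lemma nn_integral_lborel_affine:
  fixes t :: "'a::euclidean_space"
  assumes [measurable]: "f \<in> borel_measurable borel" and c: "c \<noteq> 0"
  shows "(\<integral>\<^sup>+x. f x \<partial>lborel) = ennreal (\<bar>c\<bar> ^ DIM('a)) * (\<integral>\<^sup>+x. f (t + c *\<^sub>R x) \<partial>lborel)"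
  by (subst lborel_affine[OF c, of t])
     (simp add: nn_integral_density nn_integral_distr nn_integral_cmult ennreal_power)

lemma integral_lborel_affine:
  fixes t :: "'a::euclidean_space" and f :: "'a \<Rightarrow> 'b::{banach, second_countable_topology}"
  assumes [measurable]: "f \<in> borel_measurable borel" and c: "c \<noteq> 0"
  shows "(\<integral>x. f x \<partial>lborel) = (\<bar>c\<bar> ^ DIM('a)) *\<^sub>R (\<integral>x. f (t + c *\<^sub>R x) \<partial>lborel)"
  by (subst lborel_affine[OF c, of t])
     (simp add: integral_density integral_distr)

lemma nn_integral_lborel_reflect:
  fixes x :: "'a::euclidean_space"
  assumes [measurable]: "f \<in> borel_measurable borel"
  shows "(\<integral>\<^sup>+y. f (x - y) \<partial>lborel) = (\<integral>\<^sup>+y. f y \<partial>lborel)"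
  using nn_integral_lborel_affine[OF assms, of "-1" x] by simp

lemma nn_integral_lborel_shift:
  fixes x :: "'a::euclidean_space"
  assumes [measurable]: "f \<in> borel_measurable borel"
  shows "(\<integral>\<^sup>+y. f (y + x) \<partial>lborel) = (\<integral>\<^sup>+y. f y \<partial>lborel)"
  using nn_integral_lborel_affine[OF assms, of 1 x] by (simp add: add.commute)

lemma heat_kernel_fourier:
  "heat_kernel m t (x :: real ^ 'n) =
     1 / (2 * pi) ^ CARD('n) * Re (fourier (\<lambda>\<xi>. exp (- t * norm \<xi> powr (2 * m))) x)"
  unfolding heat_kernel_def fourier_def by (subst integral_completion) auto

lemma continuous_heat_kernel:
  assumes "m > 0" "t > 0"
  shows "continuous_on UNIV (heat_kernel m t :: real ^ 'n \<Rightarrow> real)"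
  unfolding heat_kernel_fourier
  using continuous_fourier[OF integrable_exp_neg_norm_powr[of t "2 * m", where 'a="real ^ 'n"]] assms
  by (intro continuous_intros) auto

lemma heat_kernel_scaling:
  fixes x :: "real ^ 'n"
  assumes m: "m > 0" and t: "t > 0"
  shows "heat_kernel m t x =
     t powr (- (real CARD('n) / (2 * m))) * heat_kernel m 1 (t powr (- (1 / (2 * m))) *\<^sub>R x)"
proof -
  define c where "c = t powr (- (1 / (2 * m)))"
  have c: "c > 0" using t by (simp add: c_def)
  have "t * (c * y) powr (2 * m) = y powr (2 * m)" if "y \<ge> 0" for y
  proof -
    have "c powr (2 * m) = inverse t"
      unfolding c_def powr_powr using t m by (simp add: powr_minus_divide inverse_eq_divide)
    then show ?thesis using that c t by (simp add: powr_mult)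
  qed
  then have scale: "exp (- t * norm (0 + c *\<^sub>R \<xi>) powr (2 * m)) = exp (- 1 * norm \<xi> powr (2 * m))" for \<xi> :: "real ^ 'n"
    using c by simp
  have "fourier (\<lambda>\<xi>. exp (- t * norm \<xi> powr (2 * m))) x
     = \<bar>c\<bar> ^ DIM(real ^ 'n) *\<^sub>R (\<integral>\<xi>. cis (x \<bullet> (0 + c *\<^sub>R \<xi>)) * complex_of_real (exp (- t * norm (0 + c *\<^sub>R \<xi>) powr (2 * m))) \<partial>lborel)"
    unfolding fourier_def by (rule integral_lborel_affine) (use c in auto)
  also have "\<dots> = c ^ CARD('n) *\<^sub>R fourier (\<lambda>\<xi>. exp (- 1 * norm \<xi> powr (2 * m))) (c *\<^sub>R x)"
    unfolding scale fourier_def using c by simp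
  finally have "fourier (\<lambda>\<xi>. exp (- t * norm \<xi> powr (2 * m))) x
     = c ^ CARD('n) *\<^sub>R fourier (\<lambda>\<xi>. exp (- 1 * norm \<xi> powr (2 * m))) (c *\<^sub>R x)" .
  moreover have "c ^ CARD('n) = t powr (- (real CARD('n) / (2 * m)))"
    unfolding c_def using t by (subst powr_realpow[symmetric]) (auto simp: powr_powr)
  ultimately show ?thesis
    unfolding heat_kernel_fourier c_def[symmetric] by simp
qed

text \<open>For \<open>m < 1\<close> the symbol is not smooth at \<open>0\<close> but its transform is nonnegative; for integer \<open>m \<ge> 2\<close> the
kernel changes sign but the symbol is smooth. Each case needs its own argument.\<close>

lemma integrable_heat_kernel_one:
  assumes m: "(0 < m \<and> m < 1) \<or> (m \<in> \<nat> \<and> 0 < m)"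
  shows "integrable lborel (heat_kernel m 1 :: real ^ 'n \<Rightarrow> real)"
proof -
  let ?E = "\<lambda>\<xi>::real ^ 'n. exp (- 1 * norm \<xi> powr (2 * m))"
  have m0: "m > 0" using m by auto
  have "integrable lborel (\<lambda>x. Re (fourier ?E x))"
    using m
  proof
    assume m1: "0 < m \<and> m < 1"
    have iE: "integrable lborel ?E" by (rule integrable_exp_neg_norm_powr) (use m0 in auto)
    show ?thesis
    proof (rule integrable_fourier_of_nonneg[OF iE, where B=1])
      have "pos_def_fun ?E" using pos_def_fun_exp_neg_norm_powr[of m, where 'a="real ^ 'n"] m1 by simp
      then show "0 \<le> Re (fourier ?E x)" for x by (rule pos_def_fun_fourier_nonneg[OF _ iE])
    qed simp
  next
    assume "m \<in> \<nat> \<and> 0 < m"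
    then obtain k where k: "m = real k" "k \<ge> 1" by (auto elim!: Nats_cases)
    have E: "?E \<xi> = exp (- (((norm \<xi>)\<^sup>2) ^ k))" for \<xi>
    proof (cases "\<xi> = 0")
      case False
      then have "norm \<xi> powr (2 * m) = norm \<xi> powr (real (2 * k))" using k by simp
      also have "\<dots> = norm \<xi> ^ (2 * k)" using False by (subst powr_realpow) auto
      finally show ?thesis by (simp add: power_mult)
    qed (use k in auto)
    show ?thesis unfolding E
      by (rule integrable_Re[OF integrable_fourier_exp_even_power[OF k(2)]])
  qed
  then show ?thesis
    unfolding heat_kernel_fourier[abs_def] by (rule integrable_mult_right)
qed

lemma heat_kernel_bounds:
  assumes m: "(0 < m \<and> m < 1) \<or> (m \<in> \<nat> \<and> 0 < m)"
  shows "\<exists>G>0. \<forall>t>0. (\<forall>x::real ^ 'n. \<bar>heat_kernel m t x\<bar> \<le> G * t powr (- (real CARD('n) / (2 * m)))) \<and>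
     (\<integral>\<^sup>+x. ennreal \<bar>heat_kernel m t (x :: real ^ 'n)\<bar> \<partial>lborel) \<le> ennreal G"
proof -
  have m0: "m > 0" using m by auto
  let ?g = "heat_kernel m 1 :: real ^ 'n \<Rightarrow> real"
  let ?I = "\<integral>x. \<bar>?g x\<bar> \<partial>lborel"
  have int: "integrable lborel ?g" by (rule integrable_heat_kernel_one[OF m])
  have [measurable]: "?g \<in> borel_measurable borel" using int by auto
  have I0: "?I \<ge> 0" by simp
  obtain G1 where G1: "\<And>x. \<bar>?g x\<bar> \<le> G1"
  proof -
    let ?E = "\<lambda>\<xi>::real ^ 'n. exp (- 1 * norm \<xi> powr (2 * m))"
    have iE: "integrable lborel ?E" by (rule integrable_exp_neg_norm_powr) (use m0 in auto)
    have "\<bar>?g x\<bar> \<le> 1 / (2 * pi) ^ CARD('n) * (\<integral>\<xi>. \<bar>?E \<xi>\<bar> \<partial>lborel)" for x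
      unfolding heat_kernel_fourier abs_mult
      using order_trans[OF abs_Re_le_cmod norm_fourier_le[OF iE, of x]]
      by (intro mult_mono) auto
    then show ?thesis by (rule that)
  qed
  have G10: "G1 \<ge> 0" using G1[of 0] abs_ge_zero[of "?g 0"] by linarith
  show ?thesis
  proof (intro exI[of _ "G1 + ?I + 1"] conjI allI impI)
    show "0 < G1 + ?I + 1" using I0 G10 by linarith
    fix t :: real assume t: "t > 0"
    define c where "c = t powr (- (1 / (2 * m)))"
    have c: "c > 0" using t by (simp add: c_def)
    show "\<bar>heat_kernel m t x\<bar> \<le> (G1 + ?I + 1) * t powr (- (real CARD('n) / (2 * m)))" for x :: "real ^ 'n"
    proof -
      have "\<bar>heat_kernel m t x\<bar> = \<bar>?g (c *\<^sub>R x)\<bar> * t powr (- (real CARD('n) / (2 * m)))"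
        unfolding heat_kernel_scaling[OF m0 t, of x] c_def by (simp add: abs_mult)
      also have "\<dots> \<le> (G1 + ?I + 1) * t powr (- (real CARD('n) / (2 * m)))"
        using G1[of "c *\<^sub>R x"] I0 by (intro mult_right_mono powr_ge_zero) linarith
      finally show ?thesis .
    qed
    have cn: "c ^ CARD('n) = t powr (- (real CARD('n) / (2 * m)))"
      unfolding c_def using t by (subst powr_realpow[symmetric]) (auto simp: powr_powr)
    have "(\<integral>\<^sup>+x. ennreal \<bar>heat_kernel m t (x :: real ^ 'n)\<bar> \<partial>lborel)
       = ennreal (\<bar>c\<bar> ^ DIM(real ^ 'n)) * (\<integral>\<^sup>+x. ennreal \<bar>?g (0 + c *\<^sub>R x)\<bar> \<partial>lborel)"
      unfolding heat_kernel_scaling[OF m0 t] c_def[symmetric] cn[symmetric]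
      using c by (subst nn_integral_cmult[symmetric]) (auto simp: abs_mult ennreal_mult)
    also have "\<dots> = (\<integral>\<^sup>+x. ennreal \<bar>?g x\<bar> \<partial>lborel)"
      by (rule nn_integral_lborel_affine[symmetric]) (use c in auto)
    also have "\<dots> = ennreal ?I"
      by (rule nn_integral_eq_integral) (use int in auto)
    also have "\<dots> \<le> ennreal (G1 + ?I + 1)"
      using G10 by (intro ennreal_leI) linarith
    finally show "(\<integral>\<^sup>+x. ennreal \<bar>heat_kernel m t (x :: real ^ 'n)\<bar> \<partial>lborel) \<le> ennreal (G1 + ?I + 1)" .
  qed
qed

section \<open>Weak Lebesgue spaces through distribution functions\<close>

text \<open>Functions with values in \<^typ>\<open>ennreal\<close> are allowed so that time integrals of absolute values can be handled
before they are known to be finite.\<close>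

definition weak_type :: "real \<Rightarrow> real \<Rightarrow> (real ^ 'n \<Rightarrow> ennreal) \<Rightarrow> bool" where
  "weak_type q A f \<longleftrightarrow> f \<in> borel_measurable lebesgue \<and>
     (\<forall>\<tau>>0. emeasure lebesgue {x. ennreal \<tau> < f x} \<le> ennreal ((A / \<tau>) powr q))"

text \<open>The dual description of \<open>L\<^bsup>q,\<infinity>\<^esup>\<close>. It is additive in \<open>f\<close> and passes under integrals by Tonelli's theorem,
whereas \<open>weak_type\<close> is suited to products and to splitting by level sets. For \<open>q > 1\<close> the two
agree up to the factor \<open>q / (q - 1)\<close>.\<close>

definition marcinkiewicz :: "real \<Rightarrow> real \<Rightarrow> (real ^ 'n \<Rightarrow> ennreal) \<Rightarrow> bool" where
  "marcinkiewicz q A f \<longleftrightarrow> f \<in> borel_measurable lebesgue \<and>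
     (\<forall>E\<in>sets borel. emeasure lborel E < \<infinity> \<longrightarrow>
        (\<integral>\<^sup>+x\<in>E. f x \<partial>lebesgue) \<le> ennreal (A * measure lborel E powr (1 - 1 / q)))"

abbreviation eabs :: "('a \<Rightarrow> real) \<Rightarrow> 'a \<Rightarrow> ennreal" where
  "eabs f \<equiv> \<lambda>x. ennreal \<bar>f x\<bar>"

lemma superlevel_lebesgue [measurable]:
  fixes f :: "real ^ 'n \<Rightarrow> ennreal"
  assumes "f \<in> borel_measurable lebesgue"
  shows "{x. c < f x} \<in> sets lebesgue"
  using borel_measurable_less[of "\<lambda>_. c" lebesgue f] assms by simp

lemma weak_typeD:
  assumes "weak_type q A f"
  shows "f \<in> borel_measurable lebesgue"
    "\<tau> > 0 \<Longrightarrow> emeasure lebesgue {x. ennreal \<tau> < f x} \<le> ennreal ((A / \<tau>) powr q)"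
  using assms unfolding weak_type_def by auto

lemma weak_type_mono_AE:
  fixes f g :: "real ^ 'n \<Rightarrow> ennreal"
  assumes "weak_type q A g" and [measurable]: "f \<in> borel_measurable lebesgue"
    and "AE x in lebesgue. f x \<le> g x"
  shows "weak_type q A f"
  unfolding weak_type_def
proof (intro conjI allI impI)
  fix \<tau> :: real assume \<tau>: "\<tau> > 0"
  note [measurable] = weak_typeD(1)[OF assms(1)]
  have "emeasure lebesgue {x. ennreal \<tau> < f x} \<le> emeasure lebesgue {x. ennreal \<tau> < g x}"
    by (rule emeasure_mono_AE) (use assms(3) in \<open>auto elim!: eventually_mono\<close>)
  also note weak_typeD(2)[OF assms(1) \<tau>]
  finally show "emeasure lebesgue {x. ennreal \<tau> < f x} \<le> ennreal ((A / \<tau>) powr q)" .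
qed fact

lemma weak_type_mono:
  fixes f :: "real ^ 'n \<Rightarrow> ennreal"
  assumes "weak_type q A f" "0 \<le> A" "A \<le> B" "q > 0"
  shows "weak_type q B f"
  unfolding weak_type_def
proof (intro conjI allI impI)
  fix \<tau> :: real assume \<tau>: "\<tau> > 0"
  note weak_typeD(2)[OF assms(1) \<tau>]
  also have "ennreal ((A / \<tau>) powr q) \<le> ennreal ((B / \<tau>) powr q)"
    using assms \<tau> by (intro ennreal_leI powr_mono2 divide_right_mono) auto
  finally show "emeasure lebesgue {x. ennreal \<tau> < f x} \<le> ennreal ((B / \<tau>) powr q)" .
qed (rule weak_typeD[OF assms(1)])

lemma weak_type_cmult:
  fixes f :: "real ^ 'n \<Rightarrow> ennreal"
  assumes f: "weak_type q A f" and c: "c > 0"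
  shows "weak_type q (c * A) (\<lambda>x. ennreal c * f x)"
  unfolding weak_type_def
proof (intro conjI allI impI)
  note [measurable] = weak_typeD(1)[OF f]
  show "(\<lambda>x. ennreal c * f x) \<in> borel_measurable lebesgue" by measurable
  fix \<tau> :: real assume \<tau>: "\<tau> > 0"
  have "{x. ennreal \<tau> < ennreal c * f x} \<subseteq> {x. ennreal (\<tau> / c) < f x}"
  proof safe
    fix x assume *: "ennreal \<tau> < ennreal c * f x"
    show "ennreal (\<tau> / c) < f x"
    proof (rule ccontr)
      assume "\<not> ?thesis"
      then have "ennreal c * f x \<le> ennreal c * ennreal (\<tau> / c)" by (intro mult_left_mono) auto
      also have "\<dots> = ennreal \<tau>" using c \<tau> by (simp add: ennreal_mult[symmetric])
      finally show False using * by simp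
    qed
  qed
  then have "emeasure lebesgue {x. ennreal \<tau> < ennreal c * f x} \<le> emeasure lebesgue {x. ennreal (\<tau> / c) < f x}"
    by (intro emeasure_mono) auto
  also have "\<dots> \<le> ennreal ((A / (\<tau> / c)) powr q)" by (rule weak_typeD(2)[OF f]) (use c \<tau> in auto)
  also have "A / (\<tau> / c) = c * A / \<tau>" using c by simp
  finally show "emeasure lebesgue {x. ennreal \<tau> < ennreal c * f x} \<le> ennreal ((c * A / \<tau>) powr q)" .
qed

lemma weak_type_add:
  fixes f g :: "real ^ 'n \<Rightarrow> ennreal"
  assumes f: "weak_type q A f" and g: "weak_type q A g" and A: "A \<ge> 0" and q: "q > 0"
  shows "weak_type q (2 * 2 powr (1 / q) * A) (\<lambda>x. f x + g x)"
  unfolding weak_type_def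
proof (intro conjI allI impI)
  note [measurable] = weak_typeD(1)[OF f] weak_typeD(1)[OF g]
  show "(\<lambda>x. f x + g x) \<in> borel_measurable lebesgue" by measurable
  fix \<tau> :: real assume \<tau>: "\<tau> > 0"
  have "{x. ennreal \<tau> < f x + g x} \<subseteq> {x. ennreal (\<tau> / 2) < f x} \<union> {x. ennreal (\<tau> / 2) < g x}"
  proof (rule subsetI, rule ccontr)
    fix x assume *: "x \<in> {x. ennreal \<tau> < f x + g x}"
      and "x \<notin> {x. ennreal (\<tau> / 2) < f x} \<union> {x. ennreal (\<tau> / 2) < g x}"
    then have "f x + g x \<le> ennreal (\<tau> / 2) + ennreal (\<tau> / 2)" by (intro add_mono) auto
    also have "\<dots> = ennreal \<tau>" using \<tau> by (simp flip: ennreal_plus)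
    finally show False using * by simp
  qed
  then have "emeasure lebesgue {x. ennreal \<tau> < f x + g x}
      \<le> emeasure lebesgue ({x. ennreal (\<tau> / 2) < f x} \<union> {x. ennreal (\<tau> / 2) < g x})"
    by (intro emeasure_mono) auto
  also have "\<dots> \<le> emeasure lebesgue {x. ennreal (\<tau> / 2) < f x} + emeasure lebesgue {x. ennreal (\<tau> / 2) < g x}"
    by (intro emeasure_subadditive) auto
  also have "\<dots> \<le> ennreal ((A / (\<tau> / 2)) powr q) + ennreal ((A / (\<tau> / 2)) powr q)"
    using \<tau> by (intro add_mono weak_typeD(2)[OF f] weak_typeD(2)[OF g]) auto
  also have "\<dots> = ennreal ((2 * 2 powr (1 / q) * A / \<tau>) powr q)"
  proof -
    have "(2 * 2 powr (1 / q) * A / \<tau>) powr q = (2 powr (1 / q) * (A / (\<tau> / 2))) powr q"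
      by (simp add: mult_ac)
    also have "\<dots> = 2 * (A / (\<tau> / 2)) powr q"
      using A \<tau> q by (subst powr_mult) (auto simp: powr_powr)
    finally show ?thesis by (simp flip: ennreal_plus)
  qed
  finally show "emeasure lebesgue {x. ennreal \<tau> < f x + g x} \<le> ennreal ((2 * 2 powr (1 / q) * A / \<tau>) powr q)" .
qed

text \<open>Hoelder's inequality for weak spaces: where the product exceeds \<open>\<tau>\<close>, one of the factors exceeds its
share of \<open>\<tau>\<close>, and the shares are chosen to make both level sets equally large.\<close>

lemma weak_type_mult:
  fixes f g :: "real ^ 'n \<Rightarrow> ennreal"
  assumes f: "weak_type a A f" and g: "weak_type b B g"
    and pos: "A > 0" "B > 0" "a > 0" "b > 0" "r > 0" and r: "1 / r = 1 / a + 1 / b"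
  shows "weak_type r (2 powr (1 / r) * (A * B)) (\<lambda>x. f x * g x)"
  unfolding weak_type_def
proof (intro conjI allI impI)
  note [measurable] = weak_typeD(1)[OF f] weak_typeD(1)[OF g]
  show "(\<lambda>x. f x * g x) \<in> borel_measurable lebesgue" by measurable
  fix \<tau> :: real assume \<tau>: "\<tau> > 0"
  define \<theta> where "\<theta> = (\<tau> / (A * B)) powr r"
  have \<theta>: "\<theta> > 0" using \<tau> pos by (simp add: \<theta>_def)
  \<comment> \<open>both level sets get the measure bound \<open>1 / \<theta>\<close>\<close>
  define s1 s2 where "s1 = A * \<theta> powr (1 / a)" and "s2 = B * \<theta> powr (1 / b)"
  have s: "s1 > 0" "s2 > 0" using pos \<theta> by (auto simp: s1_def s2_def)
  have "s1 * s2 = A * B * \<theta> powr (1 / r)"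
    unfolding s1_def s2_def r powr_add by simp
  also have "\<dots> = \<tau>" unfolding \<theta>_def using pos \<tau> by (simp add: powr_powr)
  finally have s12: "s1 * s2 = \<tau>" .
  have "{x. ennreal \<tau> < f x * g x} \<subseteq> {x. ennreal s1 < f x} \<union> {x. ennreal s2 < g x}"
  proof (rule subsetI, rule ccontr)
    fix x assume *: "x \<in> {x. ennreal \<tau> < f x * g x}"
      and "x \<notin> {x. ennreal s1 < f x} \<union> {x. ennreal s2 < g x}"
    then have "f x * g x \<le> ennreal s1 * ennreal s2" by (intro mult_mono) auto
    also have "\<dots> = ennreal \<tau>" using s s12 by (simp flip: ennreal_mult)
    finally show False using * by simp
  qed
  then have "emeasure lebesgue {x. ennreal \<tau> < f x * g x}
      \<le> emeasure lebesgue ({x. ennreal s1 < f x} \<union> {x. ennreal s2 < g x})"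
    by (intro emeasure_mono) auto
  also have "\<dots> \<le> emeasure lebesgue {x. ennreal s1 < f x} + emeasure lebesgue {x. ennreal s2 < g x}"
    by (intro emeasure_subadditive) auto
  also have "\<dots> \<le> ennreal ((A / s1) powr a) + ennreal ((B / s2) powr b)"
    using s by (intro add_mono weak_typeD(2)[OF f] weak_typeD(2)[OF g]) auto
  also have "\<dots> = ennreal (2 * inverse \<theta>)"
  proof -
    have "(A / s1) powr a = inverse \<theta>" "(B / s2) powr b = inverse \<theta>"
      using pos \<theta> by (auto simp: s1_def s2_def powr_divide powr_powr inverse_eq_divide)
    then show ?thesis using \<theta> by (simp flip: ennreal_plus)
  qed
  also have "2 * inverse \<theta> = (2 powr (1 / r) * (A * B) / \<tau>) powr r"
  proof -
    have "(2 powr (1 / r) * (A * B) / \<tau>) powr r = (2 powr (1 / r)) powr r * ((A * B) / \<tau>) powr r"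
      using pos \<tau> by (subst powr_mult[symmetric]) auto
    also have "\<dots> = 2 * inverse \<theta>"
      unfolding \<theta>_def using pos \<tau> by (simp add: powr_powr powr_divide)
    finally show ?thesis ..
  qed
  finally show "emeasure lebesgue {x. ennreal \<tau> < f x * g x} \<le> ennreal ((2 powr (1 / r) * (A * B) / \<tau>) powr r)" .
qed

lemma weak_type_powr:
  fixes f :: "real ^ 'n \<Rightarrow> real"
  assumes f: "weak_type a A (eabs f)" and m: "f \<in> borel_measurable lebesgue"
    and pos: "A > 0" "a > 0" "s > 0"
  shows "weak_type (a / s) (A powr s) (\<lambda>x. ennreal (\<bar>f x\<bar> powr s))"
  unfolding weak_type_def
proof (intro conjI allI impI)
  note [measurable] = m
  show "(\<lambda>x. ennreal (\<bar>f x\<bar> powr s)) \<in> borel_measurable lebesgue" by measurable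
  fix \<tau> :: real assume \<tau>: "\<tau> > 0"
  have "{x. ennreal \<tau> < ennreal (\<bar>f x\<bar> powr s)} \<subseteq> {x. ennreal (\<tau> powr (1 / s)) < ennreal \<bar>f x\<bar>}"
  proof safe
    fix x assume "ennreal \<tau> < ennreal (\<bar>f x\<bar> powr s)"
    then have "\<tau> < \<bar>f x\<bar> powr s" using \<tau> by (simp add: ennreal_less_iff)
    then have "\<tau> powr (1 / s) < (\<bar>f x\<bar> powr s) powr (1 / s)" using \<tau> pos by (intro powr_less_mono2) auto
    also have "\<dots> = \<bar>f x\<bar>" using pos by (simp add: powr_powr)
    finally show "ennreal (\<tau> powr (1 / s)) < ennreal \<bar>f x\<bar>" by (intro ennreal_lessI) auto
  qed
  then have "emeasure lebesgue {x. ennreal \<tau> < ennreal (\<bar>f x\<bar> powr s)}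
      \<le> emeasure lebesgue {x. ennreal (\<tau> powr (1 / s)) < ennreal \<bar>f x\<bar>}"
    by (rule emeasure_mono[OF _ superlevel_lebesgue[OF weak_typeD(1)[OF f]]])
  also have "\<dots> \<le> ennreal ((A / \<tau> powr (1 / s)) powr a)"
    by (rule weak_typeD(2)[OF f]) (use \<tau> in auto)
  also have "(A / \<tau> powr (1 / s)) powr a = (A powr s / \<tau>) powr (a / s)"
    using pos \<tau> by (simp add: powr_divide powr_powr)
  finally show "emeasure lebesgue {x. ennreal \<tau> < ennreal (\<bar>f x\<bar> powr s)}
      \<le> ennreal ((A powr s / \<tau>) powr (a / s))" .
qed

lemma weak_type_norm_powr:
  assumes "\<alpha> > 0"
  shows "\<exists>V>0. weak_type (real CARD('n) / \<alpha>) V (\<lambda>x::real ^ 'n. ennreal (norm x powr (- \<alpha>)))"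
proof -
  let ?n = "real CARD('n)"
  let ?v = "unit_ball_vol ?n"
  define V where "V = ?v powr (\<alpha> / ?n)"
  have v: "?v > 0" by (rule unit_ball_vol_pos) simp
  have v0: "?v \<noteq> 0" using v by (rule less_imp_neq[symmetric])
  then have V: "V > 0" unfolding V_def powr_gt_zero .
  have "weak_type (?n / \<alpha>) V (\<lambda>x::real ^ 'n. ennreal (norm x powr (- \<alpha>)))"
    unfolding weak_type_def
  proof (intro conjI allI impI)
    show "(\<lambda>x::real ^ 'n. ennreal (norm x powr (- \<alpha>))) \<in> borel_measurable lebesgue"
      by (rule measurable_completion) measurable
    fix \<tau> :: real assume \<tau>: "\<tau> > 0"
    let ?R = "\<tau> powr (- (1 / \<alpha>))"
    have "{x::real ^ 'n. ennreal \<tau> < ennreal (norm x powr (- \<alpha>))} \<subseteq> ball 0 ?R"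
    proof safe
      fix x :: "real ^ 'n" assume "ennreal \<tau> < ennreal (norm x powr (- \<alpha>))"
      then have *: "\<tau> < norm x powr (- \<alpha>)" using \<tau> by (simp add: ennreal_less_iff)
      then have x: "norm x > 0" using \<tau> by (cases "norm x = 0") auto
      have "(norm x powr (- \<alpha>)) powr (- (1 / \<alpha>)) < \<tau> powr (- (1 / \<alpha>))"
        using * \<tau> assms by (intro powr_less_mono2_neg) auto
      then show "x \<in> ball 0 ?R" using x assms by (simp add: powr_powr)
    qed
    then have "emeasure lebesgue {x::real ^ 'n. ennreal \<tau> < ennreal (norm x powr (- \<alpha>))}
        \<le> emeasure lebesgue (ball (0 :: real ^ 'n) ?R)"
      by (intro emeasure_mono) auto
    also have "\<dots> = ennreal (?v * ?R ^ CARD('n))"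
      using emeasure_ball[of ?R "0 :: real ^ 'n"] by simp
    also have "?v * ?R ^ CARD('n) = (V / \<tau>) powr (?n / \<alpha>)"
    proof -
      have "?R ^ CARD('n) = \<tau> powr (- (?n / \<alpha>))"
        using \<tau> by (subst powr_realpow[symmetric]) (auto simp: powr_powr)
      moreover have "V powr (?n / \<alpha>) = ?v" unfolding V_def powr_powr using v0 assms by simp
      moreover have "(V / \<tau>) powr (?n / \<alpha>) = V powr (?n / \<alpha>) / \<tau> powr (?n / \<alpha>)"
        using V \<tau> by (simp add: powr_divide)
      ultimately show ?thesis by (simp only: powr_minus divide_inverse)
    qed
    finally show "emeasure lebesgue {x::real ^ 'n. ennreal \<tau> < ennreal (norm x powr (- \<alpha>))}
        \<le> ennreal ((V / \<tau>) powr (?n / \<alpha>))" .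
  qed
  with V show ?thesis by blast
qed

text \<open>Above height \<open>B\<close> the level sets are empty, and below it \<open>B / \<tau> \<ge> 1\<close> may be raised to the power \<open>q - r\<close> for free.\<close>

lemma weak_type_interpolate:
  fixes f :: "real ^ 'n \<Rightarrow> ennreal"
  assumes f: "weak_type r A f" and bd: "\<And>x. f x \<le> ennreal B" and pos: "A > 0" "B > 0" "0 < r" "r \<le> q"
  shows "weak_type q (A powr (r / q) * B powr (1 - r / q)) f"
  unfolding weak_type_def
proof (intro conjI allI impI)
  fix \<tau> :: real assume \<tau>: "\<tau> > 0"
  show "emeasure lebesgue {x. ennreal \<tau> < f x} \<le> ennreal ((A powr (r / q) * B powr (1 - r / q) / \<tau>) powr q)"
  proof (cases "\<tau> < B")
    case False
    then have "{x. ennreal \<tau> < f x} = {}"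
      using bd order_trans[OF bd ennreal_leI[of B \<tau>]] by (auto simp: not_less[symmetric])
    then show ?thesis by simp
  next
    case True
    have "(A / \<tau>) powr r * 1 \<le> (A / \<tau>) powr r * (B / \<tau>) powr (q - r)"
      using True \<tau> pos by (intro mult_left_mono ge_one_powr_ge_zero) auto
    also have "\<dots> = A powr r * B powr (q - r) / (\<tau> powr r * \<tau> powr (q - r))"
      using pos \<tau> by (simp add: powr_divide)
    also have "\<dots> = (A powr (r / q) * B powr (1 - r / q) / \<tau>) powr q"
      using pos \<tau> by (simp add: powr_divide powr_mult powr_powr algebra_simps powr_add[symmetric])
    finally show ?thesis
      by (intro order_trans[OF weak_typeD(2)[OF f \<tau>] ennreal_leI]) simp
  qed
qed (rule weak_typeD[OF f])

lemma marcinkiewicz_mono_AE: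
  fixes f g :: "real ^ 'n \<Rightarrow> ennreal"
  assumes g: "marcinkiewicz q A g" and [measurable]: "f \<in> borel_measurable lebesgue"
    and le: "AE x in lebesgue. f x \<le> g x"
  shows "marcinkiewicz q A f"
  unfolding marcinkiewicz_def
proof (intro conjI ballI impI)
  fix E :: "(real ^ 'n) set" assume E: "E \<in> sets borel" "emeasure lborel E < \<infinity>"
  have "(\<integral>\<^sup>+x\<in>E. f x \<partial>lebesgue) \<le> (\<integral>\<^sup>+x\<in>E. g x \<partial>lebesgue)"
    using le by (intro nn_integral_mono_AE) (auto elim!: eventually_mono intro: mult_right_mono)
  also have "\<dots> \<le> ennreal (A * measure lborel E powr (1 - 1 / q))"
    using g E unfolding marcinkiewicz_def by blast
  finally show "(\<integral>\<^sup>+x\<in>E. f x \<partial>lebesgue) \<le> ennreal (A * measure lborel E powr (1 - 1 / q))" .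
qed fact

lemma marcinkiewicz_mono:
  fixes f :: "real ^ 'n \<Rightarrow> ennreal"
  assumes f: "marcinkiewicz q A f" and AB: "A \<le> B"
  shows "marcinkiewicz q B f"
  unfolding marcinkiewicz_def
proof (intro conjI ballI impI)
  show "f \<in> borel_measurable lebesgue" using f unfolding marcinkiewicz_def by blast
  fix E :: "(real ^ 'n) set" assume "E \<in> sets borel" "emeasure lborel E < \<infinity>"
  then have "(\<integral>\<^sup>+x\<in>E. f x \<partial>lebesgue) \<le> ennreal (A * measure lborel E powr (1 - 1 / q))"
    using f unfolding marcinkiewicz_def by blast
  also have "\<dots> \<le> ennreal (B * measure lborel E powr (1 - 1 / q))"
    using AB by (intro ennreal_leI mult_right_mono) auto
  finally show "(\<integral>\<^sup>+x\<in>E. f x \<partial>lebesgue) \<le> ennreal (B * measure lborel E powr (1 - 1 / q))" .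
qed

lemma marcinkiewicz_add:
  fixes f g :: "real ^ 'n \<Rightarrow> ennreal"
  assumes f: "marcinkiewicz q A f" and g: "marcinkiewicz q B g" and "A \<ge> 0" "B \<ge> 0"
  shows "marcinkiewicz q (A + B) (\<lambda>x. f x + g x)"
  unfolding marcinkiewicz_def
proof (intro conjI ballI impI)
  have [measurable]: "f \<in> borel_measurable lebesgue" "g \<in> borel_measurable lebesgue"
    using f g unfolding marcinkiewicz_def by auto
  show "(\<lambda>x. f x + g x) \<in> borel_measurable lebesgue" by measurable
  fix E :: "(real ^ 'n) set" assume E: "E \<in> sets borel" "emeasure lborel E < \<infinity>"
  then have [measurable]: "E \<in> sets lebesgue" by simp
  have "(\<integral>\<^sup>+x\<in>E. (f x + g x) \<partial>lebesgue) = (\<integral>\<^sup>+x\<in>E. f x \<partial>lebesgue) + (\<integral>\<^sup>+x\<in>E. g x \<partial>lebesgue)"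
    by (subst nn_integral_add[symmetric]) (auto simp: distrib_right)
  also have "\<dots> \<le> ennreal (A * measure lborel E powr (1 - 1 / q)) + ennreal (B * measure lborel E powr (1 - 1 / q))"
    using f g E unfolding marcinkiewicz_def by (intro add_mono) blast+
  also have "\<dots> = ennreal ((A + B) * measure lborel E powr (1 - 1 / q))"
    using assms(3,4) by (simp add: distrib_right flip: ennreal_plus)
  finally show "(\<integral>\<^sup>+x\<in>E. (f x + g x) \<partial>lebesgue) \<le> ennreal ((A + B) * measure lborel E powr (1 - 1 / q))" .
qed

text \<open>Every Lebesgue set differs from a Borel set by a null set.\<close>

lemma marcinkiewicz_lebesgue_set:
  fixes f :: "real ^ 'n \<Rightarrow> ennreal"
  assumes f: "marcinkiewicz q A f" and E: "E \<in> sets lebesgue" "emeasure lebesgue E < \<infinity>"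
  shows "(\<integral>\<^sup>+x\<in>E. f x \<partial>lebesgue) \<le> ennreal (A * measure lebesgue E powr (1 - 1 / q))"
proof -
  obtain S N N' where SN: "E = S \<union> N" "N \<subseteq> N'" "N' \<in> null_sets lborel" "S \<in> sets lborel"
    by (rule sets_completionE[OF E(1)])
  have N': "AE x in lebesgue. x \<notin> N'"
    using SN(3) by (intro AE_not_in null_sets_completionI)
  have eq: "emeasure lebesgue E = emeasure lebesgue S"
    using N' SN E(1) by (intro emeasure_eq_AE) (auto elim!: eventually_mono)
  then have eq': "emeasure lborel S = emeasure lebesgue E" "measure lborel S = measure lebesgue E"
    using SN(4) by (auto simp: measure_def)
  have "(\<integral>\<^sup>+x\<in>E. f x \<partial>lebesgue) = (\<integral>\<^sup>+x\<in>S. f x \<partial>lebesgue)"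
    using N' SN by (intro nn_integral_cong_AE) (auto elim!: eventually_mono simp: indicator_def)
  also have "\<dots> \<le> ennreal (A * measure lborel S powr (1 - 1 / q))"
    using f E SN(4) eq' unfolding marcinkiewicz_def by auto
  finally show ?thesis unfolding eq' .
qed

text \<open>Testing with the part \<open>E\<close> of a level set inside a ball, which has finite measure, gives
\<open>\<tau> |E| \<le> A |E|\<^bsup>1-1/q\<^esup>\<close>; then the ball is exhausted.\<close>

lemma weak_type_of_marcinkiewicz:
  fixes f :: "real ^ 'n \<Rightarrow> ennreal"
  assumes f: "marcinkiewicz q A f" and q: "q > 0" and A: "A \<ge> 0"
  shows "weak_type q A f"
  unfolding weak_type_def
proof (intro conjI allI impI)
  show fm [measurable]: "f \<in> borel_measurable lebesgue" using f unfolding marcinkiewicz_def by auto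
  fix \<tau> :: real assume \<tau>: "\<tau> > 0"
  define S where "S = {x. ennreal \<tau> < f x}"
  have [measurable]: "S \<in> sets lebesgue" unfolding S_def by (rule superlevel_lebesgue[OF fm])
  have fin: "emeasure lebesgue (S \<inter> ball 0 (real j)) \<le> ennreal ((A / \<tau>) powr q)" for j
  proof -
    let ?E = "S \<inter> ball 0 (real j)"
    have Em [measurable]: "?E \<in> sets lebesgue" by (intro sets.Int \<open>S \<in> sets lebesgue\<close>) auto
    have "emeasure lebesgue ?E \<le> emeasure lebesgue (ball (0 :: real ^ 'n) (real j))"
      by (rule emeasure_mono) auto
    then have E: "emeasure lebesgue ?E < \<infinity>"
      using emeasure_lborel_ball_finite[of "0 :: real ^ 'n" "real j"] by (simp add: order.strict_trans1)
    define \<mu> where "\<mu> = measure lebesgue ?E"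
    have \<mu>: "emeasure lebesgue ?E = ennreal \<mu>" "\<mu> \<ge> 0"
      unfolding \<mu>_def
      by (rule emeasure_eq_ennreal_measure, rule less_imp_neq[OF E[unfolded infinity_ennreal_def]])
         (rule measure_nonneg)
    have "ennreal \<tau> * ennreal \<mu> = (\<integral>\<^sup>+x\<in>?E. ennreal \<tau> \<partial>lebesgue)"
      by (subst nn_integral_cmult_indicator[OF Em]) (simp only: \<mu>)
    also have "\<dots> \<le> (\<integral>\<^sup>+x\<in>?E. f x \<partial>lebesgue)"
      by (intro nn_integral_mono) (auto simp: S_def indicator_def dest: less_imp_le)
    also have "\<dots> \<le> ennreal (A * \<mu> powr (1 - 1 / q))"
      unfolding \<mu>_def by (rule marcinkiewicz_lebesgue_set[OF f Em E])
    finally have le: "\<tau> * \<mu> \<le> A * \<mu> powr (1 - 1 / q)"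
      using \<tau> \<mu>(2) A by (simp flip: ennreal_mult)
    have "\<mu> \<le> (A / \<tau>) powr q"
    proof (cases "\<mu> = 0")
      case False
      then have \<mu>0: "\<mu> > 0" using \<mu>(2) by simp
      have "\<mu> powr (1 / q) = \<mu> / \<mu> powr (1 - 1 / q)"
        using \<mu>0 by (simp add: powr_diff)
      also have "\<dots> \<le> A / \<tau>" using le \<mu>0 \<tau> by (simp add: field_simps)
      finally have "(\<mu> powr (1 / q)) powr q \<le> (A / \<tau>) powr q" using q by (intro powr_mono2) auto
      then show ?thesis using \<mu>0 q by (simp add: powr_powr)
    qed simp
    then show ?thesis unfolding \<mu> by (rule ennreal_leI)
  qed
  have un: "(\<Union>j::nat. S \<inter> ball 0 (real j)) = S"
  proof (intro equalityI subsetI)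
    fix x assume "x \<in> S"
    moreover obtain j :: nat where "norm x < real j" using reals_Archimedean2 by blast
    ultimately show "x \<in> (\<Union>j::nat. S \<inter> ball 0 (real j))" by auto
  qed auto
  have "emeasure lebesgue (\<Union>j::nat. S \<inter> ball 0 (real j)) = (SUP j. emeasure lebesgue (S \<inter> ball 0 (real j)))"
    by (rule SUP_emeasure_incseq[symmetric]) (auto simp: incseq_def)
  then have "emeasure lebesgue S \<le> ennreal ((A / \<tau>) powr q)"
    unfolding un using fin by (simp add: SUP_least)
  then show "emeasure lebesgue {x. ennreal \<tau> < f x} \<le> ennreal ((A / \<tau>) powr q)"
    unfolding S_def .
qed

lemma nn_integral_powr_tail:
  fixes T q :: real assumes "T > 0" "q > 1"
  shows "(\<integral>\<^sup>+\<tau>\<in>{T..}. ennreal (\<tau> powr (- q)) \<partial>lborel) = ennreal (T powr (1 - q) / (q - 1))"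
proof -
  have "((\<lambda>\<tau>. \<tau> powr (- q)) has_integral - (T powr (- q + 1)) / (- q + 1)) {T..}"
    using has_integral_powr_to_inf[of "- q" T] assms by simp
  then have "((\<lambda>\<tau>. \<tau> powr (- q) * indicator {T..} \<tau>) has_integral - (T powr (- q + 1)) / (- q + 1)) UNIV"
    by (subst (asm) has_integral_restrict_UNIV[symmetric]) (erule has_integral_cong[THEN iffD1, rotated], auto simp: indicator_def)
  from nn_integral_has_integral_lborel[OF _ _ this]
  have "(\<integral>\<^sup>+\<tau>. ennreal (\<tau> powr (- q) * indicator {T..} \<tau>) \<partial>lborel) = ennreal (- (T powr (- q + 1)) / (- q + 1))"
    by simp
  moreover have "- (T powr (- q + 1)) / (- q + 1) = T powr (1 - q) / (q - 1)"
    using assms by (simp add: field_simps)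
  ultimately show ?thesis
    by (simp add: ennreal_mult ennreal_indicator)
qed

lemma nn_integral_powr_head:
  fixes s a :: real assumes "s > 0" "a > -1"
  shows "(\<integral>\<^sup>+\<tau>\<in>{0<..<s}. ennreal (\<tau> powr a) \<partial>lborel) = ennreal (s powr (a + 1) / (a + 1))"
proof -
  have "((\<lambda>\<tau>. \<tau> powr a) has_integral s powr (a + 1) / (a + 1)) {0..s}"
    using has_integral_powr_from_0[of a s] assms by simp
  then have "((\<lambda>\<tau>. \<tau> powr a * indicator {0..s} \<tau>) has_integral s powr (a + 1) / (a + 1)) UNIV"
    by (subst (asm) has_integral_restrict_UNIV[symmetric]) (erule has_integral_cong[THEN iffD1, rotated], auto simp: indicator_def)
  from nn_integral_has_integral_lborel[OF _ _ this]
  have "(\<integral>\<^sup>+\<tau>. ennreal (\<tau> powr a * indicator {0..s} \<tau>) \<partial>lborel) = ennreal (s powr (a + 1) / (a + 1))"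
    by simp
  moreover have "(\<integral>\<^sup>+\<tau>. ennreal (\<tau> powr a * indicator {0..s} \<tau>) \<partial>lborel) = (\<integral>\<^sup>+\<tau>\<in>{0<..<s}. ennreal (\<tau> powr a) \<partial>lborel)"
    using AE_lborel_singleton[of "0::real"] AE_lborel_singleton[of s]
    by (intro nn_integral_cong_AE) (auto simp: indicator_def elim!: eventually_elim2)
  ultimately show ?thesis by simp
qed

lemma ennreal_layer_cake:
  "(y::ennreal) = (\<integral>\<^sup>+\<tau>\<in>{0<..}. indicator {\<tau>. ennreal \<tau> < y} \<tau> \<partial>lborel)"
proof (cases y)
  case (real r)
  have "indicator {\<tau>. ennreal \<tau> < ennreal r} \<tau> * indicator {0<..} \<tau> = (indicator {0<..<r} \<tau> :: ennreal)" for \<tau> :: real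
    using real by (auto simp: indicator_def ennreal_less_iff)
  then show ?thesis using real by simp
next
  case top
  have "indicator {\<tau>. ennreal \<tau> < top} \<tau> * indicator {0<..} \<tau> = (indicator {0<..} \<tau> :: ennreal)" for \<tau> :: real
    by (auto simp: indicator_def)
  moreover have "emeasure lborel {0::real<..} = \<infinity>"
  proof -
    have "ennreal (real k) \<le> emeasure lborel {0::real<..}" for k :: nat
    proof -
      have "emeasure lborel {0<..<real k} \<le> emeasure lborel {0::real<..}" by (intro emeasure_mono) auto
      then show ?thesis by simp
    qed
    then have "of_nat k \<le> emeasure lborel {0::real<..}" for k :: nat
      by (simp add: ennreal_of_nat_eq_real_of_nat)
    then show ?thesis
      using SUP_least[of UNIV "of_nat :: nat \<Rightarrow> ennreal" "emeasure lborel {0::real<..}"]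
      unfolding ennreal_SUP_of_nat_eq_top by (simp add: top_unique)
  qed
  ultimately show ?thesis using top by simp
qed

lemma sigma_finite_lebesgue: "sigma_finite_measure (lebesgue :: 'a::euclidean_space measure)"
proof
  have "x \<in> (\<Union>j::nat. ball 0 (real j))" for x :: 'a
    using reals_Archimedean2[of "norm x"] by auto
  then show "\<exists>A. countable A \<and> A \<subseteq> sets lebesgue \<and> \<Union> A = space (lebesgue :: 'a measure) \<and> (\<forall>a\<in>A. emeasure lebesgue a \<noteq> \<infinity>)"
    by (intro exI[of _ "range (\<lambda>j::nat. ball 0 (real j))"])
       (auto simp: emeasure_lborel_ball_finite less_imp_neq simp flip: infinity_ennreal_def)
qed

text \<open>By the layer-cake formula the integral over \<open>E\<close> is the integral over \<open>\<tau>\<close> of the measure of the part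
of the level set inside \<open>E\<close>. That measure is at most \<open>|E|\<close> and at most \<open>(A / \<tau>)\<^sup>q\<close>; the integral is split
where the two bounds coincide.\<close>

lemma marcinkiewicz_of_weak_type:
  fixes f :: "real ^ 'n \<Rightarrow> ennreal"
  assumes f: "weak_type q A f" and q: "q > 1" and A: "A > 0"
  shows "marcinkiewicz q (q / (q - 1) * A) f"
  unfolding marcinkiewicz_def
proof (intro conjI ballI impI)
  show [measurable]: "f \<in> borel_measurable lebesgue" by (rule weak_typeD[OF f])
  interpret L: sigma_finite_measure "lebesgue :: (real ^ 'n) measure" by (rule sigma_finite_lebesgue)
  interpret P: pair_sigma_finite "lebesgue :: (real ^ 'n) measure" "lborel :: real measure" ..
  fix E :: "(real ^ 'n) set" assume E: "E \<in> sets borel" "emeasure lborel E < \<infinity>"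
  then have [measurable]: "E \<in> sets lebesgue" by simp
  define \<mu> where "\<mu> = measure lborel E"
  have \<mu>: "emeasure lborel E = ennreal \<mu>" "\<mu> \<ge> 0"
    using E unfolding \<mu>_def by (auto simp: emeasure_eq_ennreal_measure less_top)
  show "(\<integral>\<^sup>+x\<in>E. f x \<partial>lebesgue) \<le> ennreal (q / (q - 1) * A * measure lborel E powr (1 - 1 / q))"
  proof (cases "\<mu> = 0")
    case True
    then have "E \<in> null_sets lebesgue" using \<mu> E(1) by (simp add: null_sets_def)
    then have "(\<integral>\<^sup>+x\<in>E. f x \<partial>lebesgue) = 0"
      by (rule nn_integral_null_set)
    then show ?thesis by simp
  next
    case False
    then have \<mu>0: "\<mu> > 0" using \<mu>(2) by simp
    \<comment> \<open>the height at which \<open>(A / T)\<^sup>q = \<mu>\<close>\<close>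
    define T where "T = A * \<mu> powr (- (1 / q))"
    have T: "T > 0" using A \<mu>0 by (simp add: T_def)
    have "(\<integral>\<^sup>+x\<in>E. f x \<partial>lebesgue)
      = (\<integral>\<^sup>+x. (\<integral>\<^sup>+\<tau>. indicator {\<tau>. ennreal \<tau> < f x} \<tau> * indicator {0<..} \<tau> * indicator E x \<partial>lborel) \<partial>lebesgue)"
      by (subst ennreal_layer_cake) (simp add: nn_integral_multc)
    also have "\<dots> = (\<integral>\<^sup>+x. (\<integral>\<^sup>+\<tau>. indicator {p. ennreal (snd p) < f (fst p)} (x, \<tau>) * indicator {0<..} \<tau> * indicator E x \<partial>lborel) \<partial>lebesgue)"
      by (simp add: indicator_def)
    also have "\<dots> = (\<integral>\<^sup>+\<tau>. (\<integral>\<^sup>+x. indicator {p. ennreal (snd p) < f (fst p)} (x, \<tau>) * indicator {0<..} \<tau> * indicator E x \<partial>lebesgue) \<partial>lborel)"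
    proof (rule P.Fubini'[symmetric])
      have "{p. ennreal (snd p) < f (fst p)} = {p \<in> space (lebesgue \<Otimes>\<^sub>M (lborel :: real measure)). ennreal (snd p) < f (fst p)}"
        by (auto simp: space_pair_measure)
      also have "\<dots> \<in> sets (lebesgue \<Otimes>\<^sub>M lborel)" by measurable
      finally have [measurable]: "{p. ennreal (snd p) < f (fst p)} \<in> sets (lebesgue \<Otimes>\<^sub>M (lborel :: real measure))" .
      show "(\<lambda>(x, \<tau>). indicator {p. ennreal (snd p) < f (fst p)} (x, \<tau>) * indicator {0<..} \<tau> * indicator E x :: ennreal)
         \<in> borel_measurable (lebesgue \<Otimes>\<^sub>M lborel)"
        by (simp add: split_beta') measurable
    qed
    also have "\<dots> \<le> (\<integral>\<^sup>+\<tau>. ennreal \<mu> * indicator {0<..<T} \<tau> + ennreal (A powr q) * (ennreal (\<tau> powr (- q)) * indicator {T..} \<tau>) \<partial>lborel)"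
    proof (intro nn_integral_mono)
      fix \<tau> :: real
      let ?I = "\<integral>\<^sup>+x. indicator {p. ennreal (snd p) < f (fst p)} (x, \<tau>) * indicator {0<..} \<tau> * indicator E x \<partial>lebesgue"
      consider "\<tau> \<le> 0" | "0 < \<tau>" "\<tau> < T" | "T \<le> \<tau>" using T by linarith
      then show "?I \<le> ennreal \<mu> * indicator {0<..<T} \<tau> + ennreal (A powr q) * (ennreal (\<tau> powr (- q)) * indicator {T..} \<tau>)"
      proof cases
        case 2
        have "?I \<le> (\<integral>\<^sup>+x. indicator E x \<partial>lebesgue)" by (intro nn_integral_mono) (auto simp: indicator_def)
        also have "\<dots> = ennreal \<mu>" using E(1) \<mu> by (subst nn_integral_indicator) auto
        finally show ?thesis using 2 by simp
      next
        case 3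
        then have \<tau>: "\<tau> > 0" using T by simp
        have "?I \<le> (\<integral>\<^sup>+x. indicator {x. ennreal \<tau> < f x} x \<partial>lebesgue)" by (intro nn_integral_mono) (auto simp: indicator_def)
        also have "\<dots> = emeasure lebesgue {x. ennreal \<tau> < f x}" by (intro nn_integral_indicator) auto
        also have "\<dots> \<le> ennreal ((A / \<tau>) powr q)" by (rule weak_typeD(2)[OF f \<tau>])
        also have "\<dots> = ennreal (A powr q) * ennreal (\<tau> powr (- q))"
          using A \<tau> by (subst ennreal_mult[symmetric]) (auto simp: powr_divide powr_minus_divide)
        finally show ?thesis using 3 by (simp add: indicator_def)
      qed (simp add: indicator_def)
    qed
    also have "\<dots> = ennreal \<mu> * ennreal T + ennreal (A powr q) * ennreal (T powr (1 - q) / (q - 1))"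
      using T by (subst nn_integral_add) (auto simp: nn_integral_cmult nn_integral_powr_tail[OF T q])
    also have "\<dots> = ennreal (\<mu> * T + A powr q * (T powr (1 - q) / (q - 1)))"
      using \<mu> T q by (simp add: ennreal_mult[symmetric] ennreal_plus[symmetric] del: ennreal_plus)
    also have "\<mu> * T + A powr q * (T powr (1 - q) / (q - 1)) = q / (q - 1) * A * \<mu> powr (1 - 1 / q)"
    proof -
      have 1: "\<mu> * T = A * \<mu> powr (1 - 1 / q)"
        unfolding T_def using \<mu>0 by (simp add: powr_diff powr_minus field_simps)
      have "A powr q * T powr (1 - q) = A powr q * A powr (1 - q) * \<mu> powr (- (1 / q) * (1 - q))"
        unfolding T_def using \<mu>0 A by (simp add: powr_mult powr_powr)
      also have "\<dots> = A * \<mu> powr (1 - 1 / q)"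
      proof -
        have "- (1 / q) * (1 - q) = 1 - 1 / q" using q by (simp add: field_simps)
        moreover have "A powr q * A powr (1 - q) = A" using A by (simp flip: powr_add)
        ultimately show ?thesis by simp
      qed
      finally show ?thesis unfolding 1 using q by (simp add: field_simps)
    qed
    finally show ?thesis unfolding \<mu>_def .
  qed
qed

lemma rearrangement_antimono:
  assumes "l \<le> l'" shows "rearrangement f l' \<le> rearrangement f l"
  unfolding rearrangement_def
  by (rule Inf_superset_mono) (use order_trans[OF _ ennreal_leI[OF assms]] in blast)

text \<open>As the rearrangement is decreasing, its average over \<open>(0, l)\<close> dominates its value at \<open>l\<close>. So for every
\<open>l > (A / \<tau>)\<^sup>q\<close> the rearrangement at \<open>l\<close> is below \<open>\<tau>\<close>, which says that the level set has measure at most \<open>l\<close>.\<close>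

lemma weak_type_of_weak_norm:
  fixes f :: "real ^ 'n \<Rightarrow> real"
  assumes [measurable]: "f \<in> borel_measurable lebesgue"
    and f: "weak_norm q f \<le> ennreal A" and A: "A \<ge> 0" and q: "q > 0"
  shows "weak_type q A (eabs f)"
  unfolding weak_type_def
proof (intro conjI allI impI)
  fix \<tau> :: real assume \<tau>: "\<tau> > 0"
  have lv: "{x. ennreal s < ennreal \<bar>f x\<bar>} = {x. s < \<bar>f x\<bar>}" if "s > 0" for s
    using that by (auto simp: ennreal_less_iff)
  have meas: "emeasure lebesgue {x. \<tau> < \<bar>f x\<bar>} \<le> ennreal l" if l: "(A / \<tau>) powr q < l" for l
  proof -
    have l0: "l > 0" using l powr_ge_zero[of "A / \<tau>" q] by linarith
    have "rearrangement f l * ennreal l \<le> (\<integral>\<^sup>+s\<in>{0<..<l}. rearrangement f s \<partial>lborel)"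
    proof -
      have "rearrangement f l * ennreal l = (\<integral>\<^sup>+s\<in>{0<..<l}. rearrangement f l \<partial>lborel)"
        using l0 by (subst nn_integral_cmult_indicator) auto
      also have "\<dots> \<le> (\<integral>\<^sup>+s\<in>{0<..<l}. rearrangement f s \<partial>lborel)"
        by (intro nn_integral_mono) (auto simp: indicator_def intro: rearrangement_antimono)
      finally show ?thesis .
    qed
    then have "ennreal (1 / l) * (rearrangement f l * ennreal l) \<le> rearrangement_avg f l"
      unfolding rearrangement_avg_def by (intro mult_left_mono) auto
    moreover have "ennreal (1 / l) * (rearrangement f l * ennreal l) = rearrangement f l"
    proof -
      have "ennreal (1 / l) * ennreal l = 1" using l0 by (simp flip: ennreal_mult)
      then show ?thesis by (metis mult.commute mult.left_commute mult.right_neutral)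
    qed
    ultimately have "rearrangement f l \<le> rearrangement_avg f l" by simp
    then have "ennreal (l powr (1 / q)) * rearrangement f l \<le> ennreal (l powr (1 / q)) * rearrangement_avg f l"
      by (rule mult_left_mono) simp
    also have "\<dots> \<le> weak_norm q f"
      unfolding weak_norm_def using l0 by (intro SUP_upper) auto
    finally have le: "ennreal (l powr (1 / q)) * rearrangement f l \<le> ennreal A" using f by simp
    have "rearrangement f l < ennreal \<tau>"
    proof (rule ccontr)
      assume "\<not> ?thesis"
      then have "ennreal (l powr (1 / q)) * ennreal \<tau> \<le> ennreal (l powr (1 / q)) * rearrangement f l"
        by (intro mult_left_mono) auto
      with le have "ennreal (l powr (1 / q)) * ennreal \<tau> \<le> ennreal A" by simp
      then have "l powr (1 / q) * \<tau> \<le> A" using \<tau> A by (simp flip: ennreal_mult)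
      then have "l powr (1 / q) \<le> A / \<tau>" using \<tau> by (simp add: field_simps)
      then have "(l powr (1 / q)) powr q \<le> (A / \<tau>) powr q" using q by (intro powr_mono2) auto
      then show False using l l0 q by (simp add: powr_powr)
    qed
    then obtain s where s: "s > 0" "emeasure lebesgue {x. \<bar>f x\<bar> > s} \<le> ennreal l" "ennreal s < ennreal \<tau>"
      unfolding rearrangement_def Inf_less_iff by auto
    then have "s < \<tau>" by (simp add: ennreal_less_iff)
    moreover have "{x. s < \<bar>f x\<bar>} \<in> sets lebesgue"
      unfolding lv[OF s(1), symmetric] by (rule superlevel_lebesgue) measurable
    ultimately have "emeasure lebesgue {x. \<tau> < \<bar>f x\<bar>} \<le> emeasure lebesgue {x. s < \<bar>f x\<bar>}"
      by (intro emeasure_mono) auto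
    then show ?thesis using s(2) by simp
  qed
  show "emeasure lebesgue {x. ennreal \<tau> < ennreal \<bar>f x\<bar>} \<le> ennreal ((A / \<tau>) powr q)"
    unfolding lv[OF \<tau>]
  proof (rule ennreal_le_epsilon)
    fix e :: real assume "0 < e"
    then show "emeasure lebesgue {x. \<tau> < \<bar>f x\<bar>} \<le> ennreal ((A / \<tau>) powr q) + ennreal e"
      using meas[of "(A / \<tau>) powr q + e"] by (simp flip: ennreal_plus)
  qed
qed measurable

text \<open>The rearrangement is at most \<open>A l\<^bsup>-1/q\<^esup>\<close>, which is integrable at \<open>0\<close> because \<open>q > 1\<close>.\<close>

lemma weak_norm_of_weak_type:
  fixes f :: "real ^ 'n \<Rightarrow> real"
  assumes f: "weak_type q A (eabs f)" and q: "q > 1" and A: "A \<ge> 0"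
  shows "weak_norm q f \<le> ennreal (q / (q - 1) * A)"
  unfolding weak_norm_def
proof (rule SUP_least)
  fix s :: real assume "s \<in> {0<..}"
  then have s: "s > 0" by simp
  have r: "rearrangement f l \<le> ennreal (A * l powr (- (1 / q)))" if l: "l > 0" for l
  proof (rule ennreal_le_epsilon)
    fix e :: real assume e: "0 < e"
    define \<tau> where "\<tau> = A * l powr (- (1 / q)) + e"
    have \<tau>: "\<tau> > 0" using A e by (simp add: \<tau>_def add_nonneg_pos)
    have "A * l powr (- (1 / q)) \<le> \<tau>" using e by (simp add: \<tau>_def)
    then have "A / \<tau> \<le> l powr (1 / q)" using \<tau> l by (simp add: field_simps powr_minus)
    then have "(A / \<tau>) powr q \<le> (l powr (1 / q)) powr q" using A \<tau> q by (intro powr_mono2) auto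
    then have "(A / \<tau>) powr q \<le> l" using l q by (simp add: powr_powr)
    then have "emeasure lebesgue {x. ennreal \<tau> < ennreal \<bar>f x\<bar>} \<le> ennreal l"
      by (intro order_trans[OF weak_typeD(2)[OF f \<tau>] ennreal_leI])
    moreover have "{x. ennreal \<tau> < ennreal \<bar>f x\<bar>} = {x. \<tau> < \<bar>f x\<bar>}"
      using \<tau> by (auto simp: ennreal_less_iff)
    ultimately have "rearrangement f l \<le> ennreal \<tau>"
      unfolding rearrangement_def using \<tau> by (intro Inf_lower) auto
    then show "rearrangement f l \<le> ennreal (A * l powr (- (1 / q))) + ennreal e"
      using A e by (simp add: \<tau>_def)
  qed
  have "(\<integral>\<^sup>+l\<in>{0<..<s}. rearrangement f l \<partial>lborel) \<le> (\<integral>\<^sup>+l. ennreal A * (ennreal (l powr (- (1 / q))) * indicator {0<..<s} l) \<partial>lborel)"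
    using A by (intro nn_integral_mono) (auto simp: indicator_def ennreal_mult[symmetric] intro: r)
  also have "\<dots> = ennreal A * ennreal (s powr (- (1 / q) + 1) / (- (1 / q) + 1))"
    using s q by (subst nn_integral_cmult) (auto simp: nn_integral_powr_head)
  also have "\<dots> = ennreal (A * (s powr (- (1 / q) + 1) / (- (1 / q) + 1)))"
    using A q by (simp add: ennreal_mult[symmetric])
  finally have "ennreal (s powr (1 / q)) * rearrangement_avg f s
     \<le> ennreal (s powr (1 / q)) * (ennreal (1 / s) * ennreal (A * (s powr (- (1 / q) + 1) / (- (1 / q) + 1))))"
    unfolding rearrangement_avg_def by (intro mult_left_mono) auto
  also have "\<dots> = ennreal (s powr (1 / q) * (1 / s * (A * (s powr (- (1 / q) + 1) / (- (1 / q) + 1)))))"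
    using A q s by (simp add: ennreal_mult[symmetric])
  also have "s powr (1 / q) * (1 / s * (A * (s powr (- (1 / q) + 1) / (- (1 / q) + 1)))) = q / (q - 1) * A"
  proof -
    have "s powr (1 / q) * s powr (- (1 / q) + 1) = s"
      using s by (simp add: powr_add[symmetric])
    then have "s powr (1 / q) * (1 / s * (A * (s powr (- (1 / q) + 1) / (- (1 / q) + 1)))) = A / (- (1 / q) + 1)"
      using s by (metis (no_types, lifting) mult.assoc mult.commute mult.left_commute nonzero_mult_div_cancel_left order_less_irrefl times_divide_eq_right mult_1)
    also have "\<dots> = q / (q - 1) * A" using q by (simp add: field_simps)
    finally show ?thesis .
  qed
  finally show "ennreal (s powr (1 / q)) * rearrangement_avg f s \<le> ennreal (q / (q - 1) * A)" .
qed

section \<open>Convolution with a self-similar kernel\<close>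

text \<open>The values of \<open>h\<close> at a point \<open>x\<close> are limits of values at points of a countable dense set on which
\<open>h\<close> is measurable in time. This supplies joint measurability of the Duhamel integrand, for which a
mild solution only provides measurability in time at almost every \<open>x\<close>.\<close>

lemma borel_measurable_caratheodory:
  fixes h :: "real \<Rightarrow> 'a::euclidean_space \<Rightarrow> real"
  assumes cont: "\<And>\<tau>. continuous_on UNIV (h \<tau>)"
    and meas: "AE x in lborel. (\<lambda>\<tau>. h \<tau> x) \<in> borel_measurable borel"
  shows "(\<lambda>p. h (fst p) (snd p)) \<in> borel_measurable (lborel \<Otimes>\<^sub>M lborel)"
proof -
  let ?S = "{x. (\<lambda>\<tau>. h \<tau> x) \<in> borel_measurable borel}"
  have dense: "\<exists>x\<in>?S. dist x y < e" if "e > 0" for y :: 'a and e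
  proof (rule ccontr)
    assume "\<not> ?thesis"
    then have "AE x in lborel. x \<notin> ball y e"
      using meas by (auto elim!: eventually_mono simp: dist_commute)
    then have "ball y e \<in> null_sets lborel"
      by (subst AE_iff_null_sets) auto
    then have "emeasure lborel (ball y e) = 0" by auto
    then show False using that by (simp add: emeasure_ball unit_ball_vol_pos less_imp_neq[symmetric])
  qed
  obtain D where D: "countable D" "D \<subseteq> ?S" "?S \<subseteq> closure D"
    using separable by blast
  have Dne: "D \<noteq> {}" using dense[of 1 0] D(3) by (auto simp: closure_def)
  have "closure ?S = UNIV" using dense by (auto simp: closure_approachable)
  then have clD: "closure D = UNIV" using D(3) by (metis closure_closure closure_mono top.extremum_uniqueI)
  define d where "d = from_nat_into D"
  have dD: "d i \<in> D" for i unfolding d_def by (rule from_nat_into[OF Dne])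
  have ex: "\<exists>i. dist (d i) x < 1 / real (Suc k)" for x k
  proof -
    have "x \<in> closure D" using clD by simp
    then obtain y where "y \<in> D" "dist y x < 1 / real (Suc k)"
      unfolding closure_approachable by (metis of_nat_0_less_iff zero_less_Suc zero_less_divide_1_iff)
    then show ?thesis unfolding d_def using from_nat_into_surj[OF D(1)] by metis
  qed
  define N where "N k x = (LEAST i. dist (d i) x < 1 / real (Suc k))" for k and x :: 'a
  have N: "dist (d (N k x)) x < 1 / real (Suc k)" for k x
    unfolding N_def by (rule LeastI_ex[OF ex])
  have [measurable]: "N k \<in> lborel \<rightarrow>\<^sub>M count_space UNIV" for k
    unfolding N_def by measurable
  have [measurable]: "(\<lambda>\<tau>. h \<tau> (d i)) \<in> borel_measurable borel" for i
    using dD D(2) by blast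
  have "(\<lambda>p. h (fst p) (d (N k (snd p)))) \<in> borel_measurable (lborel \<Otimes>\<^sub>M lborel)" for k
  proof (rule measurable_compose_countable[where f="\<lambda>i p. h (fst p) (d i)" and g="\<lambda>p. N k (snd p)"])
  qed measurable
  moreover have "(\<lambda>k. h (fst p) (d (N k (snd p)))) \<longlonglongrightarrow> h (fst p) (snd p)" for p :: "real \<times> 'a"
  proof -
    have "(\<lambda>k. d (N k (snd p))) \<longlonglongrightarrow> snd p"
    proof (rule LIMSEQ_I)
      fix r :: real assume "r > 0"
      then obtain k0 where "1 / real (Suc k0) < r" using nat_approx_posE by blast
      then have "norm (d (N k (snd p)) - snd p) < r" if "k \<ge> k0" for k
        using N[of k "snd p"] that
        by (auto simp: dist_norm intro: order.strict_trans order.strict_trans2 order.strict_trans1[OF divide_left_mono])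
          (smt (verit) frac_le of_nat_0_le_iff of_nat_mono of_nat_Suc)
      then show "\<exists>no. \<forall>n\<ge>no. norm (d (N n (snd p)) - snd p) < r" by blast
    qed
    then show ?thesis
      using cont[of "fst p"] by (auto simp: continuous_on_eq_continuous_at isCont_def intro: isCont_tendsto_compose)
  qed
  ultimately show ?thesis
    by (rule borel_measurable_LIMSEQ_real[rotated])
qed

text \<open>Minkowski's inequality. Integration over a fixed set \<open>E\<close> commutes with the time integral, while the level sets of
the time integral are not controlled directly by those of the integrand.\<close>

lemma marcinkiewicz_time_integral:
  fixes h :: "real \<Rightarrow> real ^ 'n \<Rightarrow> real" and a :: "real \<Rightarrow> real"
  assumes [measurable]: "(\<lambda>p. h (fst p) (snd p)) \<in> borel_measurable (lborel \<Otimes>\<^sub>M lborel)"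
    "I \<in> sets borel" "a \<in> borel_measurable borel"
    and w: "\<And>\<tau>. \<tau> \<in> I \<Longrightarrow> a \<tau> > 0 \<and> weak_type q (a \<tau>) (eabs (h \<tau>))"
    and Q: "(\<integral>\<^sup>+\<tau>\<in>I. ennreal (a \<tau>) \<partial>lborel) \<le> ennreal Q" and q: "q > 1" and Q0: "Q \<ge> 0"
  shows "marcinkiewicz q (q / (q - 1) * Q) (\<lambda>x. \<integral>\<^sup>+\<tau>\<in>I. ennreal \<bar>h \<tau> x\<bar> \<partial>lborel)"
  unfolding marcinkiewicz_def
proof (intro conjI ballI impI)
  have [measurable]: "(\<lambda>(\<tau>, x). h \<tau> x) \<in> borel_measurable (lborel \<Otimes>\<^sub>M lborel)"
    using assms(1) by (simp add: split_beta')
  have [measurable]: "(\<lambda>(x, \<tau>). h \<tau> x) \<in> borel_measurable (lborel \<Otimes>\<^sub>M lborel)"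
    using measurable_compose[OF measurable_pair_swap' assms(1)] by (simp add: split_beta' case_prod_unfold)
  have "(\<lambda>x. \<integral>\<^sup>+\<tau>\<in>I. ennreal \<bar>h \<tau> x\<bar> \<partial>lborel) \<in> borel_measurable lborel"
    by measurable
  then show "(\<lambda>x. \<integral>\<^sup>+\<tau>\<in>I. ennreal \<bar>h \<tau> x\<bar> \<partial>lborel) \<in> borel_measurable lebesgue"
    by (rule measurable_completion)
  fix E :: "(real ^ 'n) set" assume E: "E \<in> sets borel" "emeasure lborel E < \<infinity>"
  then have [measurable]: "E \<in> sets borel" by simp
  let ?c = "q / (q - 1)" and ?\<mu> = "measure lborel E powr (1 - 1 / q)"
  have c: "?c \<ge> 0" using q by simp
  have c\<mu>: "0 \<le> ?c * ?\<mu>" by (intro mult_nonneg_nonneg c) simp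
  have "(\<integral>\<^sup>+x\<in>E. (\<integral>\<^sup>+\<tau>\<in>I. ennreal \<bar>h \<tau> x\<bar> \<partial>lborel) \<partial>lebesgue)
      = (\<integral>\<^sup>+x. (\<integral>\<^sup>+\<tau>. ennreal \<bar>h \<tau> x\<bar> * indicator I \<tau> * indicator E x \<partial>lborel) \<partial>lborel)"
    unfolding nn_integral_completion by (intro nn_integral_cong nn_integral_multc[symmetric]) measurable
  also have "\<dots> = (\<integral>\<^sup>+\<tau>. (\<integral>\<^sup>+x. ennreal \<bar>h \<tau> x\<bar> * indicator I \<tau> * indicator E x \<partial>lborel) \<partial>lborel)"
    by (rule lborel_pair.Fubini'[symmetric]) measurable
  also have "\<dots> \<le> (\<integral>\<^sup>+\<tau>. ennreal (?c * ?\<mu>) * (ennreal (a \<tau>) * indicator I \<tau>) \<partial>lborel)"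
  proof (intro nn_integral_mono)
    fix \<tau> :: real
    show "(\<integral>\<^sup>+x. ennreal \<bar>h \<tau> x\<bar> * indicator I \<tau> * indicator E x \<partial>lborel)
       \<le> ennreal (?c * ?\<mu>) * (ennreal (a \<tau>) * indicator I \<tau>)"
    proof (cases "\<tau> \<in> I")
      case True
      from w[OF True] q have "marcinkiewicz q (?c * a \<tau>) (eabs (h \<tau>))"
        by (intro marcinkiewicz_of_weak_type) auto
      then have "(\<integral>\<^sup>+x\<in>E. ennreal \<bar>h \<tau> x\<bar> \<partial>lebesgue) \<le> ennreal (?c * a \<tau> * ?\<mu>)"
        using E unfolding marcinkiewicz_def by blast
      also have "\<dots> = ennreal (?c * ?\<mu>) * ennreal (a \<tau>)"
        using w[OF True] by (subst ennreal_mult[OF c\<mu>, symmetric]) (auto simp: mult_ac)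
      finally show ?thesis using True by (simp add: nn_integral_completion)
    qed simp
  qed
  also have "\<dots> = ennreal (?c * ?\<mu>) * (\<integral>\<^sup>+\<tau>\<in>I. ennreal (a \<tau>) \<partial>lborel)"
    by (rule nn_integral_cmult) measurable
  also have "\<dots> \<le> ennreal (?c * ?\<mu>) * ennreal Q" by (intro mult_left_mono Q) auto
  also have "\<dots> = ennreal (?c * Q * ?\<mu>)"
    using Q0 by (subst ennreal_mult[OF c\<mu>, symmetric]) (auto simp: mult_ac)
  finally show "(\<integral>\<^sup>+x\<in>E. (\<integral>\<^sup>+\<tau>\<in>I. ennreal \<bar>h \<tau> x\<bar> \<partial>lborel) \<partial>lebesgue) \<le> ennreal (?c * Q * ?\<mu>)" .
qed

text \<open>All that is used about the heat kernel, with \<open>d = n / (2m)\<close>.\<close>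

locale kernel_family =
  fixes g :: "real \<Rightarrow> real ^ 'n \<Rightarrow> real" and G d :: real
  assumes G: "G > 0" and d: "d > 0"
    and cont: "\<And>t. t > 0 \<Longrightarrow> continuous_on UNIV (g t)"
    and sup_bound: "\<And>t x. t > 0 \<Longrightarrow> \<bar>g t x\<bar> \<le> G * t powr (- d)"
    and L1_bound: "\<And>t. t > 0 \<Longrightarrow> (\<integral>\<^sup>+x. ennreal \<bar>g t x\<bar> \<partial>lborel) \<le> ennreal G"
begin

definition conv :: "real \<Rightarrow> (real ^ 'n \<Rightarrow> real) \<Rightarrow> real ^ 'n \<Rightarrow> real" where
  "conv t f x = (\<integral>y. g t (x - y) * f y \<partial>lebesgue)"

lemma g_measurable: "t > 0 \<Longrightarrow> g t \<in> borel_measurable borel"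
  by (rule borel_measurable_continuous_onI[OF cont])

lemma g_diff_measurable_lebesgue: "t > 0 \<Longrightarrow> (\<lambda>y. g t (x - y)) \<in> borel_measurable lebesgue"
  using g_measurable by (intro measurable_completion) simp

lemma L1_bound_reflect: "t > 0 \<Longrightarrow> (\<integral>\<^sup>+y. ennreal \<bar>g t (x - y)\<bar> \<partial>lebesgue) \<le> ennreal G"
  unfolding nn_integral_completion
  using nn_integral_lborel_reflect[of "\<lambda>y. ennreal \<bar>g t y\<bar>" x] g_measurable L1_bound by simp

definition conv_abs :: "real \<Rightarrow> (real ^ 'n \<Rightarrow> real) \<Rightarrow> real ^ 'n \<Rightarrow> ennreal" where
  "conv_abs t f x = (\<integral>\<^sup>+y. ennreal (\<bar>g t (x - y)\<bar> * \<bar>f y\<bar>) \<partial>lebesgue)"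

text \<open>Split \<open>f\<close> at the height \<open>T\<close>: the high part is integrable and is paired with the supremum of the kernel, the low
part is bounded and is paired with the integral of the kernel.\<close>

lemma conv_abs_sup:
  assumes t: "t > 0" and f: "weak_type r A (eabs f)" and [measurable]: "f \<in> borel_measurable lebesgue"
    and r: "r > 1" and A: "A > 0"
  shows "conv_abs t f x \<le> ennreal (G * (r / (r - 1) + 1) * A * t powr (- (d / r)))"
proof -
  note [measurable] = g_diff_measurable_lebesgue[OF t]
  \<comment> \<open>this height balances the two contributions as functions of \<open>t\<close>\<close>
  define T where "T = A * t powr (- (d / r))"
  have T: "T > 0" using A t by (simp add: T_def)
  let ?c = "r / (r - 1)"
  define E where "E = {x. ennreal T < ennreal \<bar>f x\<bar>}"
  have Em [measurable]: "E \<in> sets lebesgue" unfolding E_def by (rule superlevel_lebesgue) measurable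
  have Ef: "emeasure lebesgue E \<le> ennreal ((A / T) powr r)"
    unfolding E_def by (rule weak_typeD(2)[OF f T])
  then have Efin: "emeasure lebesgue E < \<infinity>" by (rule order.strict_trans1) simp
  then have "measure lebesgue E \<le> (A / T) powr r"
    using Ef by (simp add: emeasure_eq_ennreal_measure less_top)
  then have "measure lebesgue E powr (1 - 1 / r) \<le> ((A / T) powr r) powr (1 - 1 / r)"
    using r by (intro powr_mono2) auto
  also have "\<dots> = (A / T) powr (r - 1)"
  proof -
    have "r * (1 - 1 / r) = r - 1" using r by (simp add: algebra_simps)
    then show ?thesis by (simp only: powr_powr)
  qed
  also have "\<dots> = t powr (d - d / r)"
  proof -
    have "A / T = t powr (d / r)" unfolding T_def using A t by (simp add: powr_minus field_simps)
    moreover have "d / r * (r - 1) = d - d / r" using r by (simp add: field_simps)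
    ultimately show ?thesis by (simp only: powr_powr)
  qed
  finally have mE: "measure lebesgue E powr (1 - 1 / r) \<le> t powr (d - d / r)" .
  have "(\<integral>\<^sup>+y\<in>E. ennreal \<bar>f y\<bar> \<partial>lebesgue) \<le> ennreal (?c * A * measure lebesgue E powr (1 - 1 / r))"
    by (rule marcinkiewicz_lebesgue_set[OF marcinkiewicz_of_weak_type[OF f r A] Em Efin])
  also have "\<dots> \<le> ennreal (?c * A * t powr (d - d / r))"
    using mE r A by (intro ennreal_leI mult_left_mono) auto
  finally have int: "(\<integral>\<^sup>+y\<in>E. ennreal \<bar>f y\<bar> \<partial>lebesgue) \<le> ennreal (?c * A * t powr (d - d / r))" .
  have "conv_abs t f x \<le> (\<integral>\<^sup>+y. ennreal (G * t powr (- d)) * (ennreal \<bar>f y\<bar> * indicator E y) + ennreal T * ennreal \<bar>g t (x - y)\<bar> \<partial>lebesgue)"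
    unfolding conv_abs_def
  proof (intro nn_integral_mono)
    fix y
    show "ennreal (\<bar>g t (x - y)\<bar> * \<bar>f y\<bar>) \<le> ennreal (G * t powr (- d)) * (ennreal \<bar>f y\<bar> * indicator E y) + ennreal T * ennreal \<bar>g t (x - y)\<bar>"
    proof (cases "y \<in> E")
      case True
      have "ennreal (\<bar>g t (x - y)\<bar> * \<bar>f y\<bar>) \<le> ennreal (G * t powr (- d) * \<bar>f y\<bar>)"
        using sup_bound[OF t] by (intro ennreal_leI mult_right_mono) auto
      also have "\<dots> = ennreal (G * t powr (- d)) * ennreal \<bar>f y\<bar>"
        using G by (intro ennreal_mult) auto
      finally show ?thesis using True by (simp add: add_increasing2)
    next
      case False
      then have "\<bar>f y\<bar> \<le> T" using T by (auto simp: E_def ennreal_less_iff not_less)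
      then have "ennreal (\<bar>g t (x - y)\<bar> * \<bar>f y\<bar>) \<le> ennreal (T * \<bar>g t (x - y)\<bar>)"
        by (subst mult.commute) (intro ennreal_leI mult_right_mono, auto)
      also have "\<dots> = ennreal T * ennreal \<bar>g t (x - y)\<bar>" using T by (intro ennreal_mult) auto
      finally show ?thesis using False by simp
    qed
  qed
  also have "\<dots> = ennreal (G * t powr (- d)) * (\<integral>\<^sup>+y\<in>E. ennreal \<bar>f y\<bar> \<partial>lebesgue) + ennreal T * (\<integral>\<^sup>+y. ennreal \<bar>g t (x - y)\<bar> \<partial>lebesgue)"
    by (subst nn_integral_add) (auto simp: nn_integral_cmult)
  also have "\<dots> \<le> ennreal (G * t powr (- d)) * ennreal (?c * A * t powr (d - d / r)) + ennreal T * ennreal G"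
    by (intro add_mono mult_left_mono int L1_bound_reflect t) auto
  also have "\<dots> = ennreal (G * t powr (- d) * (?c * A * t powr (d - d / r)) + T * G)"
    using G T A r by (simp add: ennreal_mult[symmetric] ennreal_plus[symmetric] del: ennreal_plus)
  also have "G * t powr (- d) * (?c * A * t powr (d - d / r)) + T * G = G * (?c + 1) * A * t powr (- (d / r))"
  proof -
    have "t powr (- d) * t powr (d - d / r) = t powr (- (d / r))" by (simp flip: powr_add)
    then have "G * t powr (- d) * (?c * A * t powr (d - d / r)) = G * ?c * A * t powr (- (d / r))"
      by (simp add: mult_ac)
    then show ?thesis unfolding T_def by (simp add: algebra_simps)
  qed
  finally show ?thesis .
qed

lemma conv_abs_marcinkiewicz:
  assumes t: "t > 0" and f: "marcinkiewicz q A (eabs f)" and [measurable]: "f \<in> borel_measurable lebesgue"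
    and A: "A \<ge> 0"
  shows "marcinkiewicz q (G * A) (conv_abs t f)"
  unfolding marcinkiewicz_def
proof (intro conjI ballI impI)
  note [measurable] = g_measurable[OF t]
  interpret L: sigma_finite_measure "lebesgue :: (real ^ 'n) measure" by (rule sigma_finite_lebesgue)
  interpret P: pair_sigma_finite "lborel :: (real ^ 'n) measure" "lebesgue :: (real ^ 'n) measure" ..
  have gm [measurable]: "(\<lambda>p. g t (fst p - snd p)) \<in> borel_measurable (lborel \<Otimes>\<^sub>M (lebesgue :: (real ^ 'n) measure))"
  proof -
    have [measurable]: "(\<lambda>p. snd p) \<in> borel_measurable (lborel \<Otimes>\<^sub>M (lebesgue :: (real ^ 'n) measure))"
      by (rule measurable_compose[OF measurable_snd]) (rule measurable_completion, simp)
    show ?thesis by measurable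
  qed
  have cm: "(\<lambda>(x, y). ennreal (\<bar>g t (x - y)\<bar> * \<bar>f y\<bar>)) \<in> borel_measurable (lborel \<Otimes>\<^sub>M lebesgue)"
    unfolding split_beta' by measurable
  have "conv_abs t f \<in> borel_measurable lborel"
    unfolding conv_abs_def[abs_def] using L.borel_measurable_nn_integral[OF cm] by simp
  then show "conv_abs t f \<in> borel_measurable lebesgue" by (rule measurable_completion)
  fix E :: "(real ^ 'n) set" assume E: "E \<in> sets borel" "emeasure lborel E < \<infinity>"
  then have [measurable]: "E \<in> sets borel" by simp
  let ?\<mu> = "measure lborel E powr (1 - 1 / q)"
  have "(\<integral>\<^sup>+x\<in>E. conv_abs t f x \<partial>lebesgue)
     = (\<integral>\<^sup>+x. (\<integral>\<^sup>+y. ennreal (\<bar>g t (x - y)\<bar> * \<bar>f y\<bar>) * indicator E x \<partial>lebesgue) \<partial>lborel)"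
    unfolding conv_abs_def nn_integral_completion[of _ "\<lambda>x. _ x * indicator E x"]
    by (intro nn_integral_cong nn_integral_multc[symmetric] measurable_compose[OF _ measurable_ennreal]
          borel_measurable_times borel_measurable_abs g_diff_measurable_lebesgue[OF t] assms)
  also have "\<dots> = (\<integral>\<^sup>+y. (\<integral>\<^sup>+x. ennreal (\<bar>g t (x - y)\<bar> * \<bar>f y\<bar>) * indicator E x \<partial>lborel) \<partial>lebesgue)"
    by (rule P.Fubini'[symmetric]) (use cm in \<open>simp add: split_beta'\<close>)
  also have "\<dots> = (\<integral>\<^sup>+y. (\<integral>\<^sup>+z. ennreal (\<bar>g t z\<bar> * \<bar>f y\<bar>) * indicator E (z + y) \<partial>lborel) \<partial>lebesgue)"
  proof (rule nn_integral_cong)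
    fix y
    show "(\<integral>\<^sup>+x. ennreal (\<bar>g t (x - y)\<bar> * \<bar>f y\<bar>) * indicator E x \<partial>lborel)
       = (\<integral>\<^sup>+z. ennreal (\<bar>g t z\<bar> * \<bar>f y\<bar>) * indicator E (z + y) \<partial>lborel)"
      using nn_integral_lborel_shift[of "\<lambda>x. ennreal (\<bar>g t (x - y)\<bar> * \<bar>f y\<bar>) * indicator E x" y] by simp
  qed
  also have "\<dots> = (\<integral>\<^sup>+z. (\<integral>\<^sup>+y. ennreal (\<bar>g t z\<bar> * \<bar>f y\<bar>) * indicator E (z + y) \<partial>lebesgue) \<partial>lborel)"
  proof (rule P.Fubini')
    have [measurable]: "(\<lambda>p. snd p) \<in> borel_measurable (lborel \<Otimes>\<^sub>M (lebesgue :: (real ^ 'n) measure))"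
      by (rule measurable_compose[OF measurable_snd]) (rule measurable_completion, simp)
    show "(\<lambda>(z, y). ennreal (\<bar>g t z\<bar> * \<bar>f y\<bar>) * indicator E (z + y)) \<in> borel_measurable (lborel \<Otimes>\<^sub>M lebesgue)"
      unfolding split_beta' by measurable
  qed
  also have "\<dots> \<le> (\<integral>\<^sup>+z. ennreal (A * ?\<mu>) * ennreal \<bar>g t z\<bar> \<partial>lborel)"
  proof (intro nn_integral_mono)
    fix z
    let ?Ez = "{y. z + y \<in> E}"
    have Ez [measurable]: "?Ez \<in> sets borel" by measurable
    have eEz: "emeasure lborel ?Ez = emeasure lborel E"
    proof -
      have "emeasure lborel E = (\<integral>\<^sup>+y. indicator E (y + z) \<partial>lborel)"
        by (subst nn_integral_lborel_shift) auto
      also have "\<dots> = (\<integral>\<^sup>+y. indicator ?Ez y \<partial>lborel)"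
        by (intro nn_integral_cong) (auto simp: indicator_def add.commute)
      finally show ?thesis by simp
    qed
    have "(\<integral>\<^sup>+y. ennreal (\<bar>g t z\<bar> * \<bar>f y\<bar>) * indicator E (z + y) \<partial>lebesgue)
      = (\<integral>\<^sup>+y. ennreal \<bar>g t z\<bar> * (ennreal \<bar>f y\<bar> * indicator ?Ez y) \<partial>lebesgue)"
      by (intro nn_integral_cong) (auto simp: ennreal_mult indicator_def)
    also have "\<dots> = ennreal \<bar>g t z\<bar> * (\<integral>\<^sup>+y\<in>?Ez. ennreal \<bar>f y\<bar> \<partial>lebesgue)"
      by (rule nn_integral_cmult)
         (intro borel_measurable_times_ennreal measurable_compose[OF _ measurable_ennreal]
            borel_measurable_abs assms borel_measurable_indicator sets_completionI_sets, use Ez in simp)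
    also have "\<dots> \<le> ennreal \<bar>g t z\<bar> * ennreal (A * measure lborel ?Ez powr (1 - 1 / q))"
      using f Ez E(2) eEz unfolding marcinkiewicz_def by (intro mult_left_mono) auto
    also have "measure lborel ?Ez = measure lborel E" using eEz by (simp add: measure_def)
    finally show "(\<integral>\<^sup>+y. ennreal (\<bar>g t z\<bar> * \<bar>f y\<bar>) * indicator E (z + y) \<partial>lebesgue) \<le> ennreal (A * ?\<mu>) * ennreal \<bar>g t z\<bar>"
      by (simp add: mult.commute)
  qed
  also have "\<dots> = ennreal (A * ?\<mu>) * (\<integral>\<^sup>+z. ennreal \<bar>g t z\<bar> \<partial>lborel)"
    by (rule nn_integral_cmult) measurable
  also have "\<dots> \<le> ennreal (A * ?\<mu>) * ennreal G" by (intro mult_left_mono L1_bound t) auto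
  also have "\<dots> = ennreal (G * A * ?\<mu>)"
    using A G by (subst ennreal_mult[symmetric]) (auto simp: mult_ac)
  finally show "(\<integral>\<^sup>+x\<in>E. conv_abs t f x \<partial>lebesgue) \<le> ennreal (G * A * ?\<mu>)" .
qed

lemma conv_integrable:
  assumes t: "t > 0" and f: "weak_type r A (eabs f)" and [measurable]: "f \<in> borel_measurable lebesgue"
    and r: "r > 1" and A: "A > 0"
  shows "integrable lebesgue (\<lambda>y. g t (x - y) * f y)"
proof -
  note [measurable] = g_diff_measurable_lebesgue[OF t]
  have "(\<integral>\<^sup>+y. ennreal (norm (g t (x - y) * f y)) \<partial>lebesgue) = conv_abs t f x"
    by (simp add: conv_abs_def abs_mult)
  also have "\<dots> < \<infinity>" by (rule order.strict_trans1[OF conv_abs_sup[OF assms]]) simp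
  finally show ?thesis by (auto simp: integrable_iff_bounded)
qed

lemma abs_conv_le: "ennreal \<bar>conv t f x\<bar> \<le> conv_abs t f x"
proof (cases "integrable lebesgue (\<lambda>y. g t (x - y) * f y)")
  case True
  then have "ennreal (norm (conv t f x)) \<le> (\<integral>\<^sup>+y. ennreal (norm (g t (x - y) * f y)) \<partial>lebesgue)"
    unfolding conv_def by (rule integral_norm_bound_ennreal)
  then show ?thesis by (simp add: conv_abs_def abs_mult)
qed (simp add: conv_def not_integrable_integral_eq)

lemma conv_diff:
  assumes t: "t > 0" and "r > 1"
    and "weak_type r A (eabs f)" "f \<in> borel_measurable lebesgue" "A > 0"
    and "weak_type r B (eabs h)" "h \<in> borel_measurable lebesgue" "B > 0"
  shows "conv t (\<lambda>x. f x - h x) x = conv t f x - conv t h x"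
  unfolding conv_def
  using conv_integrable[OF t assms(3,4,2,5)] conv_integrable[OF t assms(6,7,2,8)]
  by (subst Bochner_Integration.integral_diff[symmetric]) (auto simp: algebra_simps)

text \<open>The part of \<open>f\<close> above height \<open>1\<close> is integrable, and dominated convergence applies as the kernel is
bounded and continuous. The part below is bounded, and translation of the kernel is continuous in \<open>L\<^sup>1\<close> by
Scheffe's lemma, since translates converge pointwise and have equal \<open>L\<^sup>1\<close> norms.\<close>

lemma conv_continuous:
  assumes t: "t > 0" and f: "weak_type r A (eabs f)" and [measurable]: "f \<in> borel_measurable lebesgue"
    and r: "r > 1" and A: "A > 0"
  shows "continuous_on UNIV (conv t f)"
  unfolding continuous_on_sequentially
proof (intro ballI allI impI, unfold o_def)
  note [measurable] = g_diff_measurable_lebesgue[OF t]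
  fix x and s :: "nat \<Rightarrow> real ^ 'n" assume "(\<forall>n. s n \<in> UNIV) \<and> s \<longlonglongrightarrow> x"
  then have s: "s \<longlonglongrightarrow> x" by simp
  have gs: "(\<lambda>k. g t (s k - y)) \<longlonglongrightarrow> g t (x - y)" for y
    using cont[OF t] s
    by (intro isCont_tendsto_compose[of "x - y" "g t"]) (auto simp: continuous_on_eq_continuous_at intro!: tendsto_intros)
  define E where "E = {x. ennreal 1 < ennreal \<bar>f x\<bar>}"
  have Em [measurable]: "E \<in> sets lebesgue" unfolding E_def by (rule superlevel_lebesgue) measurable
  have "emeasure lebesgue E \<le> ennreal ((A / 1) powr r)"
    unfolding E_def by (rule weak_typeD(2)[OF f]) simp
  then have Efin: "emeasure lebesgue E < \<infinity>" by (rule order.strict_trans1) simp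
  define f1 f2 where "f1 y = f y * indicator E y" and "f2 y = f y * indicator (- E) y" for y
  have [measurable]: "f1 \<in> borel_measurable lebesgue" "f2 \<in> borel_measurable lebesgue"
    unfolding f1_def f2_def by measurable
  have f2: "\<bar>f2 y\<bar> \<le> 1" for y by (auto simp: f2_def E_def indicator_def ennreal_less_iff)
  have f1: "integrable lebesgue f1"
  proof -
    have "(\<integral>\<^sup>+y. ennreal (norm (f1 y)) \<partial>lebesgue) = (\<integral>\<^sup>+y\<in>E. ennreal \<bar>f y\<bar> \<partial>lebesgue)"
      by (intro nn_integral_cong) (auto simp: f1_def indicator_def)
    also have "\<dots> < \<infinity>"
      by (rule order.strict_trans1[OF marcinkiewicz_lebesgue_set[OF marcinkiewicz_of_weak_type[OF f r A] Em Efin]]) simp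
    finally show ?thesis by (simp add: integrable_iff_bounded)
  qed
  have ig: "integrable lebesgue (\<lambda>y. g t (z - y))" for z
    using order.strict_trans1[OF L1_bound_reflect[OF t, of z]] by (simp add: integrable_iff_bounded)
  have i1: "integrable lebesgue (\<lambda>y. g t (z - y) * f1 y)" for z
  proof (rule Bochner_Integration.integrable_bound)
    show "integrable lebesgue (\<lambda>y. (G * t powr (- d)) * f1 y)" using f1 by simp
    show "AE y in lebesgue. norm (g t (z - y) * f1 y) \<le> norm (G * t powr (- d) * f1 y)"
      using sup_bound[OF t] G by (intro AE_I2) (auto simp: abs_mult intro!: mult_right_mono)
  qed measurable
  have i2: "integrable lebesgue (\<lambda>y. g t (z - y) * f2 y)" for z
    by (rule Bochner_Integration.integrable_bound[OF ig[of z]])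
       (use f2 in \<open>auto simp: abs_mult intro!: mult_left_le\<close>)
  have split: "conv t f z = (\<integral>y. g t (z - y) * f1 y \<partial>lebesgue) + (\<integral>y. g t (z - y) * f2 y \<partial>lebesgue)" for z
  proof -
    have "g t (z - y) * f y = g t (z - y) * f1 y + g t (z - y) * f2 y" for y
      by (auto simp: f1_def f2_def indicator_def)
    then show ?thesis unfolding conv_def using Bochner_Integration.integral_add[OF i1 i2] by simp
  qed
  have l1: "(\<lambda>k. \<integral>y. g t (s k - y) * f1 y \<partial>lebesgue) \<longlonglongrightarrow> (\<integral>y. g t (x - y) * f1 y \<partial>lebesgue)"
  proof (rule integral_dominated_convergence[where w="\<lambda>y. G * t powr (- d) * \<bar>f1 y\<bar>"])
    show "AE y in lebesgue. (\<lambda>k. g t (s k - y) * f1 y) \<longlonglongrightarrow> g t (x - y) * f1 y"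
      by (intro AE_I2 tendsto_intros gs)
    show "AE y in lebesgue. norm (g t (s k - y) * f1 y) \<le> G * t powr (- d) * \<bar>f1 y\<bar>" for k
      using sup_bound[OF t] by (intro AE_I2) (auto simp: abs_mult intro!: mult_right_mono)
  qed (use f1 in auto)
  have sch: "(\<lambda>k. \<integral>\<^sup>+y. norm (g t (s k - y) - g t (x - y)) \<partial>lebesgue) \<longlonglongrightarrow> 0"
  proof (rule Scheffe_lemma2)
    show "(\<integral>\<^sup>+y. norm (g t (s k - y)) \<partial>lebesgue) \<le> (\<integral>\<^sup>+y. norm (g t (x - y)) \<partial>lebesgue)" for k
      unfolding nn_integral_completion
      using nn_integral_lborel_reflect[of "\<lambda>y. ennreal (norm (g t y))"] g_measurable[OF t] by simp
  qed (use gs ig in auto)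
  have l2: "(\<lambda>k. \<integral>y. g t (s k - y) * f2 y \<partial>lebesgue) \<longlonglongrightarrow> (\<integral>y. g t (x - y) * f2 y \<partial>lebesgue)"
  proof -
    have "ennreal \<bar>(\<integral>y. g t (s k - y) * f2 y \<partial>lebesgue) - (\<integral>y. g t (x - y) * f2 y \<partial>lebesgue)\<bar>
       \<le> (\<integral>\<^sup>+y. norm (g t (s k - y) - g t (x - y)) \<partial>lebesgue)" for k
    proof -
      have "(\<integral>y. g t (s k - y) * f2 y \<partial>lebesgue) - (\<integral>y. g t (x - y) * f2 y \<partial>lebesgue)
        = (\<integral>y. g t (s k - y) * f2 y - g t (x - y) * f2 y \<partial>lebesgue)"
        by (rule Bochner_Integration.integral_diff[symmetric, OF i2 i2])
      then have "ennreal \<bar>(\<integral>y. g t (s k - y) * f2 y \<partial>lebesgue) - (\<integral>y. g t (x - y) * f2 y \<partial>lebesgue)\<bar>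
         \<le> (\<integral>\<^sup>+y. norm (g t (s k - y) * f2 y - g t (x - y) * f2 y) \<partial>lebesgue)"
        using integral_norm_bound_ennreal[OF Bochner_Integration.integrable_diff[OF i2[of "s k"] i2[of x]]] by simp
      also have "\<dots> \<le> (\<integral>\<^sup>+y. norm (g t (s k - y) - g t (x - y)) \<partial>lebesgue)"
      proof (intro nn_integral_mono ennreal_leI)
        fix y
        have "\<bar>(g t (s k - y) - g t (x - y)) * f2 y\<bar> \<le> \<bar>g t (s k - y) - g t (x - y)\<bar>"
          unfolding abs_mult using f2[of y] by (intro mult_left_le) auto
        then show "norm (g t (s k - y) * f2 y - g t (x - y) * f2 y) \<le> norm (g t (s k - y) - g t (x - y))"
          by (simp add: algebra_simps)
      qed
      finally show ?thesis .
    qed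
    then have "(\<lambda>k. ennreal \<bar>(\<integral>y. g t (s k - y) * f2 y \<partial>lebesgue) - (\<integral>y. g t (x - y) * f2 y \<partial>lebesgue)\<bar>) \<longlonglongrightarrow> 0"
      by (intro tendsto_sandwich[OF _ _ tendsto_const sch]) auto
    then have "(\<lambda>k. (\<integral>y. g t (s k - y) * f2 y \<partial>lebesgue) - (\<integral>y. g t (x - y) * f2 y \<partial>lebesgue)) \<longlonglongrightarrow> 0"
      by (simp add: tendsto_ennreal_iff[of _ _ 0, simplified] tendsto_rabs_zero_iff)
    then show ?thesis by (simp add: LIM_zero_iff)
  qed
  show "(\<lambda>k. conv t f (s k)) \<longlonglongrightarrow> conv t f x"
    unfolding split by (intro tendsto_add l1 l2)
qed

lemma conv_sup:
  assumes t: "t > 0" and f: "weak_type r A (eabs f)" and fm: "f \<in> borel_measurable lebesgue"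
    and r: "r > 1" and A: "A > 0"
  shows "\<bar>conv t f x\<bar> \<le> G * (r / (r - 1) + 1) * A * t powr (- (d / r))"
proof -
  have "ennreal \<bar>conv t f x\<bar> \<le> ennreal (G * (r / (r - 1) + 1) * A * t powr (- (d / r)))"
    using abs_conv_le conv_abs_sup[OF assms] by (rule order_trans)
  moreover have "0 \<le> G * (r / (r - 1) + 1) * A * t powr (- (d / r))" using G r A by simp
  ultimately show ?thesis by (simp add: ennreal_le_iff)
qed

text \<open>Smoothing between weak spaces: Young's inequality gives the same exponent \<open>r\<close>, and interpolation with the
supremum bound gives the higher exponent \<open>q\<close> at the cost of a negative power of \<open>t\<close>.\<close>

lemma conv_weak_type:
  assumes t: "t > 0" and f: "weak_type r A (eabs f)" and fm: "f \<in> borel_measurable lebesgue"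
    and r: "r > 1" and A: "A > 0" and q: "r \<le> q"
  shows "weak_type q (G * (r / (r - 1) + 1) * A * t powr (- (d * (1 / r - 1 / q)))) (eabs (conv t f))"
proof -
  let ?c = "r / (r - 1)"
  have c: "?c > 0" using r by simp
  have [measurable]: "conv t f \<in> borel_measurable lebesgue"
    using borel_measurable_continuous_onI[OF conv_continuous[OF assms(1-5)]]
    by (intro measurable_completion) simp
  have "marcinkiewicz r (G * (?c * A)) (conv_abs t f)"
    using mult_nonneg_nonneg[of ?c A] c A
    by (intro conv_abs_marcinkiewicz[OF t marcinkiewicz_of_weak_type[OF f r A] fm]) linarith
  then have "marcinkiewicz r (G * (?c * A)) (eabs (conv t f))"
    by (rule marcinkiewicz_mono_AE) (auto simp: abs_conv_le)
  then have "weak_type r (G * (?c * A)) (eabs (conv t f))"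
    using r c A G by (intro weak_type_of_marcinkiewicz) auto
  then have w: "weak_type r (G * (?c + 1) * A) (eabs (conv t f))"
    using r c A G by (rule_tac weak_type_mono) (auto simp: algebra_simps)
  let ?K = "G * (?c + 1) * A"
  have K: "?K > 0" using G c A by (simp add: add_pos_pos)
  have "weak_type q (?K powr (r / q) * (?K * t powr (- (d / r))) powr (1 - r / q)) (eabs (conv t f))"
    using w by (rule weak_type_interpolate) (use K t r q conv_sup[OF assms(1-5)] in \<open>auto intro!: ennreal_leI\<close>)
  moreover have "?K powr (r / q) * (?K * t powr (- (d / r))) powr (1 - r / q)
      = ?K * t powr (- (d * (1 / r - 1 / q)))"
  proof -
    have "(?K * t powr (- (d / r))) powr (1 - r / q) = ?K powr (1 - r / q) * t powr (- (d / r) * (1 - r / q))"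
      using K t by (subst powr_mult) (auto simp: powr_powr)
    moreover have "?K powr (r / q) * ?K powr (1 - r / q) = ?K" using K by (simp flip: powr_add)
    moreover have "- (d / r) * (1 - r / q) = - (d * (1 / r - 1 / q))"
      using r q by (simp add: field_simps)
    ultimately show ?thesis by (simp only: mult.assoc[symmetric])
  qed
  ultimately show ?thesis by simp
qed

end

section \<open>The Duhamel integral\<close>

context kernel_family
begin

text \<open>The measurability of a source is required of its convolution at almost every point, and not of
\<open>f\<close> jointly in time and space: a curve in \<open>L\<^bsup>q,\<infinity>\<^esup>\<close> is given by arbitrary representatives at each time.\<close>

definition admissible_source :: "real \<Rightarrow> real \<Rightarrow> (real \<Rightarrow> real ^ 'n \<Rightarrow> real) \<Rightarrow> bool" where
  "admissible_source r t f \<longleftrightarrow>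
     (\<forall>\<tau>\<in>{0<..<t}. f \<tau> \<in> borel_measurable lebesgue \<and> (\<exists>A>0. weak_type r A (eabs (f \<tau>)))) \<and>
     (AE x in lborel. (\<lambda>\<tau>. indicator {0<..<t} \<tau> * conv (t - \<tau>) (f \<tau>) x) \<in> borel_measurable borel)"

definition duhamel_abs :: "real \<Rightarrow> (real \<Rightarrow> real ^ 'n \<Rightarrow> real) \<Rightarrow> real set \<Rightarrow> real ^ 'n \<Rightarrow> ennreal" where
  "duhamel_abs t f I x = (\<integral>\<^sup>+\<tau>\<in>I. ennreal \<bar>conv (t - \<tau>) (f \<tau>) x\<bar> \<partial>lborel)"

lemma duhamel_integrand_measurable:
  assumes f: "admissible_source r t f" and r: "r > 1"
  shows "(\<lambda>p. indicator {0<..<t} (fst p) * conv (t - fst p) (f (fst p)) (snd p))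
     \<in> borel_measurable (lborel \<Otimes>\<^sub>M lborel)"
proof (rule borel_measurable_caratheodory[where h="\<lambda>\<tau> x. indicator {0<..<t} \<tau> * conv (t - \<tau>) (f \<tau>) x"])
  show "continuous_on UNIV (\<lambda>x. indicator {0<..<t} \<tau> * conv (t - \<tau>) (f \<tau>) x)" for \<tau>
  proof (cases "\<tau> \<in> {0<..<t}")
    case True
    then obtain A where A: "A > 0" "weak_type r A (eabs (f \<tau>))" "f \<tau> \<in> borel_measurable lebesgue"
      using f unfolding admissible_source_def by blast
    have "continuous_on UNIV (conv (t - \<tau>) (f \<tau>))"
      using True by (intro conv_continuous[OF _ A(2,3) r A(1)]) auto
    then show ?thesis by (intro continuous_intros)
  qed simp
qed (use f in \<open>simp add: admissible_source_def\<close>)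

lemma duhamel_abs_marcinkiewicz:
  assumes f: "admissible_source r t f" and r: "r > 1" and q: "q > 1"
    and I: "I \<in> sets borel" "I \<subseteq> {0<..<t}" and a: "a \<in> borel_measurable borel"
    and w: "\<And>\<tau>. \<tau> \<in> I \<Longrightarrow> a \<tau> > 0 \<and> weak_type q (a \<tau>) (eabs (conv (t - \<tau>) (f \<tau>)))"
    and Q: "(\<integral>\<^sup>+\<tau>\<in>I. ennreal (a \<tau>) \<partial>lborel) \<le> ennreal Q" "Q \<ge> 0"
  shows "marcinkiewicz q (q / (q - 1) * Q) (duhamel_abs t f I)"
proof -
  have ind: "\<tau> \<in> I \<Longrightarrow> indicator {0<..<t} \<tau> * conv (t - \<tau>) (f \<tau>) x = conv (t - \<tau>) (f \<tau>) x" for \<tau> x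
    using I(2) by (auto simp: indicator_def)
  have "marcinkiewicz q (q / (q - 1) * Q)
    (\<lambda>x. \<integral>\<^sup>+\<tau>\<in>I. ennreal \<bar>indicator {0<..<t} \<tau> * conv (t - \<tau>) (f \<tau>) x\<bar> \<partial>lborel)"
    by (rule marcinkiewicz_time_integral[OF duhamel_integrand_measurable[OF f r] I(1) a])
       (use w Q q in \<open>simp_all add: ind\<close>)
  moreover have "(\<lambda>x. \<integral>\<^sup>+\<tau>\<in>I. ennreal \<bar>indicator {0<..<t} \<tau> * conv (t - \<tau>) (f \<tau>) x\<bar> \<partial>lborel) = duhamel_abs t f I"
  proof
    fix x
    show "(\<integral>\<^sup>+\<tau>\<in>I. ennreal \<bar>indicator {0<..<t} \<tau> * conv (t - \<tau>) (f \<tau>) x\<bar> \<partial>lborel) = duhamel_abs t f I x"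
      unfolding duhamel_abs_def
    proof (rule nn_integral_cong)
      fix \<tau> :: real
      show "ennreal \<bar>indicator {0<..<t} \<tau> * conv (t - \<tau>) (f \<tau>) x\<bar> * indicator I \<tau>
          = ennreal \<bar>conv (t - \<tau>) (f \<tau>) x\<bar> * indicator I \<tau>"
        using ind[of \<tau> x] by (cases "\<tau> \<in> I") auto
    qed
  qed
  ultimately show ?thesis by simp
qed

lemma duhamel_abs_split:
  assumes f: "admissible_source r t f" and r: "r > 1"
    and I: "I \<in> sets borel" "J \<in> sets borel" "I \<inter> J = {}" "I \<union> J \<subseteq> {0<..<t}"
  shows "AE x in lebesgue. duhamel_abs t f (I \<union> J) x = duhamel_abs t f I x + duhamel_abs t f J x"
proof (rule AE_completion)
  have "AE x in lborel. (\<lambda>\<tau>. indicator {0<..<t} \<tau> * conv (t - \<tau>) (f \<tau>) x) \<in> borel_measurable borel"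
    using f unfolding admissible_source_def by blast
  then show "AE x in lborel. duhamel_abs t f (I \<union> J) x = duhamel_abs t f I x + duhamel_abs t f J x"
  proof eventually_elim
    case (elim x)
    note [measurable] = elim I(1,2)
    let ?h = "\<lambda>\<tau>. indicator {0<..<t} \<tau> * conv (t - \<tau>) (f \<tau>) x"
    have *: "duhamel_abs t f A x = (\<integral>\<^sup>+\<tau>. ennreal \<bar>?h \<tau>\<bar> * indicator A \<tau> \<partial>lborel)" if "A \<subseteq> I \<union> J" for A
      unfolding duhamel_abs_def
    proof (rule nn_integral_cong)
      fix \<tau> :: real
      show "ennreal \<bar>conv (t - \<tau>) (f \<tau>) x\<bar> * indicator A \<tau> = ennreal \<bar>?h \<tau>\<bar> * indicator A \<tau>"
        using subsetD[OF that, of \<tau>] subsetD[OF I(4), of \<tau>] by (cases "\<tau> \<in> A") simp_all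
    qed
    have "duhamel_abs t f (I \<union> J) x = (\<integral>\<^sup>+\<tau>. ennreal \<bar>?h \<tau>\<bar> * indicator I \<tau> + ennreal \<bar>?h \<tau>\<bar> * indicator J \<tau> \<partial>lborel)"
      unfolding *[OF order_refl] using I(3) by (intro nn_integral_cong) (auto simp: indicator_def)
    also have "\<dots> = duhamel_abs t f I x + duhamel_abs t f J x"
      unfolding *[OF Un_upper1] *[OF Un_upper2] by (rule nn_integral_add) measurable
    finally show ?case .
  qed
qed

lemma duhamel_abs_measurable:
  assumes f: "admissible_source r t f" and r: "r > 1"
    and I: "I \<in> sets borel" "I \<subseteq> {0<..<t}"
  shows "duhamel_abs t f I \<in> borel_measurable lebesgue"
proof (rule measurable_completion)
  let ?h = "\<lambda>\<tau> x. indicator {0<..<t} \<tau> * conv (t - \<tau>) (f \<tau>) x"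
  note [measurable] = I(1)
  have [measurable]: "(\<lambda>(x, \<tau>). ?h \<tau> x) \<in> borel_measurable (lborel \<Otimes>\<^sub>M lborel)"
    using measurable_compose[OF measurable_pair_swap' duhamel_integrand_measurable[OF f r]]
    by (simp add: split_beta' case_prod_unfold)
  have "duhamel_abs t f I = (\<lambda>x. \<integral>\<^sup>+\<tau>\<in>I. ennreal \<bar>?h \<tau> x\<bar> \<partial>lborel)"
    unfolding duhamel_abs_def[abs_def] using I(2)
    by (intro ext nn_integral_cong) (auto simp: indicator_def)
  also have "\<dots> \<in> borel_measurable lborel" by measurable
  finally show "duhamel_abs t f I \<in> borel_measurable lborel" .
qed

text \<open>The smoothing rate \<open>(t - \<tau>)\<^bsup>-1\<^esup>\<close> into \<open>L\<^bsup>q,\<infinity>\<^esup>\<close> is not integrable, so \<open>duhamel_abs_marcinkiewicz\<close> cannot be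
applied with exponent \<open>q\<close>. For a given height the times with \<open>t - \<tau> \<ge> S\<close> are treated in the supremum norm,
where the rate \<open>(t - \<tau>)\<^bsup>-d/r\<^esup>\<close> is integrable at infinity, and the remaining ones in \<open>L\<^bsup>r,\<infinity>\<^esup>\<close>, where
the rate is constant. The cut \<open>S\<close> is determined by the height.\<close>

lemma duhamel_abs_critical:
  assumes f: "admissible_source r t f" and r: "r > 1" and q: "q > 1" and crit: "d * (1 / r - 1 / q) = 1"
    and L: "L > 0" and I: "I \<in> sets borel" "I \<subseteq> {0<..<t}"
    and w: "\<And>\<tau>. \<tau> \<in> I \<Longrightarrow> weak_type r L (eabs (f \<tau>))"
  defines "c \<equiv> G * (r / (r - 1) + 1)"
  shows "weak_type q ((2 * (r / (r - 1) * c) * (2 * c * q / d) powr (q / d)) powr (r / q) * L) (duhamel_abs t f I)"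
  unfolding weak_type_def
proof (intro conjI allI impI)
  have c: "c > 0" unfolding c_def using G r by (intro mult_pos_pos add_pos_pos) auto
  show dm: "duhamel_abs t f I \<in> borel_measurable lebesgue"
    by (rule duhamel_abs_measurable[OF f r I])
  have dr: "d / r = 1 + d / q" using crit by (simp add: algebra_simps)
  have dr1: "d / r > 1" unfolding dr using d q by simp
  fix \<nu> :: real assume \<nu>: "\<nu> > 0"
  \<comment> \<open>chosen to make the bound for the far part equal to \<open>\<nu> / 2\<close>\<close>
  define S where "S = (2 * c * q / d * L / \<nu>) powr (q / d)"
  have S: "S > 0" unfolding S_def using c q d L \<nu> by simp
  define I1 I2 where "I1 = I \<inter> {..t - S}" and "I2 = I \<inter> {t - S<..}"
  have I12: "I1 \<in> sets borel" "I2 \<in> sets borel" "I1 \<inter> I2 = {}" "I1 \<union> I2 = I"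
    using I(1) by (auto simp: I1_def I2_def)
  have fm: "\<tau> \<in> I \<Longrightarrow> f \<tau> \<in> borel_measurable lebesgue" for \<tau>
    using f I(2) unfolding admissible_source_def by blast
  have far: "duhamel_abs t f I1 x \<le> ennreal (\<nu> / 2)" for x
  proof -
    have "duhamel_abs t f I1 x \<le> (\<integral>\<^sup>+\<tau>. ennreal (c * L) * (ennreal ((t - \<tau>) powr (- (d / r))) * indicator {S..} (t - \<tau>)) \<partial>lborel)"
      unfolding duhamel_abs_def
    proof (rule nn_integral_mono)
      fix \<tau> :: real
      show "ennreal \<bar>conv (t - \<tau>) (f \<tau>) x\<bar> * indicator I1 \<tau>
         \<le> ennreal (c * L) * (ennreal ((t - \<tau>) powr (- (d / r))) * indicator {S..} (t - \<tau>))"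
      proof (cases "\<tau> \<in> I1")
        case True
        then have \<tau>: "\<tau> \<in> I" "t - \<tau> \<ge> S" "t - \<tau> > 0" using S by (auto simp: I1_def)
        have "ennreal \<bar>conv (t - \<tau>) (f \<tau>) x\<bar> \<le> ennreal (c * L * (t - \<tau>) powr (- (d / r)))"
          unfolding c_def by (intro ennreal_leI conv_sup[OF \<tau>(3) w[OF \<tau>(1)] fm[OF \<tau>(1)] r L])
        also have "\<dots> = ennreal (c * L) * ennreal ((t - \<tau>) powr (- (d / r)))"
          using c L by (intro ennreal_mult) auto
        finally show ?thesis using True \<tau> by simp
      qed simp
    qed
    also have "\<dots> = ennreal (c * L) * (\<integral>\<^sup>+\<tau>. ennreal ((t - \<tau>) powr (- (d / r))) * indicator {S..} (t - \<tau>) \<partial>lborel)"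
      by (rule nn_integral_cmult) measurable
    also have "(\<integral>\<^sup>+\<tau>. ennreal ((t - \<tau>) powr (- (d / r))) * indicator {S..} (t - \<tau>) \<partial>lborel)
       = (\<integral>\<^sup>+s\<in>{S..}. ennreal (s powr (- (d / r))) \<partial>lborel)"
      by (rule nn_integral_lborel_reflect[of "\<lambda>s. ennreal (s powr (- (d / r))) * indicator {S..} s" t]) measurable
    also have "\<dots> = ennreal (S powr (1 - d / r) / (d / r - 1))"
      by (rule nn_integral_powr_tail[OF S dr1])
    also have "ennreal (c * L) * \<dots> = ennreal (c * L * (S powr (1 - d / r) / (d / r - 1)))"
      using c L dr1 by (intro ennreal_mult[symmetric]) auto
    also have "c * L * (S powr (1 - d / r) / (d / r - 1)) = \<nu> / 2"
    proof -
      have "S powr (1 - d / r) = inverse (2 * c * q / d * L / \<nu>)"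
        unfolding S_def powr_powr dr using d q c L \<nu> by (simp add: powr_minus)
      then show ?thesis unfolding dr using d q c L \<nu> by (simp add: field_simps)
    qed
    finally show ?thesis .
  qed
  have "marcinkiewicz r (r / (r - 1) * (c * L * S)) (duhamel_abs t f I2)"
  proof (rule duhamel_abs_marcinkiewicz[OF f r r, where a="\<lambda>_. c * L"])
    show "I2 \<in> sets borel" "I2 \<subseteq> {0<..<t}" using I12 I(2) by auto
    show "0 < c * L \<and> weak_type r (c * L) (eabs (conv (t - \<tau>) (f \<tau>)))" if "\<tau> \<in> I2" for \<tau>
    proof -
      have \<tau>: "\<tau> \<in> I" "t - \<tau> > 0" using that I(2) by (auto simp: I2_def)
      from conv_weak_type[OF \<tau>(2) w[OF \<tau>(1)] fm[OF \<tau>(1)] r L order_refl]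
      show ?thesis using c L \<tau> by (simp add: c_def)
    qed
    have "(\<integral>\<^sup>+\<tau>\<in>I2. ennreal (c * L) \<partial>lborel) = ennreal (c * L) * emeasure lborel I2"
      using I12 by (subst nn_integral_cmult_indicator) auto
    also have "emeasure lborel I2 \<le> emeasure lborel {t - S..t}"
      using I(2) by (intro emeasure_mono) (auto simp: I2_def)
    also have "emeasure lborel {t - S..t} = ennreal S" using S by simp
    also have "ennreal (c * L) * ennreal S = ennreal (c * L * S)"
      using c L S by (intro ennreal_mult[symmetric]) auto
    finally show "(\<integral>\<^sup>+\<tau>\<in>I2. ennreal (c * L) \<partial>lborel) \<le> ennreal (c * L * S)"
      by (simp add: mult_left_mono)
  qed (use c L S in auto)
  then have near: "weak_type r (r / (r - 1) * (c * L * S)) (duhamel_abs t f I2)"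
    using r c L S by (intro weak_type_of_marcinkiewicz) auto
  have I2m: "duhamel_abs t f I2 \<in> borel_measurable lebesgue" by (rule weak_typeD(1)[OF near])
  have "AE x in lebesgue. duhamel_abs t f I x = duhamel_abs t f I1 x + duhamel_abs t f I2 x"
    using duhamel_abs_split[OF f r I12(1-3)] I12(4) I(2) by simp
  then have "AE x in lebesgue. x \<in> {x. ennreal \<nu> < duhamel_abs t f I x} \<longrightarrow> x \<in> {x. ennreal (\<nu> / 2) < duhamel_abs t f I2 x}"
  proof eventually_elim
    case (elim x)
    show ?case
    proof (intro impI, rule ccontr)
      assume *: "x \<in> {x. ennreal \<nu> < duhamel_abs t f I x}" and "x \<notin> {x. ennreal (\<nu> / 2) < duhamel_abs t f I2 x}"
      then have "duhamel_abs t f I x \<le> ennreal (\<nu> / 2) + ennreal (\<nu> / 2)"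
        unfolding elim using far by (intro add_mono) auto
      also have "\<dots> = ennreal \<nu>" using \<nu> by (simp flip: ennreal_plus)
      finally show False using * by simp
    qed
  qed
  then have "emeasure lebesgue {x. ennreal \<nu> < duhamel_abs t f I x} \<le> emeasure lebesgue {x. ennreal (\<nu> / 2) < duhamel_abs t f I2 x}"
    by (rule emeasure_mono_AE) (rule superlevel_lebesgue[OF I2m])
  also have "\<dots> \<le> ennreal ((r / (r - 1) * (c * L * S) / (\<nu> / 2)) powr r)"
    by (rule weak_typeD(2)[OF near]) (use \<nu> in auto)
  also have "(r / (r - 1) * (c * L * S) / (\<nu> / 2)) powr r
     = ((2 * (r / (r - 1) * c) * (2 * c * q / d) powr (q / d)) powr (r / q) * L / \<nu>) powr q"
  proof -
    let ?k1 = "2 * (r / (r - 1) * c)" and ?k2 = "2 * c * q / d"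
    have k: "?k1 > 0" "?k2 > 0" using r c q d by auto
    have L\<nu>: "L / \<nu> > 0" using L \<nu> by simp
    have "S = ?k2 powr (q / d) * (L / \<nu>) powr (q / d)"
      unfolding S_def using k L\<nu> by (subst powr_mult[symmetric]) auto
    then have "r / (r - 1) * (c * L * S) / (\<nu> / 2) = (?k1 * ?k2 powr (q / d)) * ((L / \<nu>) powr 1 * (L / \<nu>) powr (q / d))"
      using L \<nu> by simp
    also have "\<dots> = (?k1 * ?k2 powr (q / d)) * (L / \<nu>) powr (1 + q / d)"
      by (simp only: powr_add)
    finally have "(r / (r - 1) * (c * L * S) / (\<nu> / 2)) powr r
       = (?k1 * ?k2 powr (q / d)) powr r * (L / \<nu>) powr ((1 + q / d) * r)"
      using k L\<nu> by (simp only: powr_mult powr_powr mult_pos_pos powr_gt_zero less_imp_le zero_le_mult_iff powr_ge_zero simp_thms)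
    moreover have "(1 + q / d) * r = q"
      using dr d q r by (simp add: field_simps)
    moreover have "(?k1 * ?k2 powr (q / d)) powr r = ((?k1 * ?k2 powr (q / d)) powr (r / q)) powr q"
      using q by (simp add: powr_powr)
    moreover have "((?k1 * ?k2 powr (q / d)) powr (r / q)) powr q * (L / \<nu>) powr q
       = ((?k1 * ?k2 powr (q / d)) powr (r / q) * (L / \<nu>)) powr q"
      by (rule powr_mult[symmetric])
    ultimately show ?thesis by simp
  qed
  finally show "emeasure lebesgue {x. ennreal \<nu> < duhamel_abs t f I x}
    \<le> ennreal (((2 * (r / (r - 1) * c) * (2 * c * q / d) powr (q / d)) powr (r / q) * L / \<nu>) powr q)" .
qed

text \<open>For \<open>\<tau> < \<rho>t \<le> t/2\<close> the smoothing factor is comparable to its value at \<open>\<tau> = 0\<close>; what remains is the integral of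
\<open>\<tau>\<^bsup>-\<beta>\<^esup>\<close> over a short interval, and this gives the small factor \<open>\<rho>\<^bsup>1-\<beta>\<^esup>\<close>.\<close>

lemma duhamel_abs_early:
  assumes f: "admissible_source r t f" and r: "r > 1" "r \<le> q" and t: "t > 0"
    and \<beta>: "\<beta> < 1" and a: "d * (1 / r - 1 / q) + \<beta> = 1 + \<delta>"
    and B: "B > 0" and \<rho>: "0 < \<rho>" "\<rho> \<le> 1 / 2"
    and w: "\<And>\<tau>. 0 < \<tau> \<Longrightarrow> \<tau> < \<rho> * t \<Longrightarrow> weak_type r (B * \<tau> powr (- \<beta>)) (eabs (f \<tau>))"
  shows "marcinkiewicz q (q / (q - 1) * (G * (r / (r - 1) + 1) * 2 powr (d * (1 / r - 1 / q)) / (1 - \<beta>)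
      * (\<rho> powr (1 - \<beta>) * B) * t powr (- \<delta>))) (duhamel_abs t f {0<..<\<rho> * t})"
proof -
  define c where "c = G * (r / (r - 1) + 1)"
  have c: "c > 0" unfolding c_def using G r by (intro mult_pos_pos add_pos_pos) auto
  define s where "s = d * (1 / r - 1 / q)"
  have s: "s \<ge> 0" unfolding s_def using r d by (intro mult_nonneg_nonneg) (auto simp: frac_le)
  have \<rho>t: "0 < \<rho> * t" "\<rho> * t \<le> t / 2" using \<rho> t by (auto simp: field_simps)
  have "marcinkiewicz q (q / (q - 1) * (c * 2 powr s / (1 - \<beta>) * (\<rho> powr (1 - \<beta>) * B) * t powr (- \<delta>)))
      (duhamel_abs t f {0<..<\<rho> * t})"
  proof (rule duhamel_abs_marcinkiewicz[OF f r(1), where a="\<lambda>\<tau>. c * B * (t / 2) powr (- s) * \<tau> powr (- \<beta>)"])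
    show "q > 1" using r by simp
    have "\<rho> * t < t" using \<rho>t(2) t by linarith
    then show "{0<..<\<rho> * t} \<subseteq> {0<..<t}" by (auto intro: order.strict_trans)
    show "0 < c * B * (t / 2) powr (- s) * \<tau> powr (- \<beta>) \<and>
        weak_type q (c * B * (t / 2) powr (- s) * \<tau> powr (- \<beta>)) (eabs (conv (t - \<tau>) (f \<tau>)))"
      if "\<tau> \<in> {0<..<\<rho> * t}" for \<tau>
    proof
      have \<tau>: "0 < \<tau>" "\<tau> < \<rho> * t" "t / 2 \<le> t - \<tau>" "0 < t - \<tau>" "\<tau> < t" using that \<rho>t t by (simp_all, linarith+)
      show "0 < c * B * (t / 2) powr (- s) * \<tau> powr (- \<beta>)" using c B t \<tau> by simp
      have fm: "f \<tau> \<in> borel_measurable lebesgue" using f \<tau> unfolding admissible_source_def by auto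
      have Bt: "0 < B * \<tau> powr (- \<beta>)" using B \<tau> by simp
      have "weak_type q (c * (B * \<tau> powr (- \<beta>)) * (t - \<tau>) powr (- s)) (eabs (conv (t - \<tau>) (f \<tau>)))"
        unfolding c_def s_def by (rule conv_weak_type[OF \<tau>(4) w[OF \<tau>(1,2)] fm r(1) Bt r(2)])
      moreover have "(t - \<tau>) powr (- s) \<le> (t / 2) powr (- s)"
        using \<tau> t s by (intro powr_mono2') auto
      ultimately show "weak_type q (c * B * (t / 2) powr (- s) * \<tau> powr (- \<beta>)) (eabs (conv (t - \<tau>) (f \<tau>)))"
        using c B Bt r
        by (elim weak_type_mono) (auto simp: mult_ac intro!: mult_left_mono)
    qed
    have "(\<integral>\<^sup>+\<tau>\<in>{0<..<\<rho> * t}. ennreal (c * B * (t / 2) powr (- s) * \<tau> powr (- \<beta>)) \<partial>lborel)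
      = (\<integral>\<^sup>+\<tau>. ennreal (c * B * (t / 2) powr (- s)) * (ennreal (\<tau> powr (- \<beta>)) * indicator {0<..<\<rho> * t} \<tau>) \<partial>lborel)"
      using c B by (intro nn_integral_cong) (simp add: ennreal_mult mult.assoc)
    also have "\<dots> = ennreal (c * B * (t / 2) powr (- s)) * ennreal ((\<rho> * t) powr (- \<beta> + 1) / (- \<beta> + 1))"
      using \<rho>t \<beta> by (subst nn_integral_cmult) (auto simp: nn_integral_powr_head)
    also have "\<dots> = ennreal (c * B * (t / 2) powr (- s) * ((\<rho> * t) powr (- \<beta> + 1) / (- \<beta> + 1)))"
      using c B \<beta> by (intro ennreal_mult[symmetric]) auto
    also have "c * B * (t / 2) powr (- s) * ((\<rho> * t) powr (- \<beta> + 1) / (- \<beta> + 1))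
       = c * 2 powr s / (1 - \<beta>) * (\<rho> powr (1 - \<beta>) * B) * t powr (- \<delta>)"
    proof -
      have "(t / 2) powr (- s) = 2 powr s * t powr (- s)"
        using t by (simp add: powr_divide powr_minus field_simps)
      moreover have "(\<rho> * t) powr (- \<beta> + 1) = \<rho> powr (1 - \<beta>) * t powr (1 - \<beta>)"
        using \<rho> t by (simp add: powr_mult)
      moreover have "t powr (- s) * t powr (1 - \<beta>) = t powr (- \<delta>)"
        using a unfolding s_def[symmetric] by (simp flip: powr_add add: algebra_simps)
      ultimately show ?thesis by (simp add: mult_ac)
    qed
    finally show "(\<integral>\<^sup>+\<tau>\<in>{0<..<\<rho> * t}. ennreal (c * B * (t / 2) powr (- s) * \<tau> powr (- \<beta>)) \<partial>lborel)
      \<le> ennreal (c * 2 powr s / (1 - \<beta>) * (\<rho> powr (1 - \<beta>) * B) * t powr (- \<delta>))" by simp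
    show "0 \<le> c * 2 powr s / (1 - \<beta>) * (\<rho> powr (1 - \<beta>) * B) * t powr (- \<delta>)"
      using c B \<beta> by simp
  qed auto
  then show ?thesis unfolding c_def s_def .
qed

text \<open>With \<open>s\<close> for the smoothing exponent, \<open>\<tau>\<^bsup>-\<beta>\<^esup> (t - \<tau>)\<^bsup>-s\<^esup>\<close> has integrable singularities at both ends. It is bounded by the sum \<open>m \<tau>\<close> in
which, at each end, the nonsingular factor is replaced by its value at \<open>t/2\<close>, so that no Beta function is needed.\<close>

lemma duhamel_abs_late_subcritical:
  assumes f: "admissible_source r t f" and r: "r > 1" "r \<le> q" and t: "t > 0"
    and \<beta>: "0 \<le> \<beta>" "\<beta> < 1" and a: "d * (1 / r - 1 / q) + \<beta> = 1 + \<delta>" "d * (1 / r - 1 / q) < 1"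
    and L: "L > 0" and I: "I \<in> sets borel" "I \<subseteq> {0<..<t}"
    and w: "\<And>\<tau>. \<tau> \<in> I \<Longrightarrow> weak_type r (L * \<tau> powr (- \<beta>)) (eabs (f \<tau>))"
  shows "marcinkiewicz q (q / (q - 1) * (G * (r / (r - 1) + 1) *
      (2 powr (d * (1 / r - 1 / q)) / (1 - \<beta>) + 2 powr \<beta> / (1 - d * (1 / r - 1 / q))) * L * t powr (- \<delta>)))
      (duhamel_abs t f I)"
proof -
  define c where "c = G * (r / (r - 1) + 1)"
  have c: "c > 0" unfolding c_def using G r by (intro mult_pos_pos add_pos_pos) auto
  define s where "s = d * (1 / r - 1 / q)"
  have s: "s \<ge> 0" "s < 1" unfolding s_def using r d a by (auto intro!: mult_nonneg_nonneg simp: frac_le)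
  define m where "m \<tau> = (t / 2) powr (- s) * \<tau> powr (- \<beta>) + (t / 2) powr (- \<beta>) * (t - \<tau>) powr (- s)" for \<tau>
  have [measurable]: "m \<in> borel_measurable borel" unfolding m_def by measurable
  have "marcinkiewicz q (q / (q - 1) * (c * (2 powr s / (1 - \<beta>) + 2 powr \<beta> / (1 - s)) * L * t powr (- \<delta>)))
      (duhamel_abs t f I)"
  proof (rule duhamel_abs_marcinkiewicz[OF f r(1) _ I, where a="\<lambda>\<tau>. c * L * m \<tau>"])
    show "q > 1" using r by simp
    show "0 < c * L * m \<tau> \<and> weak_type q (c * L * m \<tau>) (eabs (conv (t - \<tau>) (f \<tau>)))"
      if "\<tau> \<in> I" for \<tau>
    proof
      have \<tau>: "0 < \<tau>" "0 < t - \<tau>" "\<tau> < t" using that I by auto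
      show "0 < c * L * m \<tau>" using c L t \<tau> by (simp add: m_def add_pos_pos)
      have fm: "f \<tau> \<in> borel_measurable lebesgue" using f \<tau> unfolding admissible_source_def by auto
      have Lt: "0 < L * \<tau> powr (- \<beta>)" using L \<tau> by simp
      have w': "weak_type q (c * (L * \<tau> powr (- \<beta>)) * (t - \<tau>) powr (- s)) (eabs (conv (t - \<tau>) (f \<tau>)))"
        unfolding c_def s_def by (rule conv_weak_type[OF \<tau>(2) w[OF that] fm r(1) Lt r(2)])
      have "\<tau> powr (- \<beta>) * (t - \<tau>) powr (- s) \<le> m \<tau>"
      proof (cases "\<tau> \<le> t / 2")
        case True
        then have "(t - \<tau>) powr (- s) \<le> (t / 2) powr (- s)" using t s by (intro powr_mono2') auto
        then have "\<tau> powr (- \<beta>) * (t - \<tau>) powr (- s) \<le> \<tau> powr (- \<beta>) * (t / 2) powr (- s)"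
          by (intro mult_left_mono) auto
        then show ?thesis unfolding m_def by (simp add: mult.commute add_increasing2)
      next
        case False
        then have "\<tau> powr (- \<beta>) \<le> (t / 2) powr (- \<beta>)" using t \<beta> by (intro powr_mono2') auto
        then have "\<tau> powr (- \<beta>) * (t - \<tau>) powr (- s) \<le> (t / 2) powr (- \<beta>) * (t - \<tau>) powr (- s)"
          by (intro mult_right_mono) auto
        then show ?thesis unfolding m_def by (simp add: add_increasing)
      qed
      then have "c * L * (\<tau> powr (- \<beta>) * (t - \<tau>) powr (- s)) \<le> c * L * m \<tau>"
        using c L by (intro mult_left_mono) auto
      then have le: "c * (L * \<tau> powr (- \<beta>)) * (t - \<tau>) powr (- s) \<le> c * L * m \<tau>"
        by (simp only: mult.assoc)
      show "weak_type q (c * L * m \<tau>) (eabs (conv (t - \<tau>) (f \<tau>)))"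
        by (rule weak_type_mono[OF w' _ le]) (use c Lt r in auto)
    qed
    have st: "t / 2 > 0" using t by simp
    have "(\<integral>\<^sup>+\<tau>\<in>I. ennreal (c * L * m \<tau>) \<partial>lborel) \<le>
       (\<integral>\<^sup>+\<tau>. ennreal (c * L * (t / 2) powr (- s)) * (ennreal (\<tau> powr (- \<beta>)) * indicator {0<..<t} \<tau>)
          + ennreal (c * L * (t / 2) powr (- \<beta>)) * (ennreal ((t - \<tau>) powr (- s)) * indicator {0<..<t} (t - \<tau>)) \<partial>lborel)"
    proof (rule nn_integral_mono)
      fix \<tau> :: real
      show "ennreal (c * L * m \<tau>) * indicator I \<tau> \<le>
          ennreal (c * L * (t / 2) powr (- s)) * (ennreal (\<tau> powr (- \<beta>)) * indicator {0<..<t} \<tau>)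
          + ennreal (c * L * (t / 2) powr (- \<beta>)) * (ennreal ((t - \<tau>) powr (- s)) * indicator {0<..<t} (t - \<tau>))"
      proof (cases "\<tau> \<in> I")
        case True
        then have \<tau>: "\<tau> \<in> {0<..<t}" "t - \<tau> \<in> {0<..<t}" using I by auto
        have "c * L * m \<tau> = c * L * (t / 2) powr (- s) * \<tau> powr (- \<beta>) + c * L * (t / 2) powr (- \<beta>) * (t - \<tau>) powr (- s)"
          unfolding m_def by (simp add: algebra_simps)
        then show ?thesis using \<tau> True c L by (simp add: ennreal_mult[symmetric] flip: ennreal_plus)
      qed simp
    qed
    also have "\<dots> = ennreal (c * L * (t / 2) powr (- s)) * (\<integral>\<^sup>+\<tau>. ennreal (\<tau> powr (- \<beta>)) * indicator {0<..<t} \<tau> \<partial>lborel)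
          + ennreal (c * L * (t / 2) powr (- \<beta>)) * (\<integral>\<^sup>+\<tau>. ennreal ((t - \<tau>) powr (- s)) * indicator {0<..<t} (t - \<tau>) \<partial>lborel)"
      by (subst nn_integral_add) (auto simp: nn_integral_cmult)
    also have "(\<integral>\<^sup>+\<tau>. ennreal ((t - \<tau>) powr (- s)) * indicator {0<..<t} (t - \<tau>) \<partial>lborel)
        = (\<integral>\<^sup>+\<sigma>. ennreal (\<sigma> powr (- s)) * indicator {0<..<t} \<sigma> \<partial>lborel)"
      by (rule nn_integral_lborel_reflect[of "\<lambda>\<sigma>. ennreal (\<sigma> powr (- s)) * indicator {0<..<t} \<sigma>" t]) measurable
    also have "\<dots> = ennreal (t powr (- s + 1) / (- s + 1))"
      using t s by (intro nn_integral_powr_head) auto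
    also have "(\<integral>\<^sup>+\<tau>. ennreal (\<tau> powr (- \<beta>)) * indicator {0<..<t} \<tau> \<partial>lborel) = ennreal (t powr (- \<beta> + 1) / (- \<beta> + 1))"
      using t \<beta> by (intro nn_integral_powr_head) auto
    also have "ennreal (c * L * (t / 2) powr (- s)) * ennreal (t powr (- \<beta> + 1) / (- \<beta> + 1))
        + ennreal (c * L * (t / 2) powr (- \<beta>)) * ennreal (t powr (- s + 1) / (- s + 1))
       = ennreal (c * L * (t / 2) powr (- s) * (t powr (- \<beta> + 1) / (- \<beta> + 1))
        + c * L * (t / 2) powr (- \<beta>) * (t powr (- s + 1) / (- s + 1)))"
      using c L \<beta> s by (simp add: ennreal_mult[symmetric] ennreal_plus[symmetric] del: ennreal_plus)
    also have "c * L * (t / 2) powr (- s) * (t powr (- \<beta> + 1) / (- \<beta> + 1))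
        + c * L * (t / 2) powr (- \<beta>) * (t powr (- s + 1) / (- s + 1))
      = c * (2 powr s / (1 - \<beta>) + 2 powr \<beta> / (1 - s)) * L * t powr (- \<delta>)"
    proof -
      have "(t / 2) powr (- s) = 2 powr s * t powr (- s)" "(t / 2) powr (- \<beta>) = 2 powr \<beta> * t powr (- \<beta>)"
        using t by (simp_all add: powr_divide powr_minus field_simps)
      moreover have "t powr (- s) * t powr (- \<beta> + 1) = t powr (- \<delta>)" "t powr (- \<beta>) * t powr (- s + 1) = t powr (- \<delta>)"
        using a unfolding s_def[symmetric] by (simp_all flip: powr_add add: algebra_simps)
      ultimately have p: "(t / 2) powr (- s) * t powr (- \<beta> + 1) = 2 powr s * t powr (- \<delta>)"
        "(t / 2) powr (- \<beta>) * t powr (- s + 1) = 2 powr \<beta> * t powr (- \<delta>)"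
        by (simp_all only: mult.assoc)
      have e: "c * L * (t / 2) powr (- s) * (t powr (- \<beta> + 1) / (- \<beta> + 1))
         = c * L * ((t / 2) powr (- s) * t powr (- \<beta> + 1)) / (1 - \<beta>)"
        "c * L * (t / 2) powr (- \<beta>) * (t powr (- s + 1) / (- s + 1))
         = c * L * ((t / 2) powr (- \<beta>) * t powr (- s + 1)) / (1 - s)"
        by simp_all
      show ?thesis unfolding e p by (simp add: algebra_simps)
    qed
    finally show "(\<integral>\<^sup>+\<tau>\<in>I. ennreal (c * L * m \<tau>) \<partial>lborel)
      \<le> ennreal (c * (2 powr s / (1 - \<beta>) + 2 powr \<beta> / (1 - s)) * L * t powr (- \<delta>))" .
    show "0 \<le> c * (2 powr s / (1 - \<beta>) + 2 powr \<beta> / (1 - s)) * L * t powr (- \<delta>)"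
      using c L \<beta> s by (intro mult_nonneg_nonneg add_nonneg_nonneg) auto
  qed measurable
  then show ?thesis unfolding c_def s_def .
qed

text \<open>For sources with the decay rate \<open>\<tau>\<^bsup>-\<beta>\<^esup>\<close>: the bound \<open>B\<close> is the one available at all times, and \<open>L\<close> is the better one
known from the time \<open>\<rho>t\<close> on.\<close>

definition layered_source :: "real \<Rightarrow> real \<Rightarrow> real \<Rightarrow> real \<Rightarrow> real \<Rightarrow> real \<Rightarrow> (real \<Rightarrow> real ^ 'n \<Rightarrow> real) \<Rightarrow> bool" where
  "layered_source r \<beta> \<rho> t B L f \<longleftrightarrow> admissible_source r t f \<and>
     (\<forall>\<tau>. 0 < \<tau> \<longrightarrow> \<tau> < \<rho> * t \<longrightarrow> weak_type r (B * \<tau> powr (- \<beta>)) (eabs (f \<tau>))) \<and>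
     (\<forall>\<tau>. \<rho> * t \<le> \<tau> \<longrightarrow> \<tau> < t \<longrightarrow> weak_type r (L * \<tau> powr (- \<beta>)) (eabs (f \<tau>)))"

text \<open>The constant in front of \<open>L\<close> does not depend on \<open>\<rho>\<close>. This lets smallness of the solutions be fixed first and
\<open>\<rho>\<close> be chosen afterwards, depending on \<open>L\<close>.\<close>

lemma duhamel_abs_bound:
  assumes r: "r > 1" "r \<le> q" and \<beta>: "0 \<le> \<beta>" "\<beta> < 1" and a: "d * (1 / r - 1 / q) + \<beta> = 1 + \<delta>"
    and alt: "d * (1 / r - 1 / q) < 1 \<or> (\<beta> = 0 \<and> \<delta> = 0)"
  shows "\<exists>K>0. \<forall>\<rho> t B L f. 0 < \<rho> \<longrightarrow> \<rho> \<le> 1 / 2 \<longrightarrow> t > 0 \<longrightarrow> B > 0 \<longrightarrow> L > 0 \<longrightarrow>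
     layered_source r \<beta> \<rho> t B L f \<longrightarrow>
     marcinkiewicz q (K * (\<rho> powr (1 - \<beta>) * B + L) * t powr (- \<delta>)) (duhamel_abs t f {0<..<t})"
proof -
  have q: "q > 1" using r by simp
  define c where "c = G * (r / (r - 1) + 1)"
  have c: "c > 0" unfolding c_def using G r by (intro mult_pos_pos add_pos_pos) auto
  obtain K2 where K2: "K2 > 0"
    "\<And>t L f I. t > 0 \<Longrightarrow> L > 0 \<Longrightarrow> admissible_source r t f \<Longrightarrow> I \<in> sets borel \<Longrightarrow> I \<subseteq> {0<..<t} \<Longrightarrow>
       (\<And>\<tau>. \<tau> \<in> I \<Longrightarrow> weak_type r (L * \<tau> powr (- \<beta>)) (eabs (f \<tau>))) \<Longrightarrow>
       marcinkiewicz q (K2 * L * t powr (- \<delta>)) (duhamel_abs t f I)"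
  proof (cases "d * (1 / r - 1 / q) < 1")
    case True
    let ?K = "q / (q - 1) * (c * (2 powr (d * (1 / r - 1 / q)) / (1 - \<beta>) + 2 powr \<beta> / (1 - d * (1 / r - 1 / q))))"
    show ?thesis
    proof (rule that[of ?K])
      show "?K > 0" using q c \<beta> True by (intro mult_pos_pos add_pos_pos divide_pos_pos) auto
      show "marcinkiewicz q (?K * L * t powr (- \<delta>)) (duhamel_abs t f I)"
        if "t > 0" "L > 0" "admissible_source r t f" "I \<in> sets borel" "I \<subseteq> {0<..<t}"
          "\<And>\<tau>. \<tau> \<in> I \<Longrightarrow> weak_type r (L * \<tau> powr (- \<beta>)) (eabs (f \<tau>))" for t L f I
        using duhamel_abs_late_subcritical[OF that(3) r that(1) \<beta> a True that(2,4,5,6)]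
        unfolding c_def by (simp only: mult.assoc)
    qed
  next
    case False
    then have z: "\<beta> = 0" "\<delta> = 0" using alt by auto
    let ?k = "(2 * (r / (r - 1) * c) * (2 * c * q / d) powr (q / d)) powr (r / q)"
    have k: "?k > 0" using r q c d by simp
    show ?thesis
    proof (rule that[of "q / (q - 1) * ?k"])
      show "q / (q - 1) * ?k > 0" using k q by (intro mult_pos_pos) auto
      show "marcinkiewicz q (q / (q - 1) * ?k * L * t powr (- \<delta>)) (duhamel_abs t f I)"
        if t: "t > 0" and L: "L > 0" and f: "admissible_source r t f" and I: "I \<in> sets borel" "I \<subseteq> {0<..<t}"
          and w: "\<And>\<tau>. \<tau> \<in> I \<Longrightarrow> weak_type r (L * \<tau> powr (- \<beta>)) (eabs (f \<tau>))" for t L f I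
      proof -
        have crit: "d * (1 / r - 1 / q) = 1" using a z by simp
        have "weak_type r L (eabs (f \<tau>))" if "\<tau> \<in> I" for \<tau>
        proof -
          have "\<tau> > 0" using that I by auto
          then show ?thesis using w[OF that] by (simp add: z)
        qed
        from duhamel_abs_critical[OF f r(1) q crit L I this]
        have "weak_type q (?k * L) (duhamel_abs t f I)" unfolding c_def .
        then have "marcinkiewicz q (q / (q - 1) * (?k * L)) (duhamel_abs t f I)"
          using k L by (intro marcinkiewicz_of_weak_type q) (auto intro: mult_pos_pos)
        then show ?thesis using t by (simp add: z mult.assoc)
      qed
    qed
  qed
  define K1 where "K1 = q / (q - 1) * (c * 2 powr (d * (1 / r - 1 / q)) / (1 - \<beta>))"
  have K1: "K1 > 0" unfolding K1_def using q c \<beta> by simp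
  show ?thesis
  proof (intro exI[of _ "K1 + K2"] conjI allI impI)
    show "K1 + K2 > 0" using K1 K2(1) by simp
    fix \<rho> t B L :: real and f
    assume \<rho>: "0 < \<rho>" "\<rho> \<le> 1 / 2" and t: "t > 0" and B: "B > 0" and L: "L > 0"
      and src: "layered_source r \<beta> \<rho> t B L f"
    have f: "admissible_source r t f"
      and w1: "0 < \<tau> \<Longrightarrow> \<tau> < \<rho> * t \<Longrightarrow> weak_type r (B * \<tau> powr (- \<beta>)) (eabs (f \<tau>))"
      and w2: "\<rho> * t \<le> \<tau> \<Longrightarrow> \<tau> < t \<Longrightarrow> weak_type r (L * \<tau> powr (- \<beta>)) (eabs (f \<tau>))" for \<tau>
      using src unfolding layered_source_def by auto
    have \<rho>t: "0 < \<rho> * t" "\<rho> * t < t" using \<rho> t by auto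
    let ?I = "{0<..<\<rho> * t}" and ?J = "{\<rho> * t..<t}"
    have IJ: "?I \<union> ?J = {0<..<t}" using \<rho>t by auto
    have m1: "marcinkiewicz q (K1 * (\<rho> powr (1 - \<beta>) * B) * t powr (- \<delta>)) (duhamel_abs t f ?I)"
      using duhamel_abs_early[OF f r t \<beta>(2) a B \<rho>] w1 unfolding K1_def c_def by (simp add: mult.assoc)
    have m2: "marcinkiewicz q (K2 * L * t powr (- \<delta>)) (duhamel_abs t f ?J)"
      using w2 \<rho>t by (intro K2(2) t L f) auto
    have "marcinkiewicz q (K1 * (\<rho> powr (1 - \<beta>) * B) * t powr (- \<delta>) + K2 * L * t powr (- \<delta>))
        (\<lambda>x. duhamel_abs t f ?I x + duhamel_abs t f ?J x)"
      using K1 K2(1) B L by (intro marcinkiewicz_add m1 m2) auto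
    then have "marcinkiewicz q (K1 * (\<rho> powr (1 - \<beta>) * B) * t powr (- \<delta>) + K2 * L * t powr (- \<delta>))
        (duhamel_abs t f {0<..<t})"
    proof (rule marcinkiewicz_mono_AE)
      show "duhamel_abs t f {0<..<t} \<in> borel_measurable lebesgue"
        by (rule duhamel_abs_measurable[OF f r(1)]) auto
      show "AE x in lebesgue. duhamel_abs t f {0<..<t} x \<le> duhamel_abs t f ?I x + duhamel_abs t f ?J x"
      proof -
        have "?I \<inter> ?J = {}" by auto
        then have "AE x in lebesgue. duhamel_abs t f {0<..<t} x = duhamel_abs t f ?I x + duhamel_abs t f ?J x"
          using duhamel_abs_split[OF f r(1), of ?I ?J] unfolding IJ by simp
        then show ?thesis by (rule eventually_mono) simp
      qed
    qed
    moreover have "K1 * (\<rho> powr (1 - \<beta>) * B) * t powr (- \<delta>) + K2 * L * t powr (- \<delta>)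
        \<le> (K1 + K2) * (\<rho> powr (1 - \<beta>) * B + L) * t powr (- \<delta>)"
    proof -
      have "0 \<le> K2 * (\<rho> powr (1 - \<beta>) * B) * t powr (- \<delta>) + K1 * L * t powr (- \<delta>)"
        using K1 K2(1) B L by (intro add_nonneg_nonneg mult_nonneg_nonneg) auto
      then show ?thesis by (simp add: algebra_simps)
    qed
    ultimately show "marcinkiewicz q ((K1 + K2) * (\<rho> powr (1 - \<beta>) * B + L) * t powr (- \<delta>)) (duhamel_abs t f {0<..<t})"
      by (rule marcinkiewicz_mono)
  qed
qed

end

section \<open>Asymptotic stability\<close>

lemma contraction_iteration:
  fixes e :: "real \<Rightarrow> ennreal"
  assumes B: "B > 0" and bound: "\<And>t. t > 0 \<Longrightarrow> e t \<le> ennreal B"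
    and step: "\<And>L T. 0 < L \<Longrightarrow> L \<le> B \<Longrightarrow> T > 0 \<Longrightarrow> (\<And>t. t \<ge> T \<Longrightarrow> e t \<le> ennreal L) \<Longrightarrow>
       \<exists>T'>0. \<forall>t\<ge>T'. e t \<le> ennreal (3 / 4 * L)"
  shows "(e \<longlongrightarrow> 0) at_top"
proof -
  have it: "\<exists>T>0. \<forall>t\<ge>T. e t \<le> ennreal ((3 / 4) ^ k * B)" for k
  proof (induction k)
    case 0
    show ?case using bound by (intro exI[of _ 1]) auto
  next
    case (Suc k)
    then obtain T where T: "T > 0" "\<And>t. t \<ge> T \<Longrightarrow> e t \<le> ennreal ((3 / 4) ^ k * B)" by blast
    have "(3 / 4) ^ k * B \<le> 1 * B" using B by (intro mult_right_mono power_le_one) auto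
    with step[OF _ _ T] B show ?case by (simp add: mult.assoc)
  qed
  show ?thesis
  proof (rule order_tendstoI)
    fix a :: ennreal assume "0 < a"
    then obtain x where x: "x > 0" "ennreal x \<le> a"
    proof (cases a)
      case (real r)
      then show ?thesis using \<open>0 < a\<close> that[of r] by simp
    next
      case top
      then show ?thesis using that[of 1] by simp
    qed
    have "(\<lambda>k. (3 / 4) ^ k * B) \<longlonglongrightarrow> 0 * B"
      by (intro tendsto_mult_right LIMSEQ_power_zero) simp
    then have "\<forall>\<^sub>F k in sequentially. (3 / 4) ^ k * B < x"
      using x(1) by (intro order_tendstoD(2)) auto
    then obtain k where k: "(3 / 4) ^ k * B < x" by (auto simp: eventually_sequentially)
    obtain T where T: "T > 0" "\<forall>t\<ge>T. e t \<le> ennreal ((3 / 4) ^ k * B)" using it by blast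
    have "e t < a" if "t \<ge> T" for t
    proof -
      have "e t \<le> ennreal ((3 / 4) ^ k * B)" using T(2) that by blast
      also have "\<dots> < ennreal x" using k x(1) by (intro ennreal_lessI) auto
      finally show ?thesis using x(2) by simp
    qed
    then show "\<forall>\<^sub>F t in at_top. e t < a" unfolding eventually_at_top_linorder by blast
  qed simp
qed

lemma power_lipschitz_continuous:
  fixes F :: "real \<Rightarrow> real"
  assumes p: "p > 1"
    and F: "\<And>a b. \<bar>F a - F b\<bar> \<le> C * \<bar>a - b\<bar> * (\<bar>a\<bar> powr (p - 1) + \<bar>b\<bar> powr (p - 1))"
  shows "continuous_on UNIV F"
  unfolding continuous_on_eq_continuous_at[OF open_UNIV] isCont_def
proof
  fix b :: real
  have "((\<lambda>a. C * \<bar>a - b\<bar> * (\<bar>a\<bar> powr (p - 1) + \<bar>b\<bar> powr (p - 1))) \<longlongrightarrow>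
      C * \<bar>b - b\<bar> * (\<bar>b\<bar> powr (p - 1) + \<bar>b\<bar> powr (p - 1))) (at b)"
    using p by (intro tendsto_intros tendsto_powr') auto
  then have "((\<lambda>a. F a - F b) \<longlongrightarrow> 0) (at b)"
    by (intro Lim_null_comparison[of "\<lambda>a. F a - F b" "\<lambda>a. C * \<bar>a - b\<bar> * (\<bar>a\<bar> powr (p - 1) + \<bar>b\<bar> powr (p - 1))"])
       (auto simp: F)
  then show "F \<midarrow>b\<rightarrow> F b" by (simp add: LIM_zero_iff)
qed

lemma nonlinearity_measurable:
  assumes "continuous_on UNIV F" and [measurable]: "u \<in> borel_measurable lebesgue"
  shows "nonlinearity \<alpha> F u \<in> borel_measurable lebesgue"
proof -
  have [measurable]: "F \<in> borel_measurable borel" by (rule borel_measurable_continuous_onI[OF assms(1)])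
  have [measurable]: "(\<lambda>y::real ^ 'n. norm y powr (- \<alpha>)) \<in> borel_measurable lebesgue"
    by (rule measurable_completion) measurable
  show ?thesis unfolding nonlinearity_def[abs_def] by measurable
qed

lemma nonlinearity_diff_weak_type:
  fixes F :: "real \<Rightarrow> real"
  assumes p: "p > 1" and q: "q > 0" and \<alpha>: "\<alpha> > 0" and C: "C > 0"
    and r: "r > 0" "1 / r = p / q + \<alpha> / real CARD('n)"
    and F: "\<And>a b. \<bar>F a - F b\<bar> \<le> C * \<bar>a - b\<bar> * (\<bar>a\<bar> powr (p - 1) + \<bar>b\<bar> powr (p - 1))"
  shows "\<exists>c>0. \<forall>(u :: real ^ 'n \<Rightarrow> real) v M L. u \<in> borel_measurable lebesgue \<longrightarrow> v \<in> borel_measurable lebesgue \<longrightarrow>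
     M > 0 \<longrightarrow> L > 0 \<longrightarrow>
     weak_type q M (eabs u) \<longrightarrow> weak_type q M (eabs v) \<longrightarrow>
     weak_type q L (\<lambda>x. ennreal \<bar>u x - v x\<bar>) \<longrightarrow>
     weak_type r (c * M powr (p - 1) * L) (\<lambda>x. ennreal \<bar>nonlinearity \<alpha> F u x - nonlinearity \<alpha> F v x\<bar>)"
proof -
  let ?n = "real CARD('n)"
  obtain V where V: "V > 0" "weak_type (?n / \<alpha>) V (\<lambda>x::real ^ 'n. ennreal (norm x powr (- \<alpha>)))"
    using weak_type_norm_powr[OF \<alpha>] by blast
  let ?a = "q / (p - 1)"
  define c1 where "c1 = 2 * 2 powr (1 / ?a)"
  define c2 where "c2 = 2 powr (1 / (q / p))"
  define c3 where "c3 = 2 powr (1 / r)"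
  have a: "?a > 0" using p q by simp
  have cpos: "c1 > 0" "c2 > 0" "c3 > 0" by (auto simp: c1_def c2_def c3_def)
  show ?thesis
  proof (intro exI[of _ "C * (c3 * (V * (c2 * c1)))"] conjI allI impI)
    show "C * (c3 * (V * (c2 * c1))) > 0" using C V cpos by simp
    fix u v :: "real ^ 'n \<Rightarrow> real" and M L :: real
    assume um [measurable]: "u \<in> borel_measurable lebesgue" and vm [measurable]: "v \<in> borel_measurable lebesgue"
      and M: "M > 0" and L: "L > 0"
      and u: "weak_type q M (eabs u)" and v: "weak_type q M (eabs v)"
      and uv: "weak_type q L (\<lambda>x. ennreal \<bar>u x - v x\<bar>)"
    have Mp: "M powr (p - 1) > 0" using M by simp
    have 1: "weak_type ?a (c1 * M powr (p - 1)) (\<lambda>x. ennreal (\<bar>u x\<bar> powr (p - 1)) + ennreal (\<bar>v x\<bar> powr (p - 1)))"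
      unfolding c1_def using p q M
      by (intro weak_type_add weak_type_powr u v um vm) auto
    have 2: "weak_type (q / p) (c2 * (L * (c1 * M powr (p - 1))))
       (\<lambda>x. ennreal \<bar>u x - v x\<bar> * (ennreal (\<bar>u x\<bar> powr (p - 1)) + ennreal (\<bar>v x\<bar> powr (p - 1))))"
      unfolding c2_def
      by (rule weak_type_mult[OF uv 1]) (use L cpos Mp q p in \<open>auto simp: field_simps\<close>)
    have 3: "weak_type r (c3 * (V * (c2 * (L * (c1 * M powr (p - 1))))))
       (\<lambda>x. ennreal (norm x powr (- \<alpha>)) * (ennreal \<bar>u x - v x\<bar> * (ennreal (\<bar>u x\<bar> powr (p - 1)) + ennreal (\<bar>v x\<bar> powr (p - 1)))))"
      unfolding c3_def
      by (rule weak_type_mult[OF V(2) 2]) (use L V(1) cpos Mp q p \<alpha> r in auto)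
    have 4: "weak_type r (C * (c3 * (V * (c2 * (L * (c1 * M powr (p - 1)))))))
       (\<lambda>x. ennreal C * (ennreal (norm x powr (- \<alpha>)) * (ennreal \<bar>u x - v x\<bar> * (ennreal (\<bar>u x\<bar> powr (p - 1)) + ennreal (\<bar>v x\<bar> powr (p - 1))))))"
      by (rule weak_type_cmult[OF 3 C])
    have cF: "continuous_on UNIV F" by (rule power_lipschitz_continuous[OF p F])
    have "weak_type r (C * (c3 * (V * (c2 * (L * (c1 * M powr (p - 1)))))))
       (\<lambda>x. ennreal \<bar>nonlinearity \<alpha> F u x - nonlinearity \<alpha> F v x\<bar>)"
    proof (rule weak_type_mono_AE[OF 4])
      note [measurable] = nonlinearity_measurable[OF cF um] nonlinearity_measurable[OF cF vm]
      show "(\<lambda>x. ennreal \<bar>nonlinearity \<alpha> F u x - nonlinearity \<alpha> F v x\<bar>) \<in> borel_measurable lebesgue"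
        by measurable
      show "AE x in lebesgue. ennreal \<bar>nonlinearity \<alpha> F u x - nonlinearity \<alpha> F v x\<bar> \<le>
         ennreal C * (ennreal (norm x powr (- \<alpha>)) * (ennreal \<bar>u x - v x\<bar> * (ennreal (\<bar>u x\<bar> powr (p - 1)) + ennreal (\<bar>v x\<bar> powr (p - 1)))))"
      proof (intro AE_I2)
        fix x
        have "\<bar>nonlinearity \<alpha> F u x - nonlinearity \<alpha> F v x\<bar> = norm x powr (- \<alpha>) * \<bar>F (u x) - F (v x)\<bar>"
          unfolding nonlinearity_def right_diff_distrib[symmetric] abs_mult by simp
        also have "\<dots> \<le> norm x powr (- \<alpha>) * (C * \<bar>u x - v x\<bar> * (\<bar>u x\<bar> powr (p - 1) + \<bar>v x\<bar> powr (p - 1)))"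
          by (intro mult_left_mono F) auto
        also have "\<dots> = C * (norm x powr (- \<alpha>) * (\<bar>u x - v x\<bar> * (\<bar>u x\<bar> powr (p - 1) + \<bar>v x\<bar> powr (p - 1))))"
          by (simp add: mult_ac)
        finally have "ennreal \<bar>nonlinearity \<alpha> F u x - nonlinearity \<alpha> F v x\<bar>
          \<le> ennreal (C * (norm x powr (- \<alpha>) * (\<bar>u x - v x\<bar> * (\<bar>u x\<bar> powr (p - 1) + \<bar>v x\<bar> powr (p - 1)))))"
          by (rule ennreal_leI)
        also have "\<dots> = ennreal C * (ennreal (norm x powr (- \<alpha>)) * (ennreal \<bar>u x - v x\<bar> * (ennreal (\<bar>u x\<bar> powr (p - 1)) + ennreal (\<bar>v x\<bar> powr (p - 1)))))"
          using C by (simp add: ennreal_mult)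
        finally show "ennreal \<bar>nonlinearity \<alpha> F u x - nonlinearity \<alpha> F v x\<bar> \<le>
         ennreal C * (ennreal (norm x powr (- \<alpha>)) * (ennreal \<bar>u x - v x\<bar> * (ennreal (\<bar>u x\<bar> powr (p - 1)) + ennreal (\<bar>v x\<bar> powr (p - 1)))))" .
      qed
    qed
    then show "weak_type r (C * (c3 * (V * (c2 * c1))) * M powr (p - 1) * L)
       (\<lambda>x. ennreal \<bar>nonlinearity \<alpha> F u x - nonlinearity \<alpha> F v x\<bar>)"
      by (simp add: mult_ac)
  qed
qed

text \<open>Subtracting the two integral equations. The separate bounds on \<open>fu\<close> and \<open>fv\<close> are there to make both
convolutions converge at every point, so that they may be subtracted.\<close>

lemma (in kernel_family) mild_difference:
  assumes r: "r > 1" "q0 > 1" and t: "t > 0"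
    and u0: "u0 \<in> borel_measurable lebesgue" "weak_type q0 A0 (eabs u0)"
    and v0: "v0 \<in> borel_measurable lebesgue" "weak_type q0 A0 (eabs v0)" and A0: "A0 > 0"
    and fu: "\<And>\<tau>. \<tau> \<in> {0<..<t} \<Longrightarrow> fu \<tau> \<in> borel_measurable lebesgue \<and> (\<exists>A>0. weak_type r A (eabs (fu \<tau>)))"
    and fv: "\<And>\<tau>. \<tau> \<in> {0<..<t} \<Longrightarrow> fv \<tau> \<in> borel_measurable lebesgue \<and> (\<exists>A>0. weak_type r A (eabs (fv \<tau>)))"
    and w: "\<And>\<tau>. \<tau> \<in> {0<..<t} \<Longrightarrow> \<exists>A>0. weak_type r A (\<lambda>x. ennreal \<bar>fu \<tau> x - fv \<tau> x\<bar>)"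
    and u: "AE x in lebesgue. set_integrable lborel {0<..<t} (\<lambda>\<tau>. conv (t - \<tau>) (fu \<tau>) x) \<and>
        u x = conv t u0 x + (LINT \<tau>:{0<..<t}|lborel. conv (t - \<tau>) (fu \<tau>) x)"
    and v: "AE x in lebesgue. set_integrable lborel {0<..<t} (\<lambda>\<tau>. conv (t - \<tau>) (fv \<tau>) x) \<and>
        v x = conv t v0 x + (LINT \<tau>:{0<..<t}|lborel. conv (t - \<tau>) (fv \<tau>) x)"
  shows "admissible_source r t (\<lambda>\<tau> x. fu \<tau> x - fv \<tau> x)"
    and "AE x in lebesgue. ennreal \<bar>u x - v x\<bar> \<le> ennreal \<bar>conv t (\<lambda>x. u0 x - v0 x) x\<bar>
        + duhamel_abs t (\<lambda>\<tau> x. fu \<tau> x - fv \<tau> x) {0<..<t} x"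
proof -
  let ?f = "\<lambda>\<tau> x. fu \<tau> x - fv \<tau> x"
  have cd: "conv (t - \<tau>) (?f \<tau>) x = conv (t - \<tau>) (fu \<tau>) x - conv (t - \<tau>) (fv \<tau>) x" if \<tau>: "\<tau> \<in> {0<..<t}" for \<tau> x
  proof -
    obtain A where A: "A > 0" "weak_type r A (eabs (fu \<tau>))" using fu[OF \<tau>] by blast
    obtain B where B: "B > 0" "weak_type r B (eabs (fv \<tau>))" using fv[OF \<tau>] by blast
    show ?thesis
      by (rule conv_diff[OF _ r(1) A(2) _ A(1) B(2) _ B(1)]) (use \<tau> fu[OF \<tau>] fv[OF \<tau>] in auto)
  qed
  have ind: "indicator {0<..<t} \<tau> * conv (t - \<tau>) (?f \<tau>) x =
      indicator {0<..<t} \<tau> *\<^sub>R conv (t - \<tau>) (fu \<tau>) x - indicator {0<..<t} \<tau> *\<^sub>R conv (t - \<tau>) (fv \<tau>) x" for \<tau> x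
    using cd[of \<tau> x] by (cases "\<tau> \<in> {0<..<t}") auto
  have u': "AE x in lborel. set_integrable lborel {0<..<t} (\<lambda>\<tau>. conv (t - \<tau>) (fu \<tau>) x)"
    using u unfolding AE_completion_iff by (rule eventually_mono) blast
  have v': "AE x in lborel. set_integrable lborel {0<..<t} (\<lambda>\<tau>. conv (t - \<tau>) (fv \<tau>) x)"
    using v unfolding AE_completion_iff by (rule eventually_mono) blast
  show "admissible_source r t ?f"
    unfolding admissible_source_def
  proof (intro conjI ballI)
    show "(\<lambda>x. fu \<tau> x - fv \<tau> x) \<in> borel_measurable lebesgue" if "\<tau> \<in> {0<..<t}" for \<tau>
      using fu[OF that] fv[OF that] by (intro borel_measurable_diff) auto
    show "\<exists>A>0. weak_type r A (\<lambda>x. ennreal \<bar>fu \<tau> x - fv \<tau> x\<bar>)" if "\<tau> \<in> {0<..<t}" for \<tau> by (rule w[OF that])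
    show "AE x in lborel. (\<lambda>\<tau>. indicator {0<..<t} \<tau> * conv (t - \<tau>) (?f \<tau>) x) \<in> borel_measurable borel"
      using u' v'
    proof eventually_elim
      case (elim x)
      have "(\<lambda>\<tau>. indicator {0<..<t} \<tau> *\<^sub>R conv (t - \<tau>) (fu \<tau>) x) \<in> borel_measurable borel"
        "(\<lambda>\<tau>. indicator {0<..<t} \<tau> *\<^sub>R conv (t - \<tau>) (fv \<tau>) x) \<in> borel_measurable borel"
        using elim[unfolded set_integrable_def, THEN borel_measurable_integrable] by simp_all
      then show ?case unfolding ind by (rule borel_measurable_diff)
    qed
  qed
  show "AE x in lebesgue. ennreal \<bar>u x - v x\<bar> \<le> ennreal \<bar>conv t (\<lambda>x. u0 x - v0 x) x\<bar> + duhamel_abs t ?f {0<..<t} x"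
    using u v
  proof eventually_elim
    case (elim x)
    let ?F = "\<lambda>\<tau>. indicator {0<..<t} \<tau> * conv (t - \<tau>) (?f \<tau>) x"
    have int: "integrable lborel ?F"
      unfolding ind using elim unfolding set_integrable_def by (intro Bochner_Integration.integrable_diff) auto
    have eq: "u x - v x = conv t (\<lambda>x. u0 x - v0 x) x + (\<integral>\<tau>. ?F \<tau> \<partial>lborel)"
    proof -
      have "(\<integral>\<tau>. ?F \<tau> \<partial>lborel) = (LINT \<tau>:{0<..<t}|lborel. conv (t - \<tau>) (fu \<tau>) x) - (LINT \<tau>:{0<..<t}|lborel. conv (t - \<tau>) (fv \<tau>) x)"
        unfolding ind set_lebesgue_integral_def using elim unfolding set_integrable_def
        by (intro Bochner_Integration.integral_diff) auto
      moreover have "conv t (\<lambda>x. u0 x - v0 x) x = conv t u0 x - conv t v0 x"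
        by (rule conv_diff[OF t r(2) u0(2,1) A0 v0(2,1) A0])
      ultimately show ?thesis using elim by simp
    qed
    have "ennreal \<bar>u x - v x\<bar> \<le> ennreal (\<bar>conv t (\<lambda>x. u0 x - v0 x) x\<bar> + \<bar>\<integral>\<tau>. ?F \<tau> \<partial>lborel\<bar>)"
      unfolding eq by (intro ennreal_leI abs_triangle_ineq)
    also have "\<dots> = ennreal \<bar>conv t (\<lambda>x. u0 x - v0 x) x\<bar> + ennreal \<bar>\<integral>\<tau>. ?F \<tau> \<partial>lborel\<bar>"
      by simp
    also have "ennreal \<bar>\<integral>\<tau>. ?F \<tau> \<partial>lborel\<bar> \<le> (\<integral>\<^sup>+\<tau>. ennreal \<bar>?F \<tau>\<bar> \<partial>lborel)"
      using integral_norm_bound_ennreal[OF int] by simp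
    also have "\<dots> = duhamel_abs t ?f {0<..<t} x"
      unfolding duhamel_abs_def
    proof (rule nn_integral_cong)
      fix \<tau> :: real
      show "ennreal \<bar>?F \<tau>\<bar> = ennreal \<bar>conv (t - \<tau>) (?f \<tau>) x\<bar> * indicator {0<..<t} \<tau>"
        by (cases "\<tau> \<in> {0<..<t}") simp_all
    qed
    finally show ?case by (simp add: add_left_mono)
  qed
qed

lemma weak_norm_rescale:
  assumes t: "t > 0"
  shows "weak_norm q w \<le> ennreal (L * t powr (- \<delta>)) \<longleftrightarrow> ennreal (t powr \<delta>) * weak_norm q w \<le> ennreal L"
proof -
  have 1: "ennreal (t powr \<delta>) * ennreal (t powr (- \<delta>)) = 1"
    using t by (simp add: ennreal_mult[symmetric] flip: powr_add)
  have 2: "ennreal (L * t powr (- \<delta>)) = ennreal (t powr (- \<delta>)) * ennreal L"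
    by (simp add: ennreal_mult'' mult.commute)
  show ?thesis
  proof
    assume "weak_norm q w \<le> ennreal (L * t powr (- \<delta>))"
    then have "ennreal (t powr \<delta>) * weak_norm q w \<le> ennreal (t powr \<delta>) * (ennreal (t powr (- \<delta>)) * ennreal L)"
      unfolding 2 by (rule mult_left_mono) simp
    then show "ennreal (t powr \<delta>) * weak_norm q w \<le> ennreal L"
      by (simp only: mult.assoc[symmetric] 1 mult_1)
  next
    assume "ennreal (t powr \<delta>) * weak_norm q w \<le> ennreal L"
    then have "ennreal (t powr (- \<delta>)) * (ennreal (t powr \<delta>) * weak_norm q w) \<le> ennreal (t powr (- \<delta>)) * ennreal L"
      by (rule mult_left_mono) simp
    then show "weak_norm q w \<le> ennreal (L * t powr (- \<delta>))"
      unfolding 2 by (simp only: mult.assoc[symmetric] 1 mult.commute[of "ennreal (t powr (- \<delta>))" "ennreal (t powr \<delta>)"] mult_1)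
  qed
qed

text \<open>Membership of the data in some weak space, with an exponent unrelated to \<open>q\<close>, makes the linear
evolution of each of them converge at every point.\<close>

definition small_mild_pair ::
    "real \<Rightarrow> real \<Rightarrow> (real \<Rightarrow> real) \<Rightarrow> real \<Rightarrow> real \<Rightarrow> real \<Rightarrow> (real ^ 'n \<Rightarrow> real) \<Rightarrow> (real ^ 'n \<Rightarrow> real) \<Rightarrow>
     (real \<Rightarrow> real ^ 'n \<Rightarrow> real) \<Rightarrow> (real \<Rightarrow> real ^ 'n \<Rightarrow> real) \<Rightarrow> bool" where
  "small_mild_pair m \<alpha> F q \<delta> M u0 v0 u v \<longleftrightarrow>
     (\<exists>q0 A0. q0 > 1 \<and> A0 > 0 \<and> (\<forall>w\<in>{u0, v0}. w \<in> borel_measurable lebesgue \<and> weak_type q0 A0 (eabs w))) \<and>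
     (\<forall>w\<in>{u, v}. \<forall>t>0. w t \<in> borel_measurable lebesgue \<and> weak_type q (M * t powr (- \<delta>)) (eabs (w t))) \<and>
     mild_solution m \<alpha> F u0 u \<and> mild_solution m \<alpha> F v0 v"

text \<open>The exponents \<open>q\<close>, \<open>r\<close> and \<open>\<delta>\<close> are tied by scaling only, so that the critical statement (\<open>\<delta> = 0\<close>) and the
subcritical one are both instances.\<close>

lemma mild_solutions_asymptotic:
  fixes F :: "real \<Rightarrow> real"
  assumes m: "(0 < m \<and> m < 1) \<or> (m \<in> \<nat> \<and> 0 < m)"
    and p: "p > 1" and \<alpha>: "\<alpha> > 0" and C: "C > 0" and F0: "F 0 = 0"
    and F: "\<And>a b. \<bar>F a - F b\<bar> \<le> C * \<bar>a - b\<bar> * (\<bar>a\<bar> powr (p - 1) + \<bar>b\<bar> powr (p - 1))"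
    and r: "r > 1" "r \<le> q" "1 / r = p / q + \<alpha> / real CARD('n)"
    and \<delta>: "\<delta> \<ge> 0" "\<delta> * p < 1"
    and scaling: "real CARD('n) / (2 * m) * (1 / r - 1 / q) + \<delta> * p = 1 + \<delta>"
    and alt: "real CARD('n) / (2 * m) * (1 / r - 1 / q) < 1 \<or> \<delta> = 0"
  shows "\<exists>M0>0. \<forall>M (u0 :: real ^ 'n \<Rightarrow> real) v0 u v. 0 < M \<longrightarrow> M \<le> M0 \<longrightarrow> small_mild_pair m \<alpha> F q \<delta> M u0 v0 u v \<longrightarrow>
     ((\<lambda>t. ennreal (t powr \<delta>) * weak_norm q (heat m t (\<lambda>x. u0 x - v0 x))) \<longlongrightarrow> 0) at_top \<longrightarrow>
     ((\<lambda>t. ennreal (t powr \<delta>) * weak_norm q (\<lambda>x. u t x - v t x)) \<longlongrightarrow> 0) at_top"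
proof -
  have m0: "m > 0" using m by auto
  let ?d = "real CARD('n) / (2 * m)"
  obtain G where G: "G > 0" "\<And>t x. t > 0 \<Longrightarrow> \<bar>heat_kernel m t (x :: real ^ 'n)\<bar> \<le> G * t powr (- ?d)"
    "\<And>t. t > 0 \<Longrightarrow> (\<integral>\<^sup>+x. ennreal \<bar>heat_kernel m t (x :: real ^ 'n)\<bar> \<partial>lborel) \<le> ennreal G"
    using heat_kernel_bounds[OF m, where 'n='n] by blast
  interpret K: kernel_family "heat_kernel m :: real \<Rightarrow> real ^ 'n \<Rightarrow> real" G ?d
    by unfold_locales (use G m0 continuous_heat_kernel[OF m0] in auto)
  have heat: "heat m t = K.conv t" for t
    by (rule ext)+ (simp add: heat_def K.conv_def)
  have q: "q > 1" using r by simp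
  define cq where "cq = q / (q - 1)"
  have cq: "cq > 0" using q by (simp add: cq_def)
  have \<beta>: "0 \<le> \<delta> * p" using \<delta> p by simp
  have alt': "?d * (1 / r - 1 / q) < 1 \<or> (\<delta> * p = 0 \<and> \<delta> = 0)" using alt by auto
  obtain K where K: "K > 0" "\<And>\<rho> t B L f. 0 < \<rho> \<Longrightarrow> \<rho> \<le> 1 / 2 \<Longrightarrow> t > 0 \<Longrightarrow> B > 0 \<Longrightarrow> L > 0 \<Longrightarrow>
     K.layered_source r (\<delta> * p) \<rho> t B L f \<Longrightarrow>
     marcinkiewicz q (K * (\<rho> powr (1 - \<delta> * p) * B + L) * t powr (- \<delta>)) (K.duhamel_abs t f {0<..<t})"
    using K.duhamel_abs_bound[OF r(1,2) \<beta> \<delta>(2) scaling alt'] by blast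
  have r0: "r > 0" "q > 0" using r by auto
  obtain c where c: "c > 0" "\<And>(u :: real ^ 'n \<Rightarrow> real) v M L. u \<in> borel_measurable lebesgue \<Longrightarrow> v \<in> borel_measurable lebesgue \<Longrightarrow>
     M > 0 \<Longrightarrow> L > 0 \<Longrightarrow>
     weak_type q M (eabs u) \<Longrightarrow> weak_type q M (eabs v) \<Longrightarrow>
     weak_type q L (\<lambda>x. ennreal \<bar>u x - v x\<bar>) \<Longrightarrow>
     weak_type r (c * M powr (p - 1) * L) (\<lambda>x. ennreal \<bar>nonlinearity \<alpha> F u x - nonlinearity \<alpha> F v x\<bar>)"
    using nonlinearity_diff_weak_type[OF p r0(2) \<alpha> C r0(1) r(3) F] by blast
  have contF: "continuous_on UNIV F" by (rule power_lipschitz_continuous[OF p F])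
  \<comment> \<open>the smallness condition is \<open>k M\<^bsup>p-1\<^esup> \<le> 1\<close>: the source then contributes at most half of its bound\<close>
  define k where "k = 2 * cq * K * c"
  have k: "k > 0" using cq K(1) c(1) by (simp add: k_def)
  show ?thesis
  proof (intro exI[of _ "(1 / k) powr (1 / (p - 1))"] conjI allI impI)
    show "0 < (1 / k) powr (1 / (p - 1))" using k by simp
    fix M and u0 v0 :: "real ^ 'n \<Rightarrow> real" and u v
    assume M: "0 < M" "M \<le> (1 / k) powr (1 / (p - 1))" and pair: "small_mild_pair m \<alpha> F q \<delta> M u0 v0 u v"
      and lin: "((\<lambda>t. ennreal (t powr \<delta>) * weak_norm q (heat m t (\<lambda>x. u0 x - v0 x))) \<longlongrightarrow> 0) at_top"
    obtain q0 A0 where q0: "q0 > 1" and A0: "A0 > 0"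
      and u0: "u0 \<in> borel_measurable lebesgue" "weak_type q0 A0 (eabs u0)"
      and v0: "v0 \<in> borel_measurable lebesgue" "weak_type q0 A0 (eabs v0)"
      using pair unfolding small_mild_pair_def by auto
    have mu: "mild_solution m \<alpha> F u0 u" and mv: "mild_solution m \<alpha> F v0 v"
      using pair unfolding small_mild_pair_def by auto
    let ?e = "\<lambda>t. ennreal (t powr \<delta>) * weak_norm q (\<lambda>x. u t x - v t x)"
    let ?f = "\<lambda>\<tau> x. nonlinearity \<alpha> F (u \<tau>) x - nonlinearity \<alpha> F (v \<tau>) x"
    have small: "cq * K * (c * M powr (p - 1)) \<le> 1 / 2"
    proof -
      have "M powr (p - 1) \<le> ((1 / k) powr (1 / (p - 1))) powr (p - 1)"
        using M p by (intro powr_mono2) auto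
      also have "\<dots> = 1 / k" using p k by (simp add: powr_powr)
      finally have "k * M powr (p - 1) \<le> 1" using k by (simp add: field_simps)
      then show ?thesis by (simp add: k_def mult_ac)
    qed
    have um: "u t \<in> borel_measurable lebesgue" and uw: "weak_type q (M * t powr (- \<delta>)) (eabs (u t))"
      and vm: "v t \<in> borel_measurable lebesgue" and vw: "weak_type q (M * t powr (- \<delta>)) (eabs (v t))"
      if "t > 0" for t using that pair unfolding small_mild_pair_def by auto
    define B where "B = cq * (2 * 2 powr (1 / q) * M)"
    have B: "B > 0" using cq M by (simp add: B_def)
    have wm: "(\<lambda>x. u t x - v t x) \<in> borel_measurable lebesgue" if "t > 0" for t
      using um[OF that] vm[OF that] by (rule borel_measurable_diff)
    have eB: "?e t \<le> ennreal B" if t: "t > 0" for t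
    proof -
      have "weak_type q (2 * 2 powr (1 / q) * (M * t powr (- \<delta>))) (\<lambda>x. ennreal \<bar>u t x\<bar> + ennreal \<bar>v t x\<bar>)"
        using M q by (intro weak_type_add uw vw t) auto
      then have "weak_type q (2 * 2 powr (1 / q) * (M * t powr (- \<delta>))) (\<lambda>x. ennreal \<bar>u t x - v t x\<bar>)"
      proof (rule weak_type_mono_AE)
        show "(\<lambda>x. ennreal \<bar>u t x - v t x\<bar>) \<in> borel_measurable lebesgue"
          using wm[OF t] by measurable
        show "AE x in lebesgue. ennreal \<bar>u t x - v t x\<bar> \<le> ennreal \<bar>u t x\<bar> + ennreal \<bar>v t x\<bar>"
          by (intro AE_I2) (simp flip: ennreal_plus add: ennreal_leI abs_triangle_ineq4)
      qed
      from weak_norm_of_weak_type[OF this q]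
      have "weak_norm q (\<lambda>x. u t x - v t x) \<le> ennreal (B * t powr (- \<delta>))"
        using M by (simp add: B_def cq_def mult_ac)
      then show ?thesis unfolding weak_norm_rescale[OF t] .
    qed
    have source: "weak_type r (c * M powr (p - 1) * L * \<tau> powr (- (\<delta> * p))) (eabs (?f \<tau>))"
      if \<tau>: "\<tau> > 0" and L: "L > 0" and e: "?e \<tau> \<le> ennreal L" for \<tau> L
    proof -
      have "weak_norm q (\<lambda>x. u \<tau> x - v \<tau> x) \<le> ennreal (L * \<tau> powr (- \<delta>))"
        using e unfolding weak_norm_rescale[OF \<tau>] .
      then have "weak_type q (L * \<tau> powr (- \<delta>)) (\<lambda>x. ennreal \<bar>u \<tau> x - v \<tau> x\<bar>)"
        using L q by (intro weak_type_of_weak_norm wm \<tau>) auto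
      then have "weak_type r (c * (M * \<tau> powr (- \<delta>)) powr (p - 1) * (L * \<tau> powr (- \<delta>))) (eabs (?f \<tau>))"
        using M \<tau> L by (intro c(2) um vm uw vw) auto
      moreover have "c * (M * \<tau> powr (- \<delta>)) powr (p - 1) * (L * \<tau> powr (- \<delta>))
          = c * M powr (p - 1) * L * \<tau> powr (- (\<delta> * p))"
      proof -
        have "(M * \<tau> powr (- \<delta>)) powr (p - 1) = M powr (p - 1) * \<tau> powr (- \<delta> * (p - 1))"
          by (simp add: powr_mult powr_powr)
        moreover have "\<tau> powr (- \<delta> * (p - 1)) * \<tau> powr (- \<delta>) = \<tau> powr (- (\<delta> * p))"
          by (simp add: algebra_simps flip: powr_add)
        ultimately show ?thesis by (simp add: mult_ac)
      qed
      ultimately show ?thesis by simp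
    qed
    \<comment> \<open>a single nonlinear term is the difference from the zero function, because \<open>F 0 = 0\<close>\<close>
    have N0: "nonlinearity \<alpha> F (\<lambda>_. 0) x = 0" for x :: "real ^ 'n" by (simp add: nonlinearity_def F0)
    have single: "\<exists>A>0. weak_type r A (eabs (nonlinearity \<alpha> F w))"
      if w: "w \<in> borel_measurable lebesgue" "weak_type q (M * \<tau> powr (- \<delta>)) (eabs w)" and \<tau>: "\<tau> > 0" for w :: "real ^ 'n \<Rightarrow> real" and \<tau>
    proof -
      let ?M = "M * \<tau> powr (- \<delta>)"
      have M': "?M > 0" using M \<tau> by simp
      have "weak_type q ?M (\<lambda>x::real ^ 'n. ennreal \<bar>0\<bar>)" by (simp add: weak_type_def)
      then have "weak_type r (c * ?M powr (p - 1) * ?M) (\<lambda>x. ennreal \<bar>nonlinearity \<alpha> F w x - nonlinearity \<alpha> F (\<lambda>_. 0) x\<bar>)"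
        using w M' by (intro c(2)) auto
      then have "weak_type r (c * ?M powr (p - 1) * ?M) (eabs (nonlinearity \<alpha> F w))" by (simp add: N0)
      moreover have "c * y powr (p - 1) * y > 0" if "y > 0" for y using that c(1) by simp
      then have "c * ?M powr (p - 1) * ?M > 0" using M' .
      ultimately show ?thesis by blast
    qed
    have weak_w: "\<exists>A>0. weak_type r A (eabs (?f \<tau>))" if \<tau>: "\<tau> > 0" for \<tau>
    proof -
      have "c * M powr (p - 1) * B * y > 0" if "y > 0" for y using that c(1) M B by simp
      moreover have "\<tau> powr (- (\<delta> * p)) > 0" using \<tau> by simp
      ultimately show ?thesis using source[OF \<tau> B eB[OF \<tau>]] by blast
    qed
    have mild: "AE x in lebesgue. set_integrable lborel {0<..<t} (\<lambda>\<tau>. K.conv (t - \<tau>) (nonlinearity \<alpha> F (w \<tau>)) x) \<and>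
        w t x = K.conv t w0 x + (LINT \<tau>:{0<..<t}|lborel. K.conv (t - \<tau>) (nonlinearity \<alpha> F (w \<tau>)) x)"
      if "mild_solution m \<alpha> F w0 w" "t > 0" for w0 w t
      using that unfolding mild_solution_def heat by blast
    have diff: "K.admissible_source r t ?f"
      "AE x in lebesgue. ennreal \<bar>u t x - v t x\<bar> \<le> ennreal \<bar>heat m t (\<lambda>x. u0 x - v0 x) x\<bar> + K.duhamel_abs t ?f {0<..<t} x"
      if t: "t > 0" for t
    proof -
      have fu: "nonlinearity \<alpha> F (u \<tau>) \<in> borel_measurable lebesgue \<and> (\<exists>A>0. weak_type r A (eabs (nonlinearity \<alpha> F (u \<tau>))))"
        and fv: "nonlinearity \<alpha> F (v \<tau>) \<in> borel_measurable lebesgue \<and> (\<exists>A>0. weak_type r A (eabs (nonlinearity \<alpha> F (v \<tau>))))"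
        and fw: "\<exists>A>0. weak_type r A (eabs (?f \<tau>))"
        if "\<tau> \<in> {0<..<t}" for \<tau>
      proof -
        have \<tau>: "\<tau> > 0" using that by simp
        show "nonlinearity \<alpha> F (u \<tau>) \<in> borel_measurable lebesgue \<and> (\<exists>A>0. weak_type r A (eabs (nonlinearity \<alpha> F (u \<tau>))))"
          by (intro conjI nonlinearity_measurable[OF contF um[OF \<tau>]] single[OF um[OF \<tau>] uw[OF \<tau>] \<tau>])
        show "nonlinearity \<alpha> F (v \<tau>) \<in> borel_measurable lebesgue \<and> (\<exists>A>0. weak_type r A (eabs (nonlinearity \<alpha> F (v \<tau>))))"
          by (intro conjI nonlinearity_measurable[OF contF vm[OF \<tau>]] single[OF vm[OF \<tau>] vw[OF \<tau>] \<tau>])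
        show "\<exists>A>0. weak_type r A (eabs (?f \<tau>))" by (rule weak_w[OF \<tau>])
      qed
      show "K.admissible_source r t ?f"
        "AE x in lebesgue. ennreal \<bar>u t x - v t x\<bar> \<le> ennreal \<bar>heat m t (\<lambda>x. u0 x - v0 x) x\<bar> + K.duhamel_abs t ?f {0<..<t} x"
        unfolding heat
        by (rule K.mild_difference[OF r(1) q0 t u0 v0 A0 fu fv fw mild[OF mu t] mild[OF mv t]], assumption+)+
    qed
    have heatm: "heat m t (\<lambda>x. u0 x - v0 x) \<in> borel_measurable lebesgue" if t: "t > 0" for t
    proof -
      have "K.conv t (\<lambda>x. u0 x - v0 x) = (\<lambda>x. K.conv t u0 x - K.conv t v0 x)"
        by (rule ext) (rule K.conv_diff[OF t q0 u0(2,1) A0 v0(2,1) A0])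
      moreover have "continuous_on UNIV (\<lambda>x. K.conv t u0 x - K.conv t v0 x)"
        by (intro continuous_on_diff K.conv_continuous[OF t _ _ q0 A0] u0 v0)
      ultimately show ?thesis unfolding heat
        by (intro measurable_completion) (simp add: borel_measurable_continuous_onI)
    qed
    show "(?e \<longlongrightarrow> 0) at_top"
    proof (rule contraction_iteration[OF B eB])
      fix L T :: real
      assume L: "0 < L" "L \<le> B" and T: "T > 0" and eL: "\<And>t. t \<ge> T \<Longrightarrow> ?e t \<le> ennreal L"
      let ?\<kappa> = "1 - \<delta> * p"
      have \<kappa>: "?\<kappa> > 0" using \<delta> by simp
      \<comment> \<open>with this \<open>\<rho>\<close> and the \<open>\<eta>\<close> below, the linear part contributes \<open>L / 8\<close>, the early times
        contribute at most \<open>L / 8\<close>, and the late times contribute at most \<open>L / 2\<close>\<close>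
      define \<rho> where "\<rho> = min (1 / 2) ((L / (4 * B)) powr (1 / ?\<kappa>))"
      have \<rho>: "0 < \<rho>" "\<rho> \<le> 1 / 2" using L B by (auto simp: \<rho>_def)
      have \<rho>B: "\<rho> powr ?\<kappa> * B \<le> L / 4"
      proof -
        have "\<rho> powr ?\<kappa> \<le> ((L / (4 * B)) powr (1 / ?\<kappa>)) powr ?\<kappa>"
          using \<rho> \<kappa> by (intro powr_mono2) (auto simp: \<rho>_def)
        also have "\<dots> = L / (4 * B)" using \<kappa> L B by (simp add: powr_powr)
        finally show ?thesis using B by (simp add: field_simps)
      qed
      define \<eta> where "\<eta> = L / (8 * cq * cq)"
      have \<eta>: "\<eta> > 0" using L cq by (simp add: \<eta>_def)
      have "\<forall>\<^sub>F t in at_top. ennreal (t powr \<delta>) * weak_norm q (heat m t (\<lambda>x. u0 x - v0 x)) < ennreal \<eta>"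
        using lin \<eta> by (intro order_tendstoD(2)) auto
      then obtain T1 where T1: "\<And>t. t \<ge> T1 \<Longrightarrow> ennreal (t powr \<delta>) * weak_norm q (heat m t (\<lambda>x. u0 x - v0 x)) < ennreal \<eta>"
        by (auto simp: eventually_at_top_linorder)
      show "\<exists>T'>0. \<forall>t\<ge>T'. ?e t \<le> ennreal (3 / 4 * L)"
      proof (intro exI[of _ "max (T / \<rho>) (max T1 1)"] conjI allI impI)
        show "0 < max (T / \<rho>) (max T1 1)" by simp
        fix t assume "max (T / \<rho>) (max T1 1) \<le> t"
        then have t: "T / \<rho> \<le> t" "T1 \<le> t" "0 < t" by auto
        have \<rho>t: "T \<le> \<rho> * t" using t(1) \<rho> by (simp add: field_simps)
        let ?B = "c * M powr (p - 1) * B" and ?L = "c * M powr (p - 1) * L"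
        have BL: "?B > 0" "?L > 0" using c(1) M B L by auto
        have mduh: "marcinkiewicz q (K * (\<rho> powr ?\<kappa> * ?B + ?L) * t powr (- \<delta>)) (K.duhamel_abs t ?f {0<..<t})"
        proof (rule K(2)[OF \<rho> t(3) BL])
          show "K.layered_source r (\<delta> * p) \<rho> t ?B ?L ?f"
            unfolding K.layered_source_def
          proof (intro conjI allI impI diff(1)[OF t(3)])
            show "weak_type r (?B * \<tau> powr (- (\<delta> * p))) (eabs (?f \<tau>))" if "0 < \<tau>" for \<tau>
              by (rule source[OF that B eB[OF that]])
            show "weak_type r (?L * \<tau> powr (- (\<delta> * p))) (eabs (?f \<tau>))" if "\<rho> * t \<le> \<tau>" for \<tau>
              using that \<rho>t T by (intro source L(1) eL) auto
          qed
        qed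
        have "weak_norm q (heat m t (\<lambda>x. u0 x - v0 x)) \<le> ennreal (\<eta> * t powr (- \<delta>))"
          using T1[OF t(2)] unfolding weak_norm_rescale[OF t(3)] by simp
        then have "weak_type q (\<eta> * t powr (- \<delta>)) (\<lambda>x. ennreal \<bar>heat m t (\<lambda>x. u0 x - v0 x) x\<bar>)"
          using \<eta> q by (intro weak_type_of_weak_norm heatm t(3)) auto
        then have mheat: "marcinkiewicz q (cq * (\<eta> * t powr (- \<delta>))) (\<lambda>x. ennreal \<bar>heat m t (\<lambda>x. u0 x - v0 x) x\<bar>)"
          unfolding cq_def using \<eta> t(3) by (intro marcinkiewicz_of_weak_type q) auto
        let ?X = "cq * (\<eta> * t powr (- \<delta>)) + K * (\<rho> powr ?\<kappa> * ?B + ?L) * t powr (- \<delta>)"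
        have Xnn: "0 \<le> cq * (\<eta> * t powr (- \<delta>))" "0 \<le> K * (\<rho> powr ?\<kappa> * ?B + ?L) * t powr (- \<delta>)"
          using cq \<eta> K(1) BL by (auto intro!: mult_nonneg_nonneg add_nonneg_nonneg)
        have "marcinkiewicz q ?X (\<lambda>x. ennreal \<bar>heat m t (\<lambda>x. u0 x - v0 x) x\<bar> + K.duhamel_abs t ?f {0<..<t} x)"
          by (intro marcinkiewicz_add mheat mduh Xnn)
        then have "marcinkiewicz q ?X (\<lambda>x. ennreal \<bar>u t x - v t x\<bar>)"
          by (rule marcinkiewicz_mono_AE[OF _ _ diff(2)[OF t(3)]]) (use wm[OF t(3)] in measurable)
        then have "weak_type q ?X (\<lambda>x. ennreal \<bar>u t x - v t x\<bar>)"
          using Xnn q by (intro weak_type_of_marcinkiewicz) auto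
        from weak_norm_of_weak_type[OF this q]
        have "weak_norm q (\<lambda>x. u t x - v t x) \<le> ennreal (cq * ?X)"
          using Xnn by (simp add: cq_def)
        also have "\<dots> \<le> ennreal (3 / 4 * L * t powr (- \<delta>))"
        proof (rule ennreal_leI)
          have "cq * ?X = (cq * cq * \<eta> + cq * K * (c * M powr (p - 1)) * (\<rho> powr ?\<kappa> * B + L)) * t powr (- \<delta>)"
            by (simp add: algebra_simps)
          also have "\<dots> \<le> (L / 8 + 1 / 2 * (L / 4 + L)) * t powr (- \<delta>)"
          proof (intro mult_right_mono add_mono mult_mono small \<rho>B order_refl)
            show "cq * cq * \<eta> \<le> L / 8" using cq by (simp add: \<eta>_def)
            show "0 \<le> \<rho> powr ?\<kappa> * B + L" using B L by simp
          qed auto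
          finally show "cq * ?X \<le> 3 / 4 * L * t powr (- \<delta>)" by simp
        qed
        finally show "?e t \<le> ennreal (3 / 4 * L)" unfolding weak_norm_rescale[OF t(3)] .
      qed
    qed
  qed
qed

lemma weak_norm_le_time_sup: "t > 0 \<Longrightarrow> weak_norm q (u t) \<le> time_sup q u"
  unfolding time_sup_def by (intro SUP_upper) auto

lemma weighted_weak_norm_le_S_norm:
  "t > 0 \<Longrightarrow> ennreal (t powr \<delta>) * weak_norm q (u t) \<le> S_norm qc q \<delta> u"
  unfolding S_norm_def by (intro add_increasing SUP_upper) auto

lemma Cb_measurable: "u \<in> Cb q \<Longrightarrow> t > 0 \<Longrightarrow> u t \<in> borel_measurable lebesgue"
  by (auto simp: Cb_def Cb_pos_def weak_Lebesgue_def)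

lemma critical_exponent_facts:
  fixes n m \<alpha> p qc :: real
  assumes \<alpha>: "0 < \<alpha>" "\<alpha> < 2 * m" "2 * m < n"
    and p: "(n - \<alpha>) / (n - 2 * m) < p"
    and qc: "qc = n * (p - 1) / (2 * m - \<alpha>)"
  shows "p > 1" "qc > 0" "(p - 1) * (1 / qc) = (2 * m - \<alpha>) / n" "1 / qc < 1 - 2 * m / n" "1 / qc > 0"
proof -
  have n: "n > 0" using \<alpha> by simp
  have "1 < (n - \<alpha>) / (n - 2 * m)" using \<alpha> by (simp add: field_simps)
  then show p1: "p > 1" using p by simp
  then show qc0: "qc > 0" unfolding qc using \<alpha> n by simp
  then show "1 / qc > 0" by simp
  show "(p - 1) * (1 / qc) = (2 * m - \<alpha>) / n" unfolding qc using p1 \<alpha> n by (simp add: field_simps)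
  have "n - \<alpha> < p * (n - 2 * m)" using p \<alpha> by (simp add: field_simps)
  then have "2 * m - \<alpha> < (p - 1) * (n - 2 * m)" by (simp add: algebra_simps)
  then have "(2 * m - \<alpha>) / (p - 1) < n - 2 * m" using p1 by (simp add: pos_divide_less_eq mult.commute)
  then have "(2 * m - \<alpha>) / (p - 1) / n < (n - 2 * m) / n" using n by (rule divide_strict_right_mono)
  moreover have "1 / qc = (2 * m - \<alpha>) / (p - 1) / n" unfolding qc by simp
  moreover have "(n - 2 * m) / n = 1 - 2 * m / n" using n by (simp add: field_simps)
  ultimately show "1 / qc < 1 - 2 * m / n" by simp
qed

text \<open>With \<open>X = 1/q\<^sub>c\<close> and \<open>Y = 1/q\<close> every claim is linear in \<open>X\<close> and \<open>Y\<close>. The upper bound on \<open>q\<close> is exactly \<open>\<delta> p < 1\<close>,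
integrability of \<open>\<tau>\<^bsup>-\<delta>p\<^esup>\<close> at \<open>0\<close>; the bound \<open>q > q\<^sub>c\<close> gives \<open>\<delta> > 0\<close>, which keeps the smoothing exponent below \<open>1\<close>.\<close>

lemma subcritical_exponent_facts:
  fixes n m \<alpha> p qc q \<delta> :: real
  assumes \<alpha>: "0 < \<alpha>" "\<alpha> < 2 * m" "2 * m < n"
    and p: "(n - \<alpha>) / (n - 2 * m) < p"
    and qc: "qc = n * (p - 1) / (2 * m - \<alpha>)"
    and p2: "p < 2 * m / \<alpha>" and q: "qc < q" "q < n * p * (p - 1) / (2 * m - \<alpha> * p)"
    and \<delta>: "\<delta> = n / (2 * m) * (1 / qc - 1 / q)"
  defines "R \<equiv> p / q + \<alpha> / n"
  shows "0 < R" "R < 1" "1 / q \<le> R" "\<delta> > 0" "\<delta> * p < 1"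
    "n / (2 * m) * (R - 1 / q) + \<delta> * p = 1 + \<delta>" "n / (2 * m) * (R - 1 / q) < 1" "q > 0"
proof -
  note facts = critical_exponent_facts[OF \<alpha> p qc]
  have n: "n > 0" and m: "m > 0" using \<alpha> by auto
  show q0: "q > 0" using facts(2) q by simp
  define X Y where "X = 1 / qc" and "Y = 1 / q"
  have XY: "0 < Y" "Y < X" using q0 facts(2) q by (auto simp: X_def Y_def field_simps)
  have X: "(p - 1) * X = (2 * m - \<alpha>) / n" "X < 1 - 2 * m / n" using facts unfolding X_def by auto
  have p1: "p > 1" by (rule facts(1))
  have R: "R = p * Y + \<alpha> / n" by (simp add: R_def Y_def)
  have \<delta>': "\<delta> = n / (2 * m) * (X - Y)" by (simp add: \<delta> X_def Y_def)
  have an: "\<alpha> / n > 0" using \<alpha> n by simp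
  show "0 < R" unfolding R using XY p1 an by (simp add: add_pos_pos)
  have "p * Y < p * X" using XY p1 by simp
  moreover have "p * X + \<alpha> / n = X + 2 * m / n"
  proof -
    have "p * X = X + (2 * m - \<alpha>) / n" using X(1) by (simp add: algebra_simps)
    then show ?thesis by (simp add: diff_divide_distrib)
  qed
  ultimately show "R < 1" unfolding R using X(2) by linarith
  have "1 * Y \<le> p * Y" using XY p1 by (intro mult_right_mono) auto
  then show "1 / q \<le> R" unfolding R Y_def[symmetric] using an by linarith
  show \<delta>0: "\<delta> > 0" unfolding \<delta>' using XY n m by simp
  have pos: "2 * m - \<alpha> * p > 0" using p2 \<alpha> by (simp add: field_simps)
  have "(2 * m - \<alpha> * p) / (n * p * (p - 1)) < Y"
  proof -
    have "q * (2 * m - \<alpha> * p) < n * p * (p - 1)" using q(2) pos by (simp add: pos_less_divide_eq)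
    then show ?thesis unfolding Y_def using q0 n p1 by (simp add: field_simps)
  qed
  then have "p * ((2 * m - \<alpha> * p) / (n * p * (p - 1))) < p * Y"
    by (rule mult_strict_left_mono) (use p1 in simp)
  moreover have "p * ((2 * m - \<alpha> * p) / (n * p * (p - 1))) = (2 * m - \<alpha> * p) / (n * (p - 1))" using p1 by simp
  ultimately have pY: "(2 * m - \<alpha> * p) / (n * (p - 1)) < p * Y" by simp
  have "p * X = p * (2 * m - \<alpha>) / (n * (p - 1))" unfolding X_def qc by simp
  then have "p * X - (2 * m - \<alpha> * p) / (n * (p - 1)) = (p * (2 * m - \<alpha>) - (2 * m - \<alpha> * p)) / (n * (p - 1))"
    by (simp add: diff_divide_distrib)
  also have "p * (2 * m - \<alpha>) - (2 * m - \<alpha> * p) = 2 * m * (p - 1)" by (simp add: algebra_simps)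
  also have "2 * m * (p - 1) / (n * (p - 1)) = 2 * m / n" using p1 by simp
  finally have "p * X - p * Y < 2 * m / n" using pY by linarith
  then have "n / (2 * m) * (p * X - p * Y) < n / (2 * m) * (2 * m / n)"
    using n m by (intro mult_strict_left_mono) auto
  also have "\<dots> = 1" using n m by simp
  finally show "\<delta> * p < 1" unfolding \<delta>' by (simp add: algebra_simps)
  have key: "n / (2 * m) * (R - Y) + \<delta> * (p - 1) = 1"
  proof -
    have "n / (2 * m) * (R - Y) + \<delta> * (p - 1) = n / (2 * m) * ((p - 1) * X + \<alpha> / n)"
    proof -
      have "k * (p * Y + g - Y) + k * (X - Y) * (p - 1) = k * ((p - 1) * X + g)" for k g :: real
        by (simp add: algebra_simps)
      then show ?thesis unfolding R \<delta>' .
    qed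
    also have "(p - 1) * X + \<alpha> / n = 2 * m / n" unfolding X(1) by (simp add: diff_divide_distrib)
    finally show ?thesis using n m by simp
  qed
  then show "n / (2 * m) * (R - 1 / q) + \<delta> * p = 1 + \<delta>" unfolding Y_def by (simp add: algebra_simps)
  have "\<delta> * (p - 1) > 0" using \<delta>0 p1 by simp
  with key show "n / (2 * m) * (R - 1 / q) < 1" unfolding Y_def by linarith
qed

theorem theorem5p6:
  fixes m \<alpha> p C n q\<^sub>c :: real and F :: "real \<Rightarrow> real"
  assumes n_def: "n = real CARD('n::finite)"
    and m: "(0 < m \<and> m < 1) \<or> m \<in> \<nat>"
    and \<alpha>: "0 < \<alpha>" "\<alpha> < 2 * m" "2 * m < n"
    and p: "(n - \<alpha>) / (n - 2 * m) < p"
    and qc: "q\<^sub>c = n * (p - 1) / (2 * m - \<alpha>)"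
    and F0: "F 0 = 0"
    and C: "C > 0"
    and F: "\<And>a b. \<bar>F a - F b\<bar> \<le> C * \<bar>a - b\<bar> * (\<bar>a\<bar> powr (p - 1) + \<bar>b\<bar> powr (p - 1))"
  shows
    "\<forall>K>0. \<exists>\<epsilon>>0.
       (\<forall>(u\<^sub>0 :: real ^ 'n \<Rightarrow> real) v\<^sub>0 u v.
          u\<^sub>0 \<in> weak_Lebesgue q\<^sub>c \<longrightarrow> weak_norm q\<^sub>c u\<^sub>0 < ennreal \<epsilon> \<longrightarrow>
          v\<^sub>0 \<in> weak_Lebesgue q\<^sub>c \<longrightarrow> weak_norm q\<^sub>c v\<^sub>0 < ennreal \<epsilon> \<longrightarrow>
          u \<in> Cb q\<^sub>c \<longrightarrow> mild_solution m \<alpha> F u\<^sub>0 u \<longrightarrow> time_sup q\<^sub>c u \<le> ennreal (2 * (K * \<epsilon>)) \<longrightarrow>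
          v \<in> Cb q\<^sub>c \<longrightarrow> mild_solution m \<alpha> F v\<^sub>0 v \<longrightarrow> time_sup q\<^sub>c v \<le> ennreal (2 * (K * \<epsilon>)) \<longrightarrow>
          ((\<lambda>t. weak_norm q\<^sub>c (heat m t (\<lambda>x. u\<^sub>0 x - v\<^sub>0 x))) \<longlongrightarrow> 0) at_top \<longrightarrow>
          ((\<lambda>t. weak_norm q\<^sub>c (\<lambda>x. u t x - v t x)) \<longlongrightarrow> 0) at_top)
     \<and> (2 * m + \<alpha> < n \<longrightarrow> p < 2 * m / \<alpha> \<longrightarrow>
        (\<forall>q \<delta>. q\<^sub>c < q \<longrightarrow> q < n * p * (p - 1) / (2 * m - \<alpha> * p) \<longrightarrow>
           \<delta> = n / (2 * m) * (1 / q\<^sub>c - 1 / q) \<longrightarrow>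
           (\<forall>K\<^sub>q>0. \<exists>\<epsilon>\<^sub>q. 0 < \<epsilon>\<^sub>q \<and> \<epsilon>\<^sub>q < \<epsilon> \<and>
              (\<forall>(u\<^sub>0 :: real ^ 'n \<Rightarrow> real) v\<^sub>0 u v.
                 u\<^sub>0 \<in> weak_Lebesgue q\<^sub>c \<longrightarrow> weak_norm q\<^sub>c u\<^sub>0 < ennreal \<epsilon>\<^sub>q \<longrightarrow>
                 v\<^sub>0 \<in> weak_Lebesgue q\<^sub>c \<longrightarrow> weak_norm q\<^sub>c v\<^sub>0 < ennreal \<epsilon>\<^sub>q \<longrightarrow>
                 u \<in> S_space q\<^sub>c q \<delta> \<longrightarrow> mild_solution m \<alpha> F u\<^sub>0 u \<longrightarrow>
                 S_norm q\<^sub>c q \<delta> u \<le> ennreal (2 * (K\<^sub>q * \<epsilon>\<^sub>q)) \<longrightarrow>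
                 v \<in> S_space q\<^sub>c q \<delta> \<longrightarrow> mild_solution m \<alpha> F v\<^sub>0 v \<longrightarrow>
                 S_norm q\<^sub>c q \<delta> v \<le> ennreal (2 * (K\<^sub>q * \<epsilon>\<^sub>q)) \<longrightarrow>
                 ((\<lambda>t. ennreal (t powr \<delta>) * weak_norm q (heat m t (\<lambda>x. u\<^sub>0 x - v\<^sub>0 x))) \<longlongrightarrow> 0) at_top \<longrightarrow>
                 ((\<lambda>t. ennreal (t powr \<delta>) * weak_norm q (\<lambda>x. u t x - v t x)) \<longlongrightarrow> 0) at_top))))"
proof -
  note facts = critical_exponent_facts[OF \<alpha> p qc]
  have n0: "n > 0" and m0: "m > 0" using \<alpha> by auto
  have m': "(0 < m \<and> m < 1) \<or> (m \<in> \<nat> \<and> 0 < m)" using m m0 by auto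
  have p1: "p > 1" by (rule facts(1))
  have qc1: "q\<^sub>c > 1"
  proof -
    have "1 / q\<^sub>c < 1" using facts(4) n0 m0 by (smt (verit) divide_pos_pos)
    then show ?thesis using facts(2) by (simp add: field_simps)
  qed
  define r where "r = 1 / (p / q\<^sub>c + \<alpha> / n)"
  have r': "1 / r = p / q\<^sub>c + \<alpha> / n" by (simp add: r_def)
  have r'': "1 / r = 1 / q\<^sub>c + 2 * m / n"
  proof -
    have "p * x = x + (p - 1) * x" for x by (simp add: algebra_simps)
    then have "p * (1 / q\<^sub>c) = 1 / q\<^sub>c + (2 * m - \<alpha>) / n" unfolding facts(3)[symmetric] .
    then show ?thesis unfolding r' by (simp add: diff_divide_distrib)
  qed
  have mn: "2 * m / n > 0" using n0 m0 by simp
  have rinv: "0 < 1 / r" "1 / r < 1" "1 / q\<^sub>c \<le> 1 / r" unfolding r'' using facts(4) facts(5) mn by linarith+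
  have r0: "r > 0" using rinv(1) by simp
  have r1: "r > 1" using rinv(2) r0 by (simp add: field_simps)
  have rq: "r \<le> q\<^sub>c" using rinv(3) r0 facts(2) by (simp add: field_simps)
  have scaling: "real CARD('n) / (2 * m) * (1 / r - 1 / q\<^sub>c) + 0 * p = 1 + 0"
    unfolding r'' n_def[symmetric] using n0 m0 by simp
  obtain M0 where M0: "M0 > 0" and crit: "\<And>(u0 :: real ^ 'n \<Rightarrow> real) v0 u v. small_mild_pair m \<alpha> F q\<^sub>c 0 M0 u0 v0 u v \<Longrightarrow>
     ((\<lambda>t. ennreal (t powr 0) * weak_norm q\<^sub>c (heat m t (\<lambda>x. u0 x - v0 x))) \<longlongrightarrow> 0) at_top \<Longrightarrow>
     ((\<lambda>t. ennreal (t powr 0) * weak_norm q\<^sub>c (\<lambda>x. u t x - v t x)) \<longlongrightarrow> 0) at_top"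
    using mild_solutions_asymptotic[OF m' p1 \<alpha>(1) C F0 F r1 rq r'[unfolded n_def] order_refl _ scaling disjI2[OF refl]]
    by (simp only: mult_zero_left zero_less_one) blast
  have data: "w \<in> borel_measurable lebesgue" "weak_type q\<^sub>c e (eabs w)"
    if "w \<in> weak_Lebesgue q\<^sub>c" "weak_norm q\<^sub>c w < ennreal e" "e > 0" for w :: "real ^ 'n \<Rightarrow> real" and e
  proof -
    show "w \<in> borel_measurable lebesgue" using that by (simp add: weak_Lebesgue_def)
    then show "weak_type q\<^sub>c e (eabs w)"
      using that facts(2) by (intro weak_type_of_weak_norm) auto
  qed
  have tp: "(ennreal (t powr 0) * weak_norm q\<^sub>c w) = weak_norm q\<^sub>c w" if "t > 0" for t and w :: "real ^ 'n \<Rightarrow> real"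
    using that by simp
  have tendsto_tp: "((\<lambda>t. ennreal (t powr 0) * weak_norm q\<^sub>c (w t)) \<longlongrightarrow> 0) at_top \<longleftrightarrow> ((\<lambda>t. weak_norm q\<^sub>c (w t)) \<longlongrightarrow> 0) at_top"
    for w :: "real \<Rightarrow> real ^ 'n \<Rightarrow> real"
    by (rule tendsto_cong) (rule eventually_mono[OF eventually_gt_at_top[of 0]], rule tp)
  show ?thesis (is "\<forall>K>0. \<exists>\<epsilon>>0. ?crit K \<epsilon> \<and> (_ \<longrightarrow> _ \<longrightarrow> (\<forall>q \<delta>. _ q \<longrightarrow> _ q \<longrightarrow> _ q \<delta> \<longrightarrow>
      (\<forall>Kq>0. \<exists>\<epsilon>q. 0 < \<epsilon>q \<and> \<epsilon>q < \<epsilon> \<and> ?sub q \<delta> Kq \<epsilon>q)))")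
  proof (intro allI impI)
    fix K :: real assume K: "K > 0"
    define \<epsilon> where "\<epsilon> = M0 / (2 * K)"
    have \<epsilon>: "\<epsilon> > 0" "2 * (K * \<epsilon>) = M0" using M0 K by (auto simp: \<epsilon>_def)
    have sub: "\<exists>\<epsilon>\<^sub>q. 0 < \<epsilon>\<^sub>q \<and> \<epsilon>\<^sub>q < \<epsilon> \<and> ?sub q \<delta> K\<^sub>q \<epsilon>\<^sub>q"
      if p2: "p < 2 * m / \<alpha>" and q: "q\<^sub>c < q" "q < n * p * (p - 1) / (2 * m - \<alpha> * p)"
        and \<delta>: "\<delta> = n / (2 * m) * (1 / q\<^sub>c - 1 / q)" and Kq: "0 < K\<^sub>q" for q \<delta> K\<^sub>q
    proof -
      note sfacts = subcritical_exponent_facts[OF \<alpha> p qc p2 q \<delta>]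
      define s where "s = 1 / (p / q + \<alpha> / n)"
      have s': "1 / s = p / q + \<alpha> / n" by (simp add: s_def)
      have s0: "s > 0" using sfacts(1) by (simp add: s_def)
      have s1: "s > 1" using sfacts(1,2) by (simp add: s_def)
      have sq: "s \<le> q" using sfacts(3) s0 sfacts(8) unfolding s'[symmetric] by (simp add: field_simps)
      have \<delta>0: "\<delta> \<ge> 0" using sfacts(4) by simp
      have sc: "real CARD('n) / (2 * m) * (1 / s - 1 / q) + \<delta> * p = 1 + \<delta>"
        and sub: "real CARD('n) / (2 * m) * (1 / s - 1 / q) < 1 \<or> \<delta> = 0"
        using sfacts(6,7) unfolding s' n_def by auto
      obtain M1 where M1: "M1 > 0" and subcrit: "\<And>M (u0 :: real ^ 'n \<Rightarrow> real) v0 u v. 0 < M \<Longrightarrow> M \<le> M1 \<Longrightarrow>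
         small_mild_pair m \<alpha> F q \<delta> M u0 v0 u v \<Longrightarrow>
         ((\<lambda>t. ennreal (t powr \<delta>) * weak_norm q (heat m t (\<lambda>x. u0 x - v0 x))) \<longlongrightarrow> 0) at_top \<Longrightarrow>
         ((\<lambda>t. ennreal (t powr \<delta>) * weak_norm q (\<lambda>x. u t x - v t x)) \<longlongrightarrow> 0) at_top"
        using mild_solutions_asymptotic[OF m' p1 \<alpha>(1) C F0 F s1 sq s'[unfolded n_def] \<delta>0 sfacts(5) sc sub]
        by blast
      define \<epsilon>' where "\<epsilon>' = min (\<epsilon> / 2) (M1 / (2 * K\<^sub>q))"
      have \<epsilon>': "0 < \<epsilon>'" "\<epsilon>' < \<epsilon>" using \<epsilon>(1) M1 Kq by (auto simp: \<epsilon>'_def)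
      have "\<epsilon>' \<le> M1 / (2 * K\<^sub>q)" by (simp add: \<epsilon>'_def)
      then have M': "0 < 2 * (K\<^sub>q * \<epsilon>')" "2 * (K\<^sub>q * \<epsilon>') \<le> M1"
        using Kq \<epsilon>'(1) by (simp_all add: field_simps)
      show ?thesis
      proof (intro exI[of _ \<epsilon>'] conjI allI impI \<epsilon>')
        fix u0 v0 :: "real ^ 'n \<Rightarrow> real" and u v
        assume u0: "u0 \<in> weak_Lebesgue q\<^sub>c" "weak_norm q\<^sub>c u0 < ennreal \<epsilon>'"
          and v0: "v0 \<in> weak_Lebesgue q\<^sub>c" "weak_norm q\<^sub>c v0 < ennreal \<epsilon>'"
          and u: "u \<in> S_space q\<^sub>c q \<delta>" "mild_solution m \<alpha> F u0 u" "S_norm q\<^sub>c q \<delta> u \<le> ennreal (2 * (K\<^sub>q * \<epsilon>'))"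
          and v: "v \<in> S_space q\<^sub>c q \<delta>" "mild_solution m \<alpha> F v0 v" "S_norm q\<^sub>c q \<delta> v \<le> ennreal (2 * (K\<^sub>q * \<epsilon>'))"
          and lin: "((\<lambda>t. ennreal (t powr \<delta>) * weak_norm q (heat m t (\<lambda>x. u0 x - v0 x))) \<longlongrightarrow> 0) at_top"
        have small: "w t \<in> borel_measurable lebesgue \<and> weak_type q (2 * (K\<^sub>q * \<epsilon>') * t powr (- \<delta>)) (eabs (w t))"
          if w: "w \<in> S_space q\<^sub>c q \<delta>" "S_norm q\<^sub>c q \<delta> w \<le> ennreal (2 * (K\<^sub>q * \<epsilon>'))" and t: "t > 0" for w :: "real \<Rightarrow> real ^ 'n \<Rightarrow> real" and t
        proof
          show wm: "w t \<in> borel_measurable lebesgue"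
            using w(1) t by (intro Cb_measurable) (auto simp: S_space_def)
          have "ennreal (t powr \<delta>) * weak_norm q (w t) \<le> ennreal (2 * (K\<^sub>q * \<epsilon>'))"
            by (rule order_trans[OF weighted_weak_norm_le_S_norm[OF t] w(2)])
          then have "weak_norm q (w t) \<le> ennreal (2 * (K\<^sub>q * \<epsilon>') * t powr (- \<delta>))"
            unfolding weak_norm_rescale[OF t] .
          then show "weak_type q (2 * (K\<^sub>q * \<epsilon>') * t powr (- \<delta>)) (eabs (w t))"
            using M' by (intro weak_type_of_weak_norm wm sfacts(8)) auto
        qed
        show "((\<lambda>t. ennreal (t powr \<delta>) * weak_norm q (\<lambda>x. u t x - v t x)) \<longlongrightarrow> 0) at_top"
        proof (rule subcrit[OF M' _ lin])
          show "small_mild_pair m \<alpha> F q \<delta> (2 * (K\<^sub>q * \<epsilon>')) u0 v0 u v"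
            unfolding small_mild_pair_def
            using qc1 \<epsilon>'(1) data[OF u0 \<epsilon>'(1)] data[OF v0 \<epsilon>'(1)] small[OF u(1,3)] small[OF v(1,3)] u(2) v(2) by auto
        qed
      qed
    qed
    have "?crit K \<epsilon>"
    proof (intro allI impI)
      fix u0 v0 :: "real ^ 'n \<Rightarrow> real" and u v
      assume u0: "u0 \<in> weak_Lebesgue q\<^sub>c" "weak_norm q\<^sub>c u0 < ennreal \<epsilon>"
        and v0: "v0 \<in> weak_Lebesgue q\<^sub>c" "weak_norm q\<^sub>c v0 < ennreal \<epsilon>"
        and u: "u \<in> Cb q\<^sub>c" "mild_solution m \<alpha> F u0 u" "time_sup q\<^sub>c u \<le> ennreal (2 * (K * \<epsilon>))"
        and v: "v \<in> Cb q\<^sub>c" "mild_solution m \<alpha> F v0 v" "time_sup q\<^sub>c v \<le> ennreal (2 * (K * \<epsilon>))"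
        and lin: "((\<lambda>t. weak_norm q\<^sub>c (heat m t (\<lambda>x. u0 x - v0 x))) \<longlongrightarrow> 0) at_top"
      have small: "w t \<in> borel_measurable lebesgue \<and> weak_type q\<^sub>c (M0 * t powr (- 0)) (eabs (w t))"
        if w: "w \<in> Cb q\<^sub>c" "time_sup q\<^sub>c w \<le> ennreal (2 * (K * \<epsilon>))" and t: "t > 0" for w :: "real \<Rightarrow> real ^ 'n \<Rightarrow> real" and t
      proof
        show wm: "w t \<in> borel_measurable lebesgue" by (rule Cb_measurable[OF w(1) t])
        have "weak_norm q\<^sub>c (w t) \<le> ennreal M0"
          using order_trans[OF weak_norm_le_time_sup[OF t] w(2)] unfolding \<epsilon>(2) .
        then show "weak_type q\<^sub>c (M0 * t powr (- 0)) (eabs (w t))"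
          using weak_type_of_weak_norm[OF wm _ _ facts(2), of M0] M0 t by simp
      qed
      show "((\<lambda>t. weak_norm q\<^sub>c (\<lambda>x. u t x - v t x)) \<longlongrightarrow> 0) at_top"
        unfolding tendsto_tp[symmetric]
      proof (rule crit)
        show "small_mild_pair m \<alpha> F q\<^sub>c 0 M0 u0 v0 u v"
          unfolding small_mild_pair_def
          using qc1 \<epsilon>(1) data[OF u0 \<epsilon>(1)] data[OF v0 \<epsilon>(1)] small[OF u(1,3)] small[OF v(1,3)] u(2) v(2) by auto
      qed (use lin in \<open>simp only: tendsto_tp\<close>)
    qed
    with \<epsilon>(1) sub show "\<exists>\<epsilon>>0. ?crit K \<epsilon> \<and> (2 * m + \<alpha> < n \<longrightarrow> p < 2 * m / \<alpha> \<longrightarrow>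
        (\<forall>q \<delta>. q\<^sub>c < q \<longrightarrow> q < n * p * (p - 1) / (2 * m - \<alpha> * p) \<longrightarrow> \<delta> = n / (2 * m) * (1 / q\<^sub>c - 1 / q) \<longrightarrow>
           (\<forall>K\<^sub>q>0. \<exists>\<epsilon>\<^sub>q. 0 < \<epsilon>\<^sub>q \<and> \<epsilon>\<^sub>q < \<epsilon> \<and> ?sub q \<delta> K\<^sub>q \<epsilon>\<^sub>q)))"
      by (intro exI[of _ \<epsilon>] conjI) (assumption | blast)+
  qed
qed

end
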